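(* There is a randomized algorithm which, given a real $n\times d$ matrix $A$, a vector $b\in\mathbb{R}^n$ and $\varepsilon\in(0,1)$, outputs with probability at least $99/100$ a vector $x\in\mathbb{R}^d$ with $$\|Ax-b\|_2\le(1+\varepsilon)\min_{x'\in\mathbb{R}^d}\|Ax'-b\|_2,$$ in time $O(\mathrm{nnz}(A)\log(n/\varepsilon)+d^3\log^2 d+d^2\log(1/\varepsilon))$.
   Context: $\mathrm{nnz}(A)$ is the number of nonzero entries of $A$; $\|\cdot\|_2$ is the Euclidean norm. *)

theory Defs
  imports
    "HOL-Probability.Probability_Mass_Function"
    "HOL-Analysis.L2_Norm"
    "Jordan_Normal_Form.Matrix"
begin

unbundle no vec_syntax

section \<open>Least squares\<close>

definition norm2 :: "real vec \<Rightarrow> real" where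
  "norm2 v = L2_set (\<lambda>i. v $ i) {..<dim_vec v}"

definition nnz :: "real mat \<Rightarrow> nat" where
  "nnz A = card {(i, j). i < dim_row A \<and> j < dim_col A \<and> A $$ (i, j) \<noteq> 0}"

text \<open>The infimum below is a minimum: it is the distance from \<open>b\<close> to the column space of \<open>A\<close>.\<close>

definition least_residual :: "real mat \<Rightarrow> real vec \<Rightarrow> real" where
  "least_residual A b = (INF x \<in> carrier_vec (dim_col A). norm2 (A *\<^sub>v x - b))"

definition approx_solution :: "real mat \<Rightarrow> real vec \<Rightarrow> real \<Rightarrow> real vec \<Rightarrow> bool" where
  "approx_solution A b \<epsilon> x \<longleftrightarrow>
     x \<in> carrier_vec (dim_col A) \<and> norm2 (A *\<^sub>v x - b) \<le> (1 + \<epsilon>) * least_residual A b"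

section \<open>A randomized real RAM\<close>

text \<open>
  An algorithm is one program, independent of the input, for a random access machine with two
  separate memories. One holds machine words (natural numbers, used for indexing and as random
  numbers), the other holds exact real numbers. Both are organised as named arrays; a scalar
  variable is cell \<open>0\<close> of an array. As a program mentions finitely many names, this is an ordinary
  RAM with interleaved arrays.

  The real memory only supports field operations and comparisons. Words can be converted to reals,
  but there is no rounding of reals to words, and the only real constants are those computed from
  natural numbers, so reals cannot be used to pack information. Division follows the HOL convention
  \<open>x / 0 = 0\<close> (programs can test divisors themselves), and subtraction of words is truncated.
\<close>

type_synonym name = string

datatype iexp =
    INum nat
  | IRead name iexp
  | IAdd iexp iexp
  | ISub iexp iexp
  | IMul iexp iexp
  | IDiv iexp iexp
  | IMod iexp iexp

datatype rexp =
    ROfNat iexp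
  | RRead name iexp
  | RAdd rexp rexp
  | RSub rexp rexp
  | RMul rexp rexp
  | RDiv rexp rexp

datatype bexp =
    ILess iexp iexp
  | RLess rexp rexp
  | BNot bexp
  | BAnd bexp bexp

text \<open>
  \<open>IWrite x e f\<close> and \<open>RWrite x e f\<close> store the value of \<open>f\<close> in cell \<open>e\<close> of the array \<open>x\<close>;
  \<open>Draw x e f\<close> stores there a fresh, uniformly distributed random word below the value of \<open>f\<close>.
\<close>

datatype com =
    Skip
  | IWrite name iexp iexp
  | RWrite name iexp rexp
  | Draw name iexp iexp
  | Seq com com
  | If bexp com com
  | While bexp com

record memory =
  words :: "name \<Rightarrow> nat \<Rightarrow> nat"
  reals :: "name \<Rightarrow> nat \<Rightarrow> real"

fun ival :: "iexp \<Rightarrow> memory \<Rightarrow> nat" where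
  "ival (INum k) m = k"
| "ival (IRead x e) m = words m x (ival e m)"
| "ival (IAdd e f) m = ival e m + ival f m"
| "ival (ISub e f) m = ival e m - ival f m"
| "ival (IMul e f) m = ival e m * ival f m"
| "ival (IDiv e f) m = ival e m div ival f m"
| "ival (IMod e f) m = ival e m mod ival f m"

fun rval :: "rexp \<Rightarrow> memory \<Rightarrow> real" where
  "rval (ROfNat e) m = real (ival e m)"
| "rval (RRead x e) m = reals m x (ival e m)"
| "rval (RAdd e f) m = rval e m + rval f m"
| "rval (RSub e f) m = rval e m - rval f m"
| "rval (RMul e f) m = rval e m * rval f m"
| "rval (RDiv e f) m = rval e m / rval f m"

fun bval :: "bexp \<Rightarrow> memory \<Rightarrow> bool" where
  "bval (ILess e f) m \<longleftrightarrow> ival e m < ival f m"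
| "bval (RLess e f) m \<longleftrightarrow> rval e m < rval f m"
| "bval (BNot b) m \<longleftrightarrow> \<not> bval b m"
| "bval (BAnd b c) m \<longleftrightarrow> bval b m \<and> bval c m"

definition write_word :: "name \<Rightarrow> nat \<Rightarrow> nat \<Rightarrow> memory \<Rightarrow> memory" where
  "write_word x i v m = m\<lparr>words := (words m)(x := (words m x)(i := v))\<rparr>"

definition write_real :: "name \<Rightarrow> nat \<Rightarrow> real \<Rightarrow> memory \<Rightarrow> memory" where
  "write_real x i v m = m\<lparr>reals := (reals m)(x := (reals m x)(i := v))\<rparr>"

text \<open>
  A configuration is the stack of commands still to be executed together with the memory; \<open>None\<close> is
  a fault. The parameter \<open>W\<close> is the largest machine word: storing a larger word, or drawing a random
  word from an empty range or from a range of more than \<open>W\<close> values, is a fault. Every step costs one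
  time unit. The expressions in a step have a size fixed by the program, so charging each arithmetic
  operation would change the time by a constant factor only.
\<close>

type_synonym config = "(com list \<times> memory) option"

fun step :: "nat \<Rightarrow> com list \<times> memory \<Rightarrow> config pmf" where
  "step W ([], m) = return_pmf (Some ([], m))"
| "step W (Skip # cs, m) = return_pmf (Some (cs, m))"
| "step W (IWrite x e f # cs, m) =
     return_pmf (if ival f m \<le> W then Some (cs, write_word x (ival e m) (ival f m) m) else None)"
| "step W (RWrite x e f # cs, m) =
     return_pmf (Some (cs, write_real x (ival e m) (rval f m) m))"
| "step W (Draw x e f # cs, m) =
     (if 0 < ival f m \<and> ival f m \<le> W
      then map_pmf (\<lambda>v. Some (cs, write_word x (ival e m) v m)) (pmf_of_set {..<ival f m})
      else return_pmf None)"
| "step W (Seq c d # cs, m) = return_pmf (Some (c # d # cs, m))"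
| "step W (If b c d # cs, m) = return_pmf (Some ((if bval b m then c else d) # cs, m))"
| "step W (While b c # cs, m) =
     return_pmf (Some (if bval b m then c # While b c # cs else cs, m))"

fun run :: "nat \<Rightarrow> nat \<Rightarrow> config \<Rightarrow> config pmf" where
  "run W 0 c = return_pmf c"
| "run W (Suc t) c =
     bind_pmf (case c of None \<Rightarrow> return_pmf None | Some c' \<Rightarrow> step W c') (run W t)"

definition outcome :: "nat \<Rightarrow> nat \<Rightarrow> com \<Rightarrow> memory \<Rightarrow> config pmf" where
  "outcome W t P m = run W t (Some ([P], m))"

text \<open>Worst case over all random choices; halting configurations are left unchanged by \<^const>\<open>step\<close>.\<close>

definition halts_within :: "nat \<Rightarrow> nat \<Rightarrow> com \<Rightarrow> memory \<Rightarrow> bool" where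
  "halts_within W t P m \<longleftrightarrow> (\<forall>c \<in> set_pmf (outcome W t P m). \<exists>m'. c = Some ([], m'))"

section \<open>Input and output\<close>

text \<open>
  The matrix is given in sparse form, as a list of the positions of its nonzero entries, each
  occurring once, in an arbitrary order.
\<close>

definition lists_nonzeros :: "(nat \<times> nat) list \<Rightarrow> real mat \<Rightarrow> bool" where
  "lists_nonzeros ps A \<longleftrightarrow> distinct ps \<and>
     set ps = {(i, j). i < dim_row A \<and> j < dim_col A \<and> A $$ (i, j) \<noteq> 0}"

definition cells :: "'a::zero list \<Rightarrow> nat \<Rightarrow> 'a" where
  "cells xs i = (if i < length xs then xs ! i else 0)"

text \<open>All memory cells that do not hold the input are initially zero.\<close>

definition input_memory :: "(nat \<times> nat) list \<Rightarrow> real mat \<Rightarrow> real vec \<Rightarrow> real \<Rightarrow> memory" where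
  "input_memory ps A b \<epsilon> =
     \<lparr>words = (\<lambda>_ _. 0)
        (''n'' := cells [dim_row A], ''d'' := cells [dim_col A], ''nnz'' := cells [length ps],
         ''row'' := cells (map fst ps), ''col'' := cells (map snd ps)),
      reals = (\<lambda>_ _. 0)
        (''val'' := cells (map (\<lambda>p. A $$ p) ps), ''b'' := cells (list_of_vec b),
         ''eps'' := cells [\<epsilon>])\<rparr>"

definition output_vector :: "nat \<Rightarrow> memory \<Rightarrow> real vec" where
  "output_vector d m = vec d (reals m ''x'')"

end

theory Submission
  imports Defs "HOL-Probability.Product_PMF" "HOL-Probability.Hoeffding"
begin

unbundle no vec_syntax

text \<open>
  Put \<open>D = d + 1\<close> and append \<open>b\<close> to \<open>A\<close> as an extra column. A CountSketch hashes the nonzero rows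
  of \<open>[A b]\<close> with random signs into \<open>N = O(D^2)\<close> buckets, which preserves all norms on the column
  space by a second moment estimate. A Hadamard transform of the buckets then makes all rows small
  relative to the column space, by Hoeffding, so that \<open>m = O(D log^2 D)\<close> uniformly sampled rows
  still give a spectral approximation \<open>G\<close> of \<open>[A b]\<^sup>T [A b]\<close>. This last step needs a bound on the
  operator norm of a sum of independent random matrices; it is obtained from the trace of a high
  power by exchangeable pairs, with Cauchy--Schwarz replacing the spectral theorem.

  Gram--Schmidt with respect to the form \<open>G\<close> yields a generalised inverse \<open>P\<close> of the block of \<open>G\<close>
  that belongs to \<open>A\<close>, and the minimiser of the sketched problem. Starting there, the iteration
  \<open>x := x + P A\<^sup>T (b - A x)\<close> contracts the squared distance to the optimum by \<open>2/3\<close>, so that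
  \<open>O(log (1/\<epsilon>))\<close> rounds of cost \<open>O(nnz(A) + d^2)\<close> suffice.
\<close>

section \<open>Traces of powers of symmetric matrices\<close>

text \<open>Forming the sampled Gram matrix costs \<open>m * D^2\<close>, so the term d^3 log^2 d
  leaves room for only about D log^2 D samples. Controlling the Frobenius norm of the sampling error
  would take on the order of D^2 of them; hence the effort spent on the operator norm. One of the
  two logarithms comes from the squared row norm after flattening, the other is the order of the
  trace moment. Both are logarithms of \<open>D\<close> and not of \<open>n\<close>, because the
  rows have been hashed to O(D^2) buckets before the union bound over the transformed entries. The
  signs of the CountSketch also do the work of the random diagonal that usually precedes a Hadamard
  transform: each transformed entry is the sum of the original entries of one column with
  independent signs, whatever the collisions. No rank assumption is made, so null directions occur.
  They lie in the radical of the form in question, and the convention \<open>x / 0 = 0\<close> lets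
  them drop out of the formulas.\<close>

text \<open>A \<open>D \<times> D\<close> matrix is a function that is only inspected below \<open>D\<close>; the size varies with the
  input, so it cannot be a type.\<close>

type_synonym mtx = "nat \<Rightarrow> nat \<Rightarrow> real"

definition mmul :: "nat \<Rightarrow> mtx \<Rightarrow> mtx \<Rightarrow> mtx" where
  "mmul D X Y = (\<lambda>i j. \<Sum>k<D. X i k * Y k j)"

definition mtrace :: "nat \<Rightarrow> mtx \<Rightarrow> real" where
  "mtrace D X = (\<Sum>i<D. X i i)"

definition msupp :: "nat \<Rightarrow> mtx \<Rightarrow> bool" where
  "msupp D X \<longleftrightarrow> (\<forall>i j. i \<ge> D \<or> j \<ge> D \<longrightarrow> X i j = 0)"

definition msym :: "nat \<Rightarrow> mtx \<Rightarrow> bool" where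
  "msym D X \<longleftrightarrow> msupp D X \<and> (\<forall>i j. X i j = X j i)"

definition mtrans :: "mtx \<Rightarrow> mtx" where "mtrans X = (\<lambda>i j. X j i)"

text \<open>The zeroth power is the identity cut off at \<open>D\<close>. Matrices are compared as
  functions on all pairs of naturals, so it is neutral only for those with \<open>msupp\<close>;
  therefore \<open>msym\<close> includes the support condition.\<close>

primrec mpow :: "nat \<Rightarrow> mtx \<Rightarrow> nat \<Rightarrow> mtx" where
  "mpow D X 0 = (\<lambda>i j. if i = j \<and> i < D then 1 else 0)"
| "mpow D X (Suc n) = mmul D X (mpow D X n)"

definition mip :: "nat \<Rightarrow> mtx \<Rightarrow> mtx \<Rightarrow> real" where
  "mip D X Y = (\<Sum>i<D. \<Sum>j<D. X i j * Y i j)"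

section \<open>Matrix products, traces and Cauchy--Schwarz\<close>

lemma mmul_assoc: "mmul D (mmul D X Y) Z = mmul D X (mmul D Y Z)"
  unfolding mmul_def
  by (intro ext) (simp add: sum_distrib_left sum_distrib_right mult.assoc, rule sum.swap)

lemma mtrace_comm: "mtrace D (mmul D X Y) = mtrace D (mmul D Y X)"
  unfolding mmul_def mtrace_def by (subst sum.swap) (simp add: mult.commute)

lemma mtrans_mmul: "mtrans (mmul D X Y) = mmul D (mtrans Y) (mtrans X)"
  unfolding mmul_def mtrans_def by (simp add: mult.commute)

lemma mip_mtrace: "mip D X Y = mtrace D (mmul D (mtrans X) Y)"
  unfolding mmul_def mtrace_def mip_def mtrans_def by (rule sum.swap)

lemma mip_self_nonneg: "0 \<le> mip D X X"
  unfolding mip_def by (intro sum_nonneg) simp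

lemma mip_Cauchy_Schwarz: "(mip D X Y)\<^sup>2 \<le> mip D X X * mip D Y Y"
proof -
  have "mip D X Y = (\<Sum>p\<in>{..<D}\<times>{..<D}. case_prod X p * case_prod Y p)" for X Y
    by (simp add: mip_def sum.cartesian_product case_prod_unfold)
  then show ?thesis
    using Cauchy_Schwarz_ineq_sum[of "case_prod X" "case_prod Y" "{..<D}\<times>{..<D}"]
    by (simp add: power2_eq_square)
qed

lemma mip_AM_GM: "mip D X Y \<le> (mip D X X + mip D Y Y) / 2"
proof -
  have "0 \<le> (\<Sum>i<D. \<Sum>j<D. (X i j - Y i j)\<^sup>2)"
    by (intro sum_nonneg) simp
  also have "\<dots> = mip D X X + mip D Y Y - 2 * mip D X Y"
    by (simp add: mip_def power2_diff sum.distrib sum_subtractf sum_distrib_left power2_eq_square[symmetric] mult.assoc)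
  finally show ?thesis by simp
qed

lemma msupp_mmul: "msupp D X \<Longrightarrow> msupp D Y \<Longrightarrow> msupp D (mmul D X Y)"
  unfolding msupp_def mmul_def by auto

lemma msupp_mpow: "msupp D X \<Longrightarrow> msupp D (mpow D X n)"
  by (induction n) (auto simp: msupp_mmul, auto simp: msupp_def)

lemma mmul_one_left: "msupp D X \<Longrightarrow> mmul D (mpow D Y 0) X = X"
proof (intro ext)
  fix i j assume X: "msupp D X"
  have "mmul D (mpow D Y 0) X i j = (\<Sum>k<D. if i = k then (if i < D then X i j else 0) else 0)"
    unfolding mmul_def by (intro sum.cong) auto
  also have "\<dots> = X i j" using X by (auto simp: msupp_def)
  finally show "mmul D (mpow D Y 0) X i j = X i j" .
qed

lemma mmul_one_right: "msupp D X \<Longrightarrow> mmul D X (mpow D Y 0) = X"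
proof (intro ext)
  fix i j assume X: "msupp D X"
  have "mmul D X (mpow D Y 0) i j = (\<Sum>k<D. if j = k then (if j < D then X i j else 0) else 0)"
    unfolding mmul_def by (intro sum.cong) auto
  also have "\<dots> = X i j" using X by (auto simp: msupp_def)
  finally show "mmul D X (mpow D Y 0) i j = X i j" .
qed

lemma mpow_add: "msupp D X \<Longrightarrow> mmul D (mpow D X a) (mpow D X b) = mpow D X (a + b)"
proof (induction a)
  case 0
  then show ?case using mmul_one_left[OF msupp_mpow[OF 0], of X b] by simp
next
  case (Suc a)
  then show ?case by (simp add: mmul_assoc)
qed

lemma mpow_1: "msupp D X \<Longrightarrow> mpow D X 1 = X"
  using mmul_one_right[of D X X] by simp

lemma mpow_Suc_right: "msupp D X \<Longrightarrow> mpow D X (Suc n) = mmul D (mpow D X n) X"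
  using mpow_add[of D X n 1] mpow_1[of D X] by simp

lemma mtrans_sym: "msym D X \<Longrightarrow> mtrans X = X"
  unfolding msym_def mtrans_def by (simp add: fun_eq_iff)

lemma msym_supp: "msym D X \<Longrightarrow> msupp D X"
  by (simp add: msym_def)

lemma mtrans_mpow: assumes "msym D X" shows "mtrans (mpow D X n) = mpow D X n"
proof (induction n)
  case 0 show ?case by (auto simp: mtrans_def fun_eq_iff)
next
  case (Suc n)
  have "mtrans (mpow D X (Suc n)) = mmul D (mpow D X n) X"
    by (simp add: mtrans_mmul Suc mtrans_sym[OF assms])
  then show ?case using mpow_Suc_right[OF msym_supp[OF assms]] by simp
qed

text \<open>The traces \<open>tr (\<Delta> X^a \<Delta> Y^b)\<close> with \<open>a + b\<close> fixed are log-convex in \<open>a\<close> by Cauchy--Schwarz,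
  so the extreme values of \<open>a\<close> dominate.\<close>

definition ftr :: "nat \<Rightarrow> mtx \<Rightarrow> mtx \<Rightarrow> mtx \<Rightarrow> nat \<Rightarrow> nat \<Rightarrow> real" where
  "ftr D Z X Y a b = mtrace D (mmul D Z (mmul D (mpow D X a) (mmul D Z (mpow D Y b))))"

text \<open>Cyclicity of the trace moves the power of \<open>Y\<close> that stems from the transpose
  to the far end, where it merges with the other one. So the values of \<open>ftr\<close> are inner
  products of matrices \<open>X^a Z Y^b\<close>, which gives access to Cauchy--Schwarz.\<close>

lemma ftr_mip:
  assumes "msym D X" "msym D Y" "msym D Z"
  shows "mip D (mmul D (mpow D X a) (mmul D Z (mpow D Y b))) (mmul D (mpow D X c) (mmul D Z (mpow D Y e)))
    = ftr D Z X Y (a + c) (e + b)" (is "?l = _")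
proof -
  have "?l = mtrace D (mmul D (mpow D Y b) (mmul D Z (mmul D (mpow D X (a + c)) (mmul D Z (mpow D Y e)))))"
    using assms
    by (simp add: mip_mtrace mtrans_mmul mtrans_mpow mtrans_sym mmul_assoc
        flip: mpow_add[OF msym_supp[OF assms(1)]])
  also have "\<dots> = ftr D Z X Y (a + c) (e + b)"
    unfolding ftr_def
    by (subst mtrace_comm) (simp add: mmul_assoc flip: mpow_add[OF msym_supp[OF assms(2)]])
  finally show ?thesis .
qed

text \<open>For symmetric arguments this is the trace of \<open>Z^2 X^(2n)\<close>, written as a
  squared Frobenius norm; it is the value of \<open>ftr\<close> at the two extremes.\<close>

definition deviation :: "nat \<Rightarrow> mtx \<Rightarrow> mtx \<Rightarrow> nat \<Rightarrow> real" where
  "deviation D Z X n = mip D (mmul D Z (mpow D X n)) (mmul D Z (mpow D X n))"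

lemma ftr_0: assumes "msym D X" "msym D Y" "msym D Z"
  shows "ftr D Z X Y 0 (2 * n) = deviation D Z Y n"
  using ftr_mip[OF assms, of 0 n 0 n]
  by (simp add: mmul_one_left msupp_mmul msupp_mpow msym_supp assms deviation_def mult_2 del: mpow.simps)

lemma ftr_max: assumes "msym D X" "msym D Y" "msym D Z"
  shows "ftr D Z X Y (2 * n) 0 = deviation D Z X n"
proof -
  have "ftr D Z X Y (2 * n) 0 = mtrace D (mmul D Z (mmul D (mpow D X (2*n)) Z))"
    unfolding ftr_def by (simp add: mmul_one_right msym_supp assms del: mpow.simps)
  also have "\<dots> = mtrace D (mmul D Z (mmul D Z (mpow D X (2*n))))"
    by (metis mmul_assoc mtrace_comm)
  also have "\<dots> = ftr D Z Y X 0 (2 * n)"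
    unfolding ftr_def by (simp add: mmul_one_left msym_supp msupp_mmul msupp_mpow assms del: mpow.simps)
  finally show ?thesis using ftr_0 assms by simp
qed

text \<open>At an interior maximum the left neighbour has to be maximal as well, so the leftmost
  maximiser is an end point.\<close>

lemma log_convex_max:
  fixes g :: "nat \<Rightarrow> real"
  assumes nonneg: "\<And>a. a \<le> n \<Longrightarrow> 0 \<le> g a"
    and convex: "\<And>a. 0 < a \<Longrightarrow> a < n \<Longrightarrow> (g a)\<^sup>2 \<le> g (a - 1) * g (a + 1)"
    and "a \<le> n"
  shows "g a \<le> max (g 0) (g n)"
proof -
  define M where "M = Max (g ` {..n})"
  have le: "g b \<le> M" if "b \<le> n" for b
    using that by (auto simp: M_def intro!: Max_ge)
  have "M \<in> g ` {..n}" unfolding M_def by (intro Max_in) auto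
  then have ex: "\<exists>b. b \<le> n \<and> g b = M" by auto
  define c where "c = (LEAST b. b \<le> n \<and> g b = M)"
  have c: "c \<le> n" "g c = M" using LeastI_ex[OF ex] by (auto simp: c_def)
  have less: "g b < M" if "b < c" for b
  proof -
    have "\<not> (b \<le> n \<and> g b = M)" using not_less_Least[of b] that by (auto simp: c_def)
    then show ?thesis using le[of b] that c by force
  qed
  have "M \<le> max (g 0) (g n)"
  proof (cases "c = 0 \<or> c = n")
    case True then show ?thesis using c by auto
  next
    case False
    then have cn: "0 < c" "c < n" using c by auto
    have "M\<^sup>2 \<le> g (c - 1) * g (c + 1)" using convex[OF cn] c by simp
    also have "\<dots> \<le> g (c - 1) * M"
      using cn le[of "c + 1"] nonneg[of "c - 1"] by (intro mult_left_mono) auto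
    finally have "M * M \<le> g (c - 1) * M" by (simp add: power2_eq_square)
    moreover have "0 \<le> g (c - 1)" "g (c - 1) < M" using nonneg[of "c-1"] less[of "c - 1"] cn by auto
    ultimately show ?thesis by (simp add: mult_le_cancel_right)
  qed
  then show ?thesis using le[OF assms(3)] by simp
qed

text \<open>At even exponents the traces are squared norms, hence nonnegative, and log-convexity
  applies to them. Odd exponents follow by one more Cauchy--Schwarz step: with
  \<open>q = a + c\<close> the trace is an inner product of the matrices behind \<open>g a\<close>
  and \<open>g c\<close>.\<close>

lemma ftr_le:
  assumes sym: "msym D X" "msym D Y" "msym D Z" and q: "q \<le> 2 * n"
  shows "ftr D Z X Y q (2 * n - q) \<le> deviation D Z X n + deviation D Z Y n"
proof -
  define g where "g a = ftr D Z X Y (2 * a) (2 * (n - a))" for a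
  have g_mip: "g a = mip D (mmul D (mpow D X a) (mmul D Z (mpow D Y (n - a))))
     (mmul D (mpow D X a) (mmul D Z (mpow D Y (n - a))))" for a
    using ftr_mip[OF sym, of a "n-a" a "n-a"] by (simp add: g_def mult_2)
  have cs: "(ftr D Z X Y (a + c) (2 * n - (a + c)))\<^sup>2 \<le> g a * g c" if "a \<le> n" "c \<le> n" for a c
  proof -
    have "2 * n - (a + c) = n - c + (n - a)" using that by simp
    then show ?thesis
      using mip_Cauchy_Schwarz[of D "mmul D (mpow D X a) (mmul D Z (mpow D Y (n - a)))"
          "mmul D (mpow D X c) (mmul D Z (mpow D Y (n - c)))"]
      by (simp add: ftr_mip[OF sym] g_mip)
  qed
  have nonneg: "0 \<le> g a" for a unfolding g_mip by (rule mip_self_nonneg)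
  have g0: "g 0 = deviation D Z Y n" "g n = deviation D Z X n"
    using ftr_0[OF sym] ftr_max[OF sym] by (simp_all add: g_def)
  have gmax: "g a \<le> deviation D Z X n + deviation D Z Y n" if "a \<le> n" for a
  proof -
    have "g a \<le> max (g 0) (g n)"
    proof (rule log_convex_max[OF _ _ that])
      fix a assume a: "0 < a" "a < n"
      have e: "a - 1 + (a + 1) = 2 * a" "2 * n - 2 * a = 2 * (n - a)" using a by auto
      have "a - 1 \<le> n" "a + 1 \<le> n" using a by auto
      from cs[OF this] show "(g a)\<^sup>2 \<le> g (a - 1) * g (a + 1)"
        unfolding e g_def[of a] .
    qed (rule nonneg)
    then show ?thesis using nonneg[of 0] nonneg[of n] g0 by linarith
  qed
  let ?M = "deviation D Z X n + deviation D Z Y n"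
  obtain a c where ac: "a \<le> n" "c \<le> n" "q = a + c"
  proof (cases "q \<le> n")
    case True then show ?thesis using that[of q 0] by simp
  next
    case False then show ?thesis using that[of n "q - n"] q by simp
  qed
  have "(ftr D Z X Y q (2 * n - q))\<^sup>2 \<le> g a * g c"
    using cs[OF ac(1,2)] ac(3) by simp
  also have "\<dots> \<le> ?M\<^sup>2"
    unfolding power2_eq_square
    using gmax[OF ac(1)] gmax[OF ac(2)] nonneg[of a] nonneg[of c] by (intro mult_mono) linarith+
  finally show ?thesis by (rule power2_le_imp_le) (use nonneg[of a] gmax[OF ac(1)] in linarith)
qed

section \<open>Differences of odd powers\<close>

lemma mpow_telescope:
  assumes "msupp D X" "msupp D Y"
  shows "mpow D X (Suc n) i j - mpow D Y (Suc n) i j =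
    (\<Sum>a\<le>n. mmul D (mpow D X a) (mmul D (\<lambda>i j. X i j - Y i j) (mpow D Y (n - a))) i j)"
proof (induction n arbitrary: i j)
  case 0
  have s: "msupp D (\<lambda>i j. X i j - Y i j)" using assms by (simp add: msupp_def)
  show ?case
    using mpow_1[OF assms(1)] mpow_1[OF assms(2)]
    by (simp add: mmul_one_right mmul_one_left s msupp_mmul del: mpow.simps)
next
  case (Suc n)
  let ?Z = "\<lambda>i j. X i j - Y i j"
  have s: "msupp D ?Z" using assms by (simp add: msupp_def)
  have 1: "mpow D X (Suc (Suc n)) i j - mpow D Y (Suc (Suc n)) i j =
     (\<Sum>k<D. X i k * (mpow D X (Suc n) k j - mpow D Y (Suc n) k j)) + mmul D ?Z (mpow D Y (Suc n)) i j"
    by (simp add: mmul_def[of D X] mmul_def[of D Y "mmul _ _ _"] mmul_def[of D ?Z]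
         algebra_simps sum.distrib sum_subtractf del: mpow.simps)
       (simp add: mmul_def)
  have 2: "(\<Sum>k<D. X i k * (mpow D X (Suc n) k j - mpow D Y (Suc n) k j)) =
     (\<Sum>a\<le>n. mmul D (mpow D X (Suc a)) (mmul D ?Z (mpow D Y (Suc n - Suc a))) i j)"
  proof -
    have "(\<Sum>k<D. X i k * (\<Sum>a\<le>n. f a k)) = (\<Sum>a\<le>n. \<Sum>k<D. X i k * f a k)" for f :: mtx
      by (simp add: sum_distrib_left) (rule sum.swap)
    then show ?thesis
      unfolding Suc by (simp add: mmul_assoc) (simp add: mmul_def[of D X])
  qed
  have 3: "mmul D ?Z (mpow D Y (Suc n)) i j = mmul D (mpow D X 0) (mmul D ?Z (mpow D Y (Suc n - 0))) i j"
    by (simp add: mmul_one_left s msupp_mmul msupp_mpow assms del: mpow.simps)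
  show ?case unfolding 1 2 3
    by (subst sum.atMost_Suc_shift) simp
qed

text \<open>A mean value inequality under the trace for the function x^(2n+1) with derivative (2n+1)
  x^(2n): telescoping gives \<open>2n+1\<close> mixed terms of total degree \<open>2n\<close>, each
  dominated by its extreme values. Taking the sum of both extremes instead of a weighted mean loses
  a factor 2, which affects only constants.\<close>

lemma trace_diff_power:
  assumes "msym D X" "msym D Y"
  defines "Z \<equiv> (\<lambda>i j. X i j - Y i j)"
  shows "mip D Z (mpow D X (Suc (2 * n))) - mip D Z (mpow D Y (Suc (2 * n)))
     \<le> real (Suc (2 * n)) * (deviation D Z X n + deviation D Z Y n)"
proof -
  have sym: "msym D Z" using assms by (auto simp: msym_def msupp_def)
  have "mip D Z (mpow D X (Suc (2 * n))) - mip D Z (mpow D Y (Suc (2 * n)))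
     = (\<Sum>i<D. \<Sum>j<D. Z i j * (mpow D X (Suc (2*n)) i j - mpow D Y (Suc (2*n)) i j))"
    by (simp add: mip_def algebra_simps sum_subtractf del: mpow.simps)
  also have "\<dots> = (\<Sum>i<D. \<Sum>j<D. \<Sum>a\<le>2*n. Z i j * mmul D (mpow D X a) (mmul D Z (mpow D Y (2*n - a))) i j)"
    by (simp add: mpow_telescope[OF msym_supp[OF assms(1)] msym_supp[OF assms(2)]] sum_distrib_left Z_def del: mpow.simps)
  also have "\<dots> = (\<Sum>a\<le>2*n. \<Sum>i<D. \<Sum>j<D. Z i j * mmul D (mpow D X a) (mmul D Z (mpow D Y (2*n - a))) i j)"
    by (subst sum.swap[of _ "{..2*n}"]) (simp add: sum.swap[of _ "{..2*n}" "{..<D}"])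
  also have "\<dots> = (\<Sum>a\<le>2*n. ftr D Z X Y a (2 * n - a))"
    unfolding mip_def[symmetric] ftr_def mip_mtrace mtrans_sym[OF sym] ..
  also have "\<dots> \<le> (\<Sum>a\<le>2*n. deviation D Z X n + deviation D Z Y n)"
    by (intro sum_mono ftr_le assms sym) auto
  finally show ?thesis by simp
qed

subsection \<open>The operator norm\<close>

definition mvec :: "nat \<Rightarrow> mtx \<Rightarrow> (nat \<Rightarrow> real) \<Rightarrow> nat \<Rightarrow> real" where
  "mvec D X z = (\<lambda>i. \<Sum>j<D. X i j * z j)"

definition vip :: "nat \<Rightarrow> (nat \<Rightarrow> real) \<Rightarrow> (nat \<Rightarrow> real) \<Rightarrow> real" where
  "vip D x y = (\<Sum>i<D. x i * y i)"

lemma vip_self_nonneg: "0 \<le> vip D x x" unfolding vip_def by (intro sum_nonneg) simp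

lemma vip_Cauchy_Schwarz: "(vip D x y)\<^sup>2 \<le> vip D x x * vip D y y"
  using Cauchy_Schwarz_ineq_sum[of x y "{..<D}"] by (simp add: vip_def power2_eq_square)

lemma mvec_mmul: "mvec D (mmul D X Y) z = mvec D X (mvec D Y z)"
  unfolding mvec_def mmul_def
  by (intro ext) (simp add: sum_distrib_left sum_distrib_right mult.assoc, rule sum.swap)

lemma vip_mvec_sym: "msym D X \<Longrightarrow> vip D (mvec D X x) y = vip D x (mvec D X y)"
  unfolding vip_def mvec_def msym_def
  by (simp add: sum_distrib_left sum_distrib_right, subst sum.swap) (simp add: algebra_simps)

lemma vip_mvec_le: "vip D (mvec D X z) (mvec D X z) \<le> mip D X X * vip D z z"
proof -
  have "(mvec D X z i)\<^sup>2 \<le> (\<Sum>j<D. (X i j)\<^sup>2) * vip D z z" for i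
    using Cauchy_Schwarz_ineq_sum[of "X i" z "{..<D}"] by (simp add: mvec_def vip_def power2_eq_square)
  then have "(\<Sum>i<D. (mvec D X z i)\<^sup>2) \<le> (\<Sum>i<D. (\<Sum>j<D. (X i j)\<^sup>2) * vip D z z)"
    by (intro sum_mono)
  then show ?thesis by (simp add: vip_def mip_def power2_eq_square sum_distrib_right)
qed

text \<open>The ratios of successive terms do not decrease, so a power of the first ratio is at most
  a product of ratios. Denominators are cleared because terms may vanish.\<close>

lemma power_norm_growth:
  fixes a :: "nat \<Rightarrow> real"
  assumes nonneg: "\<And>k. 0 \<le> a k" and conv: "\<And>k. (a (Suc k))\<^sup>2 \<le> a k * a (Suc (Suc k))"
  shows "a 1 ^ Suc k \<le> a (Suc k) * a 0 ^ k"
proof -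
  have ratio: "a k * a 1 \<le> a (Suc k) * a 0" for k
  proof (induction k)
    case 0 show ?case by simp
  next
    case (Suc k)
    show ?case
    proof (cases "a (Suc k) = 0")
      case True
      then show ?thesis using nonneg by simp
    next
      case False
      then have pos: "0 < a (Suc k)" using nonneg[of "Suc k"] by simp
      have "a (Suc k) * (a (Suc k) * a 1) \<le> a k * a (Suc (Suc k)) * a 1"
        using conv[of k] nonneg[of 1] by (metis mult.assoc mult_right_mono power2_eq_square)
      also have "\<dots> \<le> a (Suc k) * a 0 * a (Suc (Suc k))"
        using Suc nonneg[of "Suc (Suc k)"] by (metis mult.assoc mult.commute mult_right_mono)
      finally show ?thesis using pos by (simp add: mult.commute mult.left_commute)
    qed
  qed
  show ?thesis
  proof (induction k)
    case 0 show ?case by simp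
  next
    case (Suc k)
    have "a 1 ^ Suc (Suc k) \<le> a (Suc k) * a 0 ^ k * a 1"
      using mult_right_mono[OF Suc nonneg[of 1]] by (simp add: mult.commute mult.left_commute)
    also have "\<dots> = (a (Suc k) * a 1) * a 0 ^ k" by simp
    also have "\<dots> \<le> (a (Suc (Suc k)) * a 0) * a 0 ^ k"
      using ratio[of "Suc k"] nonneg[of 0] by (intro mult_right_mono) auto
    finally show ?case by (simp add: mult.assoc)
  qed
qed

lemma mip_mpow_trace: assumes "msym D X"
  shows "mip D (mpow D X a) (mpow D X b) = mtrace D (mpow D X (a + b))"
  by (simp add: mip_mtrace mtrans_mpow assms mpow_add msym_supp)

text \<open>This stands in for bounding the largest absolute eigenvalue by the root of a trace. The
  squared norm \<open>a k\<close> of \<open>X^k z\<close> is log-convex in \<open>k\<close>, so its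
  growth in one step is controlled by its growth over \<open>p\<close> steps, and that by the
  squared Frobenius norm of \<open>X^p\<close>, which is the trace of \<open>X^(2p)\<close>.\<close>

lemma quadratic_form_le_trace:
  assumes sym: "msym D X" and p: "p > 0" and c: "0 \<le> c" and tr: "mtrace D (mpow D X (2 * p)) \<le> c ^ (2 * p)"
  shows "\<bar>vip D z (mvec D X z)\<bar> \<le> c * vip D z z"
proof -
  define v where "v k = mvec D (mpow D X k) z" for k
  define a where "a k = vip D (v k) (v k)" for k
  have v_Suc: "v (Suc k) = mvec D X (v k)" for k by (simp add: v_def mvec_mmul)
  have nonneg: "0 \<le> a k" for k by (simp add: a_def vip_self_nonneg)
  have conv: "(a (Suc k))\<^sup>2 \<le> a k * a (Suc (Suc k))" for k
  proof -
    have "a (Suc k) = vip D (v k) (v (Suc (Suc k)))"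
      by (simp add: a_def v_Suc vip_mvec_sym[OF sym])
    then show ?thesis using vip_Cauchy_Schwarz[of D "v k" "v (Suc (Suc k))"] by (simp add: a_def)
  qed
  obtain k where k: "p = Suc k" using p by (cases p) auto
  \<comment> \<open>\<open>v 0\<close> is \<open>z\<close> cut off at \<open>D\<close>, which the
    inner product does not notice.\<close>
  have v0: "vip D (v 0) w = vip D z w" for w
  proof -
    have "v 0 i = (if i < D then z i else 0)" for i
    proof -
      have "v 0 i = (\<Sum>j<D. if j = i then (if i < D then z i else 0) else 0)"
        unfolding v_def mvec_def by (intro sum.cong) auto
      then show ?thesis by auto
    qed
    then show ?thesis by (simp add: vip_def)
  qed
  have a0: "a 0 = vip D z z" using v0[of "v 0"] v0[of z] by (simp add: a_def vip_def mult.commute)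
  have "a p \<le> mip D (mpow D X p) (mpow D X p) * vip D z z"
    unfolding a_def v_def by (rule vip_mvec_le)
  also have "\<dots> \<le> c ^ (2 * p) * a 0"
    using tr by (simp add: mip_mpow_trace[OF sym] a0 mult_2 vip_self_nonneg mult_right_mono)
  finally have ap: "a p \<le> c ^ (2 * p) * a 0" .
  have "a 1 ^ p \<le> a p * a 0 ^ k" using power_norm_growth[of a k] nonneg conv k by simp
  also have "\<dots> \<le> c ^ (2 * p) * a 0 * a 0 ^ k" using ap nonneg[of 0] by (intro mult_right_mono) auto
  also have "\<dots> = (c\<^sup>2 * a 0) ^ p" unfolding power_mult power_mult_distrib by (simp add: k mult.assoc mult.commute)
  finally have a1: "a 1 \<le> c\<^sup>2 * a 0"
    using power_mono_iff[of "a 1" "c\<^sup>2 * a 0" p] nonneg p by simp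
  have mz: "vip D z (mvec D X z) = vip D (v 0) (v 1)"
  proof -
    have "v 1 = mvec D X z"
      unfolding v_def by (simp add: mpow_1[OF msym_supp[OF sym]] del: One_nat_def)
    then show ?thesis using v0 by simp
  qed
  have "(vip D z (mvec D X z))\<^sup>2 \<le> a 0 * a 1"
    unfolding mz a_def by (rule vip_Cauchy_Schwarz)
  also have "\<dots> \<le> a 0 * (c\<^sup>2 * a 0)" using a1 nonneg by (intro mult_left_mono)
  finally have "\<bar>vip D z (mvec D X z)\<bar>\<^sup>2 \<le> (c * vip D z z)\<^sup>2"
    by (simp add: a0 power2_eq_square mult.assoc mult.left_commute)
  then show ?thesis by (rule power2_le_imp_le) (use c vip_self_nonneg in simp)
qed

section \<open>Sampling rows\<close>

text \<open>The rows are not normalised: it is the average of their outer products, not the sum,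
  that is bounded by 5/4, the value left by a distortion of 1/4 in the hashing step.\<close>

locale row_sampling =
  fixes D m N :: nat and y :: mtx and L :: real
  assumes m: "0 < m" and N: "0 < N"
    and row_bound: "\<And>a. a < N \<Longrightarrow> vip D (y a) (y a) \<le> L"
    and cov_bound: "\<And>z. (\<Sum>a<N. (vip D (y a) z)\<^sup>2) \<le> real N * (5/4 * vip D z z)"
begin

definition samples :: "(nat \<Rightarrow> nat) set" where
  "samples = PiE_dflt {..<m} 0 (\<lambda>_. {..<N})"

text \<open>The old minus the new value of \<open>err\<close> when one sampled row changes from
  \<open>a\<close> to \<open>b\<close>.\<close>

definition swap_err :: "nat \<Rightarrow> nat \<Rightarrow> mtx" where
  "swap_err a b = (\<lambda>i j. if i < D \<and> j < D then (y a i * y a j - y b i * y b j) / m else 0)"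

definition err :: "(nat \<Rightarrow> nat) \<Rightarrow> mtx" where
  "err s = (\<lambda>i j. if i < D \<and> j < D
     then (\<Sum>r<m. y (s r) i * y (s r) j) / m - (\<Sum>a<N. y a i * y a j) / N else 0)"

lemma finite_samples: "finite samples"
  unfolding samples_def by (rule finite_PiE_dflt) auto

lemma samples_nonempty: "samples \<noteq> {}"
  unfolding samples_def using N by auto

lemma samples_lt: "s \<in> samples \<Longrightarrow> r < m \<Longrightarrow> s r < N"
  unfolding samples_def PiE_dflt_def by auto

lemma samples_upd: "s \<in> samples \<Longrightarrow> r < m \<Longrightarrow> b < N \<Longrightarrow> s(r := b) \<in> samples"
  unfolding samples_def PiE_dflt_def by auto

lemma L_nonneg: "0 \<le> L"
  using row_bound[OF N] vip_self_nonneg[of D "y 0"] by linarith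

lemma msym_err: "msym D (err s)"
  unfolding msym_def msupp_def err_def by (auto simp: mult.commute)

lemma err_diff:
  assumes "r < m"
  shows "(\<lambda>i j. err s i j - err (s(r := b)) i j) = swap_err (s r) b"
proof (intro ext)
  fix i j
  have "(\<Sum>q<m. y (s q) i * y (s q) j) - (\<Sum>q<m. y ((s(r := b)) q) i * y ((s(r := b)) q) j)
     = y (s r) i * y (s r) j - y b i * y b j"
    using assms by (simp add: sum.remove[of "{..<m}" r])
  then show "err s i j - err (s(r := b)) i j = swap_err (s r) b i j"
    unfolding err_def swap_err_def by (auto simp flip: diff_divide_distrib)
qed

text \<open>Summing over the replacement \<open>b\<close> turns its outer product into
  \<open>N\<close> times the mean, so the changes at all positions together reproduce
  \<open>err\<close>. This linear regression property is what the method of exchangeable pairs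
  requires.\<close>

lemma err_average: "real N * err s i j = (\<Sum>r<m. \<Sum>b<N. swap_err (s r) b i j)"
proof (cases "i < D \<and> j < D")
  case True
  define f where "f a = y a i * y a j" for a
  have "(\<Sum>r<m. \<Sum>b<N. swap_err (s r) b i j) = (\<Sum>r<m. \<Sum>b<N. (f (s r) - f b) / m)"
    using True by (simp add: swap_err_def f_def)
  also have "\<dots> = (\<Sum>r<m. (N * f (s r) - (\<Sum>b<N. f b)) / m)"
    by (simp only: sum_divide_distrib[symmetric] sum_subtractf) simp
  also have "\<dots> = (N * (\<Sum>r<m. f (s r)) - m * (\<Sum>b<N. f b)) / m"
    by (simp add: sum_divide_distrib[symmetric] sum_subtractf sum_distrib_left)
  also have "\<dots> = N * ((\<Sum>r<m. f (s r)) / m - (\<Sum>b<N. f b) / N)"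
    using m N by (simp add: field_simps)
  finally show ?thesis using True by (simp add: err_def f_def)
qed (auto simp: err_def swap_err_def)

text \<open>Putting \<open>b\<close> at place \<open>r\<close> and returning the old entry is an
  involution of the pairs \<open>(s, b)\<close>, and it swaps the old and the new sample.\<close>

lemma exchange:
  fixes F :: "(nat \<Rightarrow> nat) \<Rightarrow> (nat \<Rightarrow> nat) \<Rightarrow> real"
  assumes r: "r < m"
  shows "(\<Sum>s\<in>samples. \<Sum>b<N. F s (s(r := b))) = (\<Sum>s\<in>samples. \<Sum>b<N. F (s(r := b)) s)"
proof -
  let ?w = "\<lambda>(s, b). (s(r := b), s r :: nat)"
  have "(\<Sum>(s, b)\<in>samples \<times> {..<N}. F s (s(r := b))) = (\<Sum>(s, b)\<in>samples \<times> {..<N}. F (s(r := b)) s)"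
    by (rule sum.reindex_bij_witness[of _ ?w ?w]) (use r in \<open>auto simp: samples_upd samples_lt\<close>)
  then show ?thesis by (simp add: sum.cartesian_product)
qed

lemma deviation_columns: "deviation D Z X n = (\<Sum>c<D. vip D (mvec D Z (\<lambda>k. mpow D X n k c)) (mvec D Z (\<lambda>k. mpow D X n k c)))"
  unfolding deviation_def mip_def mmul_def mvec_def vip_def by (rule sum.swap)

lemma deviation_minus: "deviation D (\<lambda>i j. Y i j - X i j) Z n = deviation D (\<lambda>i j. X i j - Y i j) Z n"
proof -
  have "mmul D (\<lambda>i j. Y i j - X i j) W i j = - mmul D (\<lambda>i j. X i j - Y i j) W i j" for W i j
    by (simp add: mmul_def algebra_simps sum_subtractf)
  then show ?thesis by (simp add: deviation_def mip_def)
qed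

text \<open>Applied to \<open>z\<close>, the matrix gives a difference of multiples of the two rows.
  The square of a difference is at most twice the sum of the squares, and each row norm is at most
  \<open>L\<close>.\<close>

lemma swap_err_vec:
  assumes "a < N" "b < N"
  shows "vip D (mvec D (swap_err a b) z) (mvec D (swap_err a b) z)
     \<le> 2 * L / m\<^sup>2 * ((vip D (y a) z)\<^sup>2 + (vip D (y b) z)\<^sup>2)"
proof -
  let ?a = "vip D (y a) z" and ?b = "vip D (y b) z"
  have ev: "mvec D (swap_err a b) z i = (y a i * ?a - y b i * ?b) / m" if "i < D" for i
    using that unfolding mvec_def swap_err_def vip_def
    by (simp add: sum_divide_distrib[symmetric] algebra_simps sum_subtractf sum_distrib_left)
  have "vip D (mvec D (swap_err a b) z) (mvec D (swap_err a b) z)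
     = (\<Sum>i<D. ((y a i * ?a - y b i * ?b) / m)\<^sup>2)"
    unfolding vip_def[of D "mvec D (swap_err a b) z"] by (intro sum.cong) (auto simp: ev power2_eq_square)
  also have "\<dots> \<le> (\<Sum>i<D. 2 / m\<^sup>2 * ((y a i)\<^sup>2 * ?a\<^sup>2 + (y b i)\<^sup>2 * ?b\<^sup>2))"
  proof (intro sum_mono)
    fix i
    have "(y a i * ?a - y b i * ?b)\<^sup>2 \<le> 2 * ((y a i)\<^sup>2 * ?a\<^sup>2 + (y b i)\<^sup>2 * ?b\<^sup>2)"
      using zero_le_power2[of "y a i * ?a + y b i * ?b"]
      by (simp add: power2_sum power2_diff power_mult_distrib)
    then show "((y a i * ?a - y b i * ?b) / m)\<^sup>2 \<le> 2 / m\<^sup>2 * ((y a i)\<^sup>2 * ?a\<^sup>2 + (y b i)\<^sup>2 * ?b\<^sup>2)"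
      by (simp add: power_divide divide_right_mono)
  qed
  also have "\<dots> = 2 / m\<^sup>2 * (vip D (y a) (y a) * ?a\<^sup>2 + vip D (y b) (y b) * ?b\<^sup>2)"
  proof -
    have "(\<Sum>i<D. c * ((f i)\<^sup>2 * A + (g i)\<^sup>2 * B)) = c * ((\<Sum>i<D. f i * f i) * A + (\<Sum>i<D. g i * g i) * B)"
      for c A B :: real and f g :: "nat \<Rightarrow> real"
      by (simp add: sum_distrib_left sum_distrib_right sum.distrib power2_eq_square distrib_left)
    then show ?thesis by (simp only: vip_def[of D "y a" "y a"] vip_def[of D "y b" "y b"])
  qed
  also have "\<dots> \<le> 2 / m\<^sup>2 * (L * ?a\<^sup>2 + L * ?b\<^sup>2)"
    using row_bound assms by (intro mult_left_mono add_mono mult_right_mono) auto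
  also have "\<dots> = 2 * L / m\<^sup>2 * (?a\<^sup>2 + ?b\<^sup>2)" by (simp add: algebra_simps)
  finally show ?thesis .
qed

lemma sample_squares:
  "(\<Sum>r<m. (vip D (y (s r)) z)\<^sup>2) = m * (vip D z (mvec D (err s) z) + (\<Sum>a<N. (vip D (y a) z)\<^sup>2) / N)"
proof -
  have sq: "(vip D (y a) z)\<^sup>2 = (\<Sum>i<D. \<Sum>j<D. z i * (y a i * y a j) * z j)" for a
    by (simp add: vip_def power2_eq_square sum_product algebra_simps)
  have "vip D z (mvec D (err s) z) = (\<Sum>i<D. \<Sum>j<D. z i * ((\<Sum>r<m. y (s r) i * y (s r) j) / m - (\<Sum>a<N. y a i * y a j) / N) * z j)"
    unfolding vip_def mvec_def err_def by (simp add: sum_distrib_left mult.assoc)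
  also have "\<dots> = (\<Sum>i<D. \<Sum>j<D. \<Sum>r<m. z i * (y (s r) i * y (s r) j) * z j) / m
     - (\<Sum>i<D. \<Sum>j<D. \<Sum>a<N. z i * (y a i * y a j) * z j) / N"
    by (simp add: sum_subtractf sum_divide_distrib right_diff_distrib left_diff_distrib
        sum_distrib_left sum_distrib_right)
  also have "(\<Sum>i<D. \<Sum>j<D. \<Sum>r<m. z i * (y (s r) i * y (s r) j) * z j) = (\<Sum>r<m. (vip D (y (s r)) z)\<^sup>2)"
    unfolding sq by (simp add: sum.swap[of _ "{..<m}"])
  also have "(\<Sum>i<D. \<Sum>j<D. \<Sum>a<N. z i * (y a i * y a j) * z j) = (\<Sum>a<N. (vip D (y a) z)\<^sup>2)"
    unfolding sq by (simp add: sum.swap[of _ "{..<N}"])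
  finally show ?thesis using m by (simp add: field_simps)
qed

text \<open>Rewriting the sampled squares by \<open>sample_squares\<close> brings back the quadratic
  form of \<open>err\<close>, so the variance term is bounded by traces of powers of
  \<open>err\<close> itself. Summed over the columns, the form is the trace of an odd power, which
  the AM-GM inequality splits between the adjacent even ones. The coefficient 3 is 5/2 + 1/2, where
  5/2 is 5/4 once for the sampled rows and once for the replacements.\<close>

lemma sum_dev_le:
  assumes s: "s \<in> samples"
  shows "(\<Sum>r<m. \<Sum>b<N. deviation D (swap_err (s r) b) (err s) n)
    \<le> 2 * L * N / m * (3 * mtrace D (mpow D (err s) (2 * n)) + mtrace D (mpow D (err s) (2 * n + 2)) / 2)"
proof -
  define z where "z c k = mpow D (err s) n k c" for c k
  have "(\<Sum>r<m. \<Sum>b<N. deviation D (swap_err (s r) b) (err s) n)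
     = (\<Sum>r<m. \<Sum>b<N. \<Sum>c<D. vip D (mvec D (swap_err (s r) b) (z c)) (mvec D (swap_err (s r) b) (z c)))"
    unfolding deviation_columns z_def ..
  also have "\<dots> \<le> (\<Sum>r<m. \<Sum>b<N. \<Sum>c<D. 2 * L / m\<^sup>2 * ((vip D (y (s r)) (z c))\<^sup>2 + (vip D (y b) (z c))\<^sup>2))"
    using s by (intro sum_mono swap_err_vec) (auto simp: samples_lt)
  also have "\<dots> = (\<Sum>c<D. \<Sum>r<m. \<Sum>b<N. 2 * L / m\<^sup>2 * ((vip D (y (s r)) (z c))\<^sup>2 + (vip D (y b) (z c))\<^sup>2))"
    by (simp add: sum.swap[of _ "{..<D}"])
  also have "\<dots> = (\<Sum>c<D. 2 * L / m\<^sup>2 * (N * (\<Sum>r<m. (vip D (y (s r)) (z c))\<^sup>2) + m * (\<Sum>b<N. (vip D (y b) (z c))\<^sup>2)))"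
    by (simp add: sum.distrib sum_distrib_left algebra_simps)
  also have "\<dots> \<le> (\<Sum>c<D. 2 * L * N / m * (vip D (z c) (mvec D (err s) (z c)) + 5/2 * vip D (z c) (z c)))"
  proof (intro sum_mono)
    fix c
    let ?q = "vip D (z c) (mvec D (err s) (z c))" and ?S = "\<Sum>a<N. (vip D (y a) (z c))\<^sup>2"
    have "N * (\<Sum>r<m. (vip D (y (s r)) (z c))\<^sup>2) + m * ?S = m * (N * ?q + 2 * ?S)"
      using N by (simp add: sample_squares field_simps)
    also have "\<dots> \<le> m * (N * ?q + 2 * (real N * (5/4 * vip D (z c) (z c))))"
      using cov_bound by (intro mult_left_mono add_left_mono) auto
    also have "\<dots> = m * N * (?q + 5/2 * vip D (z c) (z c))" by (simp add: algebra_simps)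
    finally have "2 * L / m\<^sup>2 * (N * (\<Sum>r<m. (vip D (y (s r)) (z c))\<^sup>2) + m * ?S)
      \<le> 2 * L / m\<^sup>2 * (m * N * (?q + 5/2 * vip D (z c) (z c)))"
      using L_nonneg by (intro mult_left_mono) auto
    also have "\<dots> = 2 * L * N / m * (?q + 5/2 * vip D (z c) (z c))"
      using m by (simp add: power2_eq_square)
    finally show "2 * L / m\<^sup>2 * (N * (\<Sum>r<m. (vip D (y (s r)) (z c))\<^sup>2) + m * ?S)
      \<le> 2 * L * N / m * (?q + 5/2 * vip D (z c) (z c))" .
  qed
  also have "\<dots> = 2 * L * N / m * ((\<Sum>c<D. vip D (z c) (mvec D (err s) (z c))) + 5/2 * (\<Sum>c<D. vip D (z c) (z c)))"
    by (simp add: sum_distrib_left sum.distrib distrib_left)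
  also have "(\<Sum>c<D. vip D (z c) (z c)) = mtrace D (mpow D (err s) (2 * n))"
    using mip_mpow_trace[OF msym_err, of s n n]
    by (simp add: mip_def vip_def z_def mult_2, subst sum.swap) simp
  also have "(\<Sum>c<D. vip D (z c) (mvec D (err s) (z c))) = mip D (mpow D (err s) n) (mpow D (err s) (Suc n))"
    by (simp add: mip_def vip_def z_def mvec_def mmul_def, subst sum.swap) simp
  also have "2 * L * N / m * (mip D (mpow D (err s) n) (mpow D (err s) (Suc n)) + 5/2 * mtrace D (mpow D (err s) (2 * n)))
    \<le> 2 * L * N / m * ((mip D (mpow D (err s) n) (mpow D (err s) n) + mip D (mpow D (err s) (Suc n)) (mpow D (err s) (Suc n))) / 2 + 5/2 * mtrace D (mpow D (err s) (2 * n)))"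
    using L_nonneg by (intro mult_left_mono add_right_mono mip_AM_GM) auto
  also have "\<dots> = 2 * L * N / m * (3 * mtrace D (mpow D (err s) (2 * n)) + mtrace D (mpow D (err s) (2 * n + 2)) / 2)"
    by (simp add: mip_mpow_trace[OF msym_err] mult_2[symmetric] field_simps del: mpow.simps)
  finally show ?thesis .
qed

text \<open>Resampling one row turns \<open>s\<close> into \<open>s'\<close> such that \<open>(s, s')\<close> is an exchangeable pair; this replaces
  the covariance of \<open>err s\<close> and its odd power by a difference of odd powers.\<close>

lemma exchangeable_pair:
  assumes r: "r < m"
  shows "(\<Sum>s\<in>samples. \<Sum>b<N. mip D (swap_err (s r) b) (mpow D (err s) (Suc (2 * n))))
     \<le> Suc (2 * n) * (\<Sum>s\<in>samples. \<Sum>b<N. deviation D (swap_err (s r) b) (err s) n)" (is "?T \<le> _ * ?V")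
proof -
  let ?Z = "\<lambda>s s'. (\<lambda>i j. err s i j - err s' i j)"
  let ?P = "\<lambda>s. mpow D (err s) (Suc (2 * n))"
  have T: "?T = (\<Sum>s\<in>samples. \<Sum>b<N. mip D (?Z s (s(r:=b))) (?P s))"
    by (simp only: err_diff[OF r])
  also have "\<dots> = (\<Sum>s\<in>samples. \<Sum>b<N. mip D (?Z (s(r:=b)) s) (?P (s(r:=b))))"
    by (rule exchange[OF r])
  also have "\<dots> = (\<Sum>s\<in>samples. \<Sum>b<N. - mip D (?Z s (s(r:=b))) (?P (s(r:=b))))"
    by (simp add: mip_def algebra_simps sum_subtractf del: mpow.simps)
  finally have T': "?T = - (\<Sum>s\<in>samples. \<Sum>b<N. mip D (?Z s (s(r:=b))) (?P (s(r:=b))))"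
    by (simp add: sum_negf)
  \<comment> \<open>Swapping the old and the new sample reverses the sign of the matrix difference,
    so adding the two expressions for the left side produces a difference of odd powers.\<close>
  have "2 * ?T = (\<Sum>s\<in>samples. \<Sum>b<N. mip D (?Z s (s(r:=b))) (?P s) - mip D (?Z s (s(r:=b))) (?P (s(r:=b))))"
    using T T' by (simp add: sum_subtractf)
  also have "\<dots> \<le> (\<Sum>s\<in>samples. \<Sum>b<N. real (Suc (2 * n)) * (deviation D (?Z s (s(r:=b))) (err s) n + deviation D (?Z s (s(r:=b))) (err (s(r:=b))) n))"
    by (intro sum_mono trace_diff_power msym_err)
  also have "\<dots> = Suc (2 * n) * ((\<Sum>s\<in>samples. \<Sum>b<N. deviation D (?Z s (s(r:=b))) (err s) n)
      + (\<Sum>s\<in>samples. \<Sum>b<N. deviation D (?Z s (s(r:=b))) (err (s(r:=b))) n))"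
    by (simp only: sum_distrib_left[symmetric] sum.distrib)
  also have "(\<Sum>s\<in>samples. \<Sum>b<N. deviation D (?Z s (s(r:=b))) (err (s(r:=b))) n)
     = (\<Sum>s\<in>samples. \<Sum>b<N. deviation D (?Z (s(r:=b)) s) (err s) n)"
    by (rule exchange[OF r])
  also have "\<dots> = (\<Sum>s\<in>samples. \<Sum>b<N. deviation D (?Z s (s(r:=b))) (err s) n)"
    by (simp only: deviation_minus)
  also have "(\<Sum>s\<in>samples. \<Sum>b<N. deviation D (?Z s (s(r:=b))) (err s) n) = ?V"
    by (simp only: err_diff[OF r])
  finally show ?thesis by simp
qed

section \<open>The recursion for even trace moments and the tail bound\<close>

definition moment :: "nat \<Rightarrow> real" where
  "moment p = (\<Sum>s\<in>samples. mtrace D (mpow D (err s) (2 * p)))"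

lemma moment_Suc_le:
  "moment (Suc n) \<le> Suc (2 * n) * (2 * L / m) * (3 * moment n + moment (Suc n) / 2)"
proof -
  have mi: "mip D (err s) (mpow D (err s) (Suc (2 * n))) = mtrace D (mpow D (err s) (2 * Suc n))" for s
    by (simp add: mip_mtrace mtrans_sym[OF msym_err])
  have "N * moment (Suc n) = (\<Sum>s\<in>samples. N * mip D (err s) (mpow D (err s) (Suc (2 * n))))"
    unfolding moment_def mi by (rule sum_distrib_left)
  also have "\<dots> = (\<Sum>s\<in>samples. \<Sum>r<m. \<Sum>b<N. mip D (swap_err (s r) b) (mpow D (err s) (Suc (2 * n))))"
  proof (intro sum.cong refl)
    fix s
    let ?W = "mpow D (err s) (Suc (2 * n))"
    have "N * mip D (err s) ?W = (\<Sum>i<D. \<Sum>j<D. (real N * err s i j) * ?W i j)"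
      by (simp add: mip_def sum_distrib_left mult.assoc del: mpow.simps)
    also have "\<dots> = (\<Sum>i<D. \<Sum>j<D. \<Sum>r<m. \<Sum>b<N. swap_err (s r) b i j * ?W i j)"
      by (simp add: err_average sum_distrib_right del: mpow.simps)
    also have "\<dots> = (\<Sum>r<m. \<Sum>b<N. mip D (swap_err (s r) b) ?W)"
      unfolding mip_def
      by (simp add: sum.swap[of _ "{..<m}" "{..<D}"] sum.swap[of _ "{..<N}" "{..<D}"] del: mpow.simps)
    finally show "N * mip D (err s) ?W = (\<Sum>r<m. \<Sum>b<N. mip D (swap_err (s r) b) ?W)" .
  qed
  also have "\<dots> = (\<Sum>r<m. \<Sum>s\<in>samples. \<Sum>b<N. mip D (swap_err (s r) b) (mpow D (err s) (Suc (2 * n))))"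
    by (rule sum.swap)
  also have "\<dots> \<le> (\<Sum>r<m. Suc (2 * n) * (\<Sum>s\<in>samples. \<Sum>b<N. deviation D (swap_err (s r) b) (err s) n))"
    by (intro sum_mono exchangeable_pair) auto
  also have "\<dots> = Suc (2 * n) * (\<Sum>s\<in>samples. \<Sum>r<m. \<Sum>b<N. deviation D (swap_err (s r) b) (err s) n)"
    by (simp only: sum_distrib_left[symmetric] sum.swap[of _ "{..<m}"])
  also have "\<dots> \<le> Suc (2 * n) * (\<Sum>s\<in>samples. 2 * L * N / m * (3 * mtrace D (mpow D (err s) (2 * n)) + mtrace D (mpow D (err s) (2 * n + 2)) / 2))"
    by (intro mult_left_mono sum_mono sum_dev_le) auto
  also have "\<dots> = Suc (2 * n) * (2 * L * N / m * (3 * moment n + moment (Suc n) / 2))"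
    unfolding moment_def
    by (simp only: sum_distrib_left[symmetric] sum.distrib sum_divide_distrib[symmetric]) simp
  also have "\<dots> = N * (Suc (2 * n) * (2 * L / m) * (3 * moment n + moment (Suc n) / 2))" by simp
  finally show ?thesis by (rule mult_left_le_imp_le) (use N in simp)
qed

lemma mtrace_even_nonneg: "0 \<le> mtrace D (mpow D (err s) (2 * n))"
  using mip_self_nonneg[of D "mpow D (err s) n"] by (simp add: mip_mpow_trace[OF msym_err] mult_2)

lemma moment_nonneg: "0 \<le> moment n"
  unfolding moment_def by (intro sum_nonneg mtrace_even_nonneg)

text \<open>The assumption on \<open>m\<close> makes the coefficient at most
  \<open>4 p L / m \<le> 1/128\<close>, so that the term \<open>moment (Suc n)\<close> on the right
  can be absorbed; the ratio 6/255 that results is below 1/32. The factor \<open>D\<close> is the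
  trace of the zeroth power.\<close>

lemma moment_le:
  assumes p: "512 * real p * L \<le> m" and n: "n \<le> p"
  shows "moment n \<le> (1/32) ^ n * (card samples * D)"
  using n
proof (induction n)
  case 0
  have "mtrace D (mpow D X 0) = D" for X by (simp add: mtrace_def)
  then show ?case by (simp add: moment_def)
next
  case (Suc n)
  define e where "e = Suc (2 * n) * (2 * L / m)"
  have "real (Suc (2 * n)) * (2 * L) \<le> (2 * real p) * (2 * L)"
    using Suc.prems L_nonneg by (intro mult_right_mono) auto
  also have "\<dots> \<le> m / 128" using p by simp
  finally have e: "e \<le> 1/128" "0 \<le> e" using m L_nonneg by (auto simp: e_def field_simps)
  have "moment (Suc n) \<le> e * (3 * moment n + moment (Suc n) / 2)"
    using moment_Suc_le[of n] by (simp add: e_def)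
  also have "\<dots> \<le> 1/128 * (3 * moment n + moment (Suc n) / 2)"
    using e moment_nonneg by (intro mult_right_mono) auto
  finally have "moment (Suc n) \<le> 1/32 * moment n" using moment_nonneg[of n] by simp
  then show ?case using Suc by simp
qed

text \<open>Markov's inequality for the trace of the power \<open>2p\<close>: a violation at level
  1/4 forces this trace to be at least \<open>16^(-p)\<close>, while its mean is at most
  \<open>D * 32^(-p)\<close>.\<close>

theorem sampling_concentration:
  assumes p: "512 * real p * L \<le> m" "0 < p"
  shows "measure_pmf.prob (Pi_pmf {..<m} 0 (\<lambda>_. pmf_of_set {..<N}))
    {s. \<not> (\<forall>z. \<bar>(\<Sum>r<m. (vip D (y (s r)) z)\<^sup>2) / m - (\<Sum>a<N. (vip D (y a) z)\<^sup>2) / N\<bar> \<le> 1/4 * vip D z z)}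
    \<le> D / 2 ^ p" (is "measure_pmf.prob _ ?B \<le> _")
proof -
  let ?T = "\<lambda>s. mtrace D (mpow D (err s) (2 * p))"
  have "real (card (samples \<inter> ?B)) * (1/4) ^ (2 * p) \<le> (\<Sum>s\<in>samples \<inter> ?B. ?T s)"
  proof -
    have "(1/4) ^ (2 * p) \<le> ?T s" if "s \<in> ?B" for s
    proof (rule ccontr)
      assume "\<not> (1/4) ^ (2 * p) \<le> ?T s"
      then have *: "?T s \<le> (1/4) ^ (2 * p)" by simp
      have "\<bar>vip D z (mvec D (err s) z)\<bar> \<le> 1/4 * vip D z z" for z
        by (rule quadratic_form_le_trace[OF msym_err p(2) _ *]) simp
      then have "s \<notin> ?B" using m by (simp add: sample_squares)
      then show False using that by blast
    qed
    then have "(\<Sum>s\<in>samples \<inter> ?B. (1/4) ^ (2 * p)) \<le> (\<Sum>s\<in>samples \<inter> ?B. ?T s)"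
      by (intro sum_mono) blast
    then show ?thesis by simp
  qed
  also have "\<dots> \<le> moment p"
    unfolding moment_def
    by (intro sum_mono2 finite_samples mtrace_even_nonneg) auto
  also have "\<dots> \<le> (1/32) ^ p * (card samples * D)" by (rule moment_le[OF p(1)]) simp
  also have "(1/32::real) ^ p = (1/4) ^ (2 * p) * (1 / 2 ^ p)"
    by (simp add: power_mult power_one_over power2_eq_square flip: power_mult_distrib)
  finally have "(1/4::real) ^ (2 * p) * card (samples \<inter> ?B) \<le> (1/4) ^ (2 * p) * (card samples * D / 2 ^ p)"
    by (simp add: mult.commute mult.left_commute)
  then have 1: "real (card (samples \<inter> ?B)) \<le> card samples * D / 2 ^ p"
    by (rule mult_left_le_imp_le) simp
  have "card samples > 0" using finite_samples samples_nonempty by (simp add: card_gt_0_iff)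
  with 1 have "real (card (samples \<inter> ?B)) / card samples \<le> D / 2 ^ p"
    by (simp add: field_simps)
  moreover have "Pi_pmf {..<m} 0 (\<lambda>_. pmf_of_set {..<N}) = pmf_of_set samples"
    unfolding samples_def using N by (intro Pi_pmf_of_set) auto
  ultimately show ?thesis
    by (simp add: measure_pmf_of_set[OF samples_nonempty finite_samples])
qed

end

section \<open>Random hashing\<close>

text \<open>A hash word below \<open>2 * N\<close> carries both the bucket \<open>w div 2\<close>
  and, as its parity, an independent sign.\<close>

definition hash_sign :: "nat \<Rightarrow> real" where "hash_sign w = 1 - 2 * real (w mod 2)"

definition count_sketch :: "nat set \<Rightarrow> (nat \<Rightarrow> nat) \<Rightarrow> mtx \<Rightarrow> mtx" where
  "count_sketch R f U = (\<lambda>a k. \<Sum>r\<in>R. if f r div 2 = a then hash_sign (f r) * U r k else 0)"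

definition hashes :: "nat \<Rightarrow> nat set \<Rightarrow> (nat \<Rightarrow> nat) set" where
  "hashes N R = PiE_dflt R 0 (\<lambda>_. {..<2 * N})"

text \<open>Expectations over the hash functions are kept as finite sums, so that rows can be added
  one at a time by induction; probabilities return in \<open>avg_markov\<close>.\<close>

definition avg :: "nat \<Rightarrow> nat set \<Rightarrow> ((nat \<Rightarrow> nat) \<Rightarrow> real) \<Rightarrow> real" where
  "avg N R F = (\<Sum>f\<in>hashes N R. F f) / real (2 * N) ^ card R"

lemma finite_hashes: "finite R \<Longrightarrow> finite (hashes N R)"
  unfolding hashes_def by (rule finite_PiE_dflt) auto

lemma card_hashes: "finite R \<Longrightarrow> card (hashes N R) = (2 * N) ^ card R"
  unfolding hashes_def by (subst card_PiE_dflt) auto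

lemma hashes_nonempty: "0 < N \<Longrightarrow> hashes N R \<noteq> {}"
  unfolding hashes_def by (auto simp: lessThan_empty_iff)

lemma sum_hashes_insert:
  fixes F :: "(nat \<Rightarrow> nat) \<Rightarrow> real"
  assumes x: "x \<notin> R"
  shows "(\<Sum>f\<in>hashes N (insert x R). F f) = (\<Sum>f\<in>hashes N R. \<Sum>w<2 * N. F (f(x := w)))"
proof -
  have "(\<Sum>f\<in>hashes N (insert x R). F f) = (\<Sum>(f, w)\<in>hashes N R \<times> {..<2 * N}. F (f(x := w)))"
    by (rule sum.reindex_bij_witness[where i = "\<lambda>(f, w). f(x := w)" and j = "\<lambda>f. (f(x := 0), f x)"])
       (use x in \<open>auto simp: hashes_def PiE_dflt_def\<close>)
  then show ?thesis by (simp add: sum.cartesian_product)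
qed

lemma avg_insert:
  assumes "x \<notin> R" "finite R"
  shows "avg N (insert x R) F = avg N R (\<lambda>f. (\<Sum>w<2 * N. F (f(x := w))) / (2 * N))"
  using assms unfolding avg_def
  by (simp add: sum_hashes_insert sum_divide_distrib[symmetric] mult.commute)

lemma avg_mono: "(\<And>f. f \<in> hashes N R \<Longrightarrow> F f \<le> G f) \<Longrightarrow> avg N R F \<le> avg N R G"
  unfolding avg_def by (intro divide_right_mono sum_mono) auto

lemma avg_add: "avg N R (\<lambda>f. F f + G f) = avg N R F + avg N R G"
  unfolding avg_def by (simp add: sum.distrib add_divide_distrib)

lemma avg_cmult: "avg N R (\<lambda>f. c * F f) = c * avg N R F"
  unfolding avg_def by (simp add: sum_distrib_left)

lemma avg_const: "finite R \<Longrightarrow> 0 < N \<Longrightarrow> avg N R (\<lambda>_. c) = c"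
  unfolding avg_def by (simp add: card_hashes)

lemma avg_markov:
  assumes R: "finite R" and N: "0 < N" and nonneg: "\<And>f. 0 \<le> F f" and c: "0 < c"
    and B: "\<And>f. f \<in> hashes N R \<Longrightarrow> f \<in> B \<Longrightarrow> c \<le> F f"
  shows "measure_pmf.prob (pmf_of_set (hashes N R)) B \<le> avg N R F / c"
proof -
  have "c * card (hashes N R \<inter> B) = (\<Sum>f\<in>hashes N R \<inter> B. c)" by simp
  also have "\<dots> \<le> (\<Sum>f\<in>hashes N R \<inter> B. F f)" using B by (intro sum_mono) auto
  also have "\<dots> \<le> (\<Sum>f\<in>hashes N R. F f)"
    using nonneg by (intro sum_mono2 finite_hashes R) auto
  finally show ?thesis
    using N c unfolding measure_pmf_of_set[OF hashes_nonempty[OF N] finite_hashes[OF R]] avg_def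
    by (simp add: card_hashes[OF R] field_simps)
qed

lemma sum_even_odd: "(\<Sum>w<2 * (N::nat). F w) = (\<Sum>a<N. F (2 * a) + F (2 * a + 1) :: real)"
  by (induction N) auto

lemma hash_sign_simps [simp]: "hash_sign (2 * a) = 1" "hash_sign (Suc (2 * a)) = -1"
  unfolding hash_sign_def by auto

lemma hash_sign_sq: "hash_sign w * hash_sign w = 1"
  unfolding hash_sign_def by (cases "even w") (auto simp: odd_iff_mod_2_eq_one)

lemma count_sketch_insert:
  assumes "x \<notin> R" "finite R"
  shows "count_sketch (insert x R) (f(x := w)) U a k =
    count_sketch R f U a k + (if w div 2 = a then hash_sign w * U x k else 0)"
proof -
  have "(\<Sum>r\<in>R. if (f(x := w)) r div 2 = a then hash_sign ((f(x := w)) r) * U r k else 0)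
     = (\<Sum>r\<in>R. if f r div 2 = a then hash_sign (f r) * U r k else 0)"
    using assms by (intro sum.cong) auto
  then show ?thesis using assms by (simp add: count_sketch_def)
qed

subsection \<open>Second moment of the sketched Gram matrix\<close>

definition sketch_err :: "nat \<Rightarrow> nat set \<Rightarrow> mtx \<Rightarrow> (nat \<Rightarrow> nat) \<Rightarrow> mtx" where
  "sketch_err N R U f = (\<lambda>k l. (\<Sum>a<N. count_sketch R f U a k * count_sketch R f U a l) - (\<Sum>r\<in>R. U r k * U r l))"

text \<open>The square of the sign is 1, so the outer product of the new row cancels against its
  share of the exact Gram matrix. What remains are the cross terms with the bucket contents, linear
  in the fresh sign.\<close>

lemma sketch_err_insert:
  assumes x: "x \<notin> R" "finite R" and w: "w < 2 * N"
  shows "sketch_err N (insert x R) U (f(x := w)) k l = sketch_err N R U f k l +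
    hash_sign w * (count_sketch R f U (w div 2) k * U x l + U x k * count_sketch R f U (w div 2) l)"
proof -
  let ?s = "count_sketch R f U" and ?v = "w div 2"
  have v: "?v < N" using w by auto
  have "count_sketch (insert x R) (f(x := w)) U a k * count_sketch (insert x R) (f(x := w)) U a l =
     ?s a k * ?s a l + (if a = ?v then hash_sign w * (?s ?v k * U x l + U x k * ?s ?v l) + U x k * U x l else 0)" for a
    using hash_sign_sq[of w] unfolding count_sketch_insert[OF x] by (auto simp: algebra_simps)
  then show ?thesis
    using v x unfolding sketch_err_def by (simp add: sum.distrib)
qed

lemma avg_sketch_err_trace:
  assumes "finite R" "0 < N"
  shows "avg N R (\<lambda>f. \<Sum>k<D. sketch_err N R U f k k) = 0"
  using assms(1)
proof (induction R rule: finite_induct)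
  case empty
  then show ?case by (simp add: avg_def sketch_err_def count_sketch_def)
next
  case (insert x R)
  have "(\<Sum>w<2 * N. \<Sum>k<D. sketch_err N (insert x R) U (f(x := w)) k k) / (2 * N)
     = (\<Sum>k<D. sketch_err N R U f k k)" for f
  proof -
    have "(\<Sum>w<2 * N. \<Sum>k<D. sketch_err N (insert x R) U (f(x := w)) k k)
       = (\<Sum>w<2 * N. (\<Sum>k<D. sketch_err N R U f k k) + hash_sign w * (\<Sum>k<D. 2 * (count_sketch R f U (w div 2) k * U x k)))"
      using insert.hyps by (intro sum.cong)
        (auto simp: sketch_err_insert sum.distrib sum_distrib_left algebra_simps)
    also have "\<dots> = 2 * N * (\<Sum>k<D. sketch_err N R U f k k)"
      by (simp add: sum_even_odd)
    finally show ?thesis using assms(2) by simp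
  qed
  then show ?case using insert by (simp add: avg_insert)
qed

lemma avg_sketch_energy:
  assumes "finite R" "0 < N"
  shows "avg N R (\<lambda>f. \<Sum>a<N. \<Sum>k<D. (count_sketch R f U a k)\<^sup>2) = (\<Sum>r\<in>R. \<Sum>k<D. (U r k)\<^sup>2)"
proof -
  have "(\<Sum>a<N. \<Sum>k<D. (count_sketch R f U a k)\<^sup>2) = (\<Sum>k<D. sketch_err N R U f k k) + (\<Sum>r\<in>R. \<Sum>k<D. (U r k)\<^sup>2)" for f
    unfolding sketch_err_def by (simp add: sum_subtractf power2_eq_square sum.swap[of _ "{..<D}"])
  then show ?thesis by (simp add: avg_add avg_const avg_sketch_err_trace assms)
qed

text \<open>The increments have mean zero given the earlier hashes, so their squares add up. A new
  row of squared norm \<open>u\<close> meets a uniformly chosen bucket, which holds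
  \<open>T / N\<close> of the energy on average; the contribution of at most
  \<open>4 u T / N\<close> fits into the growth from \<open>4 T^2 / N\<close> to
  \<open>4 (u + T)^2 / N\<close>.\<close>

lemma avg_sketch_err_sq:
  assumes "finite R" "0 < N"
  shows "avg N R (\<lambda>f. mip D (sketch_err N R U f) (sketch_err N R U f)) \<le> 4 * (\<Sum>r\<in>R. \<Sum>k<D. (U r k)\<^sup>2)\<^sup>2 / N"
  using assms(1)
proof (induction R rule: finite_induct)
  case empty
  then show ?case by (simp add: avg_def sketch_err_def count_sketch_def mip_def)
next
  case (insert x R)
  define u where "u = (\<Sum>k<D. (U x k)\<^sup>2)"
  define T where "T = (\<Sum>r\<in>R. \<Sum>k<D. (U r k)\<^sup>2)"
  have u0: "0 \<le> u" "0 \<le> T" unfolding u_def T_def by (auto intro!: sum_nonneg)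
  have step: "(\<Sum>w<2 * N. mip D (sketch_err N (insert x R) U (f(x := w))) (sketch_err N (insert x R) U (f(x := w)))) / (2 * N)
     \<le> mip D (sketch_err N R U f) (sketch_err N R U f) + 4 * u / N * (\<Sum>a<N. \<Sum>k<D. (count_sketch R f U a k)\<^sup>2)" for f
  proof -
    let ?X = "sketch_err N R U f" and ?s = "count_sketch R f U"
    define Z where "Z a = (\<lambda>k l. ?s a k * U x l + U x k * ?s a l)" for a
    have "(\<Sum>w<2 * N. mip D (sketch_err N (insert x R) U (f(x := w))) (sketch_err N (insert x R) U (f(x := w))))
       = (\<Sum>w<2 * N. \<Sum>k<D. \<Sum>l<D. (?X k l + hash_sign w * Z (w div 2) k l)\<^sup>2)"
      using insert.hyps by (intro sum.cong) (auto simp: mip_def sketch_err_insert power2_eq_square Z_def)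
    also have "\<dots> = (\<Sum>a<N. (\<Sum>k<D. \<Sum>l<D. (?X k l + Z a k l)\<^sup>2) + (\<Sum>k<D. \<Sum>l<D. (?X k l - Z a k l)\<^sup>2))"
      by (simp add: sum_even_odd)
    also have "\<dots> = (\<Sum>a<N. \<Sum>k<D. \<Sum>l<D. 2 * (?X k l)\<^sup>2 + 2 * (Z a k l)\<^sup>2)"
      by (simp add: power2_sum power2_diff flip: sum.distrib)
    also have "\<dots> = (\<Sum>a<N. 2 * mip D ?X ?X + 2 * (\<Sum>k<D. \<Sum>l<D. (Z a k l)\<^sup>2))"
      by (simp add: mip_def sum.distrib sum_distrib_left power2_eq_square)
    also have "\<dots> \<le> (\<Sum>a<N. 2 * mip D ?X ?X + 2 * (4 * u * (\<Sum>k<D. (?s a k)\<^sup>2)))"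
    proof (intro sum_mono add_left_mono mult_left_mono)
      fix a
      have "(\<Sum>k<D. \<Sum>l<D. (Z a k l)\<^sup>2) \<le> (\<Sum>k<D. \<Sum>l<D. 2 * ((?s a k)\<^sup>2 * (U x l)\<^sup>2) + 2 * ((U x k)\<^sup>2 * (?s a l)\<^sup>2))"
      proof (intro sum_mono)
        fix k l
        show "(Z a k l)\<^sup>2 \<le> 2 * ((?s a k)\<^sup>2 * (U x l)\<^sup>2) + 2 * ((U x k)\<^sup>2 * (?s a l)\<^sup>2)"
          using zero_le_power2[of "?s a k * U x l - U x k * ?s a l"]
          by (simp add: Z_def power2_sum power2_diff power_mult_distrib mult.commute)
      qed
      also have "\<dots> = 4 * u * (\<Sum>k<D. (?s a k)\<^sup>2)"
        by (simp add: u_def sum.distrib flip: sum_distrib_left sum_distrib_right)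
      finally show "(\<Sum>k<D. \<Sum>l<D. (Z a k l)\<^sup>2) \<le> 4 * u * (\<Sum>k<D. (?s a k)\<^sup>2)" .
    qed simp
    also have "\<dots> = 2 * N * (mip D ?X ?X + 4 * u / N * (\<Sum>a<N. \<Sum>k<D. (?s a k)\<^sup>2))"
      using assms(2) by (simp add: sum.distrib sum_distrib_left algebra_simps)
    finally show ?thesis by (subst pos_divide_le_eq) (use assms(2) in \<open>simp_all add: mult.commute\<close>)
  qed
  have "avg N (insert x R) (\<lambda>f. mip D (sketch_err N (insert x R) U f) (sketch_err N (insert x R) U f))
    \<le> avg N R (\<lambda>f. mip D (sketch_err N R U f) (sketch_err N R U f) + 4 * u / N * (\<Sum>a<N. \<Sum>k<D. (count_sketch R f U a k)\<^sup>2))"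
    using insert.hyps step by (subst avg_insert) (auto intro!: avg_mono)
  also have "\<dots> \<le> 4 * T\<^sup>2 / N + 4 * u / N * T"
    unfolding avg_add avg_cmult avg_sketch_energy[OF insert.hyps(1) assms(2)] using insert.IH by (simp add: T_def)
  also have "\<dots> \<le> 4 * (u + T)\<^sup>2 / N"
    using u0 assms(2) by (simp add: field_simps power2_eq_square)
  finally show ?case using insert.hyps by (simp add: u_def T_def)
qed

lemma mip_bilinear_le: "\<bar>vip D z (mvec D X z)\<bar> \<le> sqrt (mip D X X) * vip D z z"
proof -
  have "(vip D z (mvec D X z))\<^sup>2 \<le> vip D z z * (mip D X X * vip D z z)"
    using order_trans[OF vip_Cauchy_Schwarz mult_left_mono[OF vip_mvec_le vip_self_nonneg]] .
  also have "\<dots> = (sqrt (mip D X X) * vip D z z)\<^sup>2"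
    by (simp add: power_mult_distrib mip_self_nonneg power2_eq_square[of "vip D z z"])
  finally have "\<bar>vip D z (mvec D X z)\<bar>\<^sup>2 \<le> (sqrt (mip D X X) * vip D z z)\<^sup>2" by simp
  then show ?thesis by (rule power2_le_imp_le) (simp add: mip_self_nonneg vip_self_nonneg)
qed

text \<open>Chebyshev's inequality for the Frobenius norm: a violation requires a squared norm of at
  least 1/16, and the mean is at most \<open>4 D^2 / N\<close>. A quadratic number of buckets is
  affordable, since the transform costs only \<open>K * N * D\<close>.\<close>

lemma sketch_concentration:
  fixes U :: mtx
  assumes R: "finite R" and N: "0 < N" and T: "(\<Sum>r\<in>R. \<Sum>k<D. (U r k)\<^sup>2) \<le> D"
  shows "measure_pmf.prob (pmf_of_set (hashes N R))
     {f. \<not> (\<forall>z. \<bar>(\<Sum>a<N. (vip D (count_sketch R f U a) z)\<^sup>2) - (\<Sum>r\<in>R. (vip D (U r) z)\<^sup>2)\<bar> \<le> 1/4 * vip D z z)}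
     \<le> 64 * (real D)\<^sup>2 / N" (is "measure_pmf.prob _ ?B \<le> _")
proof -
  let ?F = "\<lambda>f. mip D (sketch_err N R U f) (sketch_err N R U f)"
  have eq: "vip D z (mvec D (sketch_err N R U f) z)
     = (\<Sum>a<N. (vip D (count_sketch R f U a) z)\<^sup>2) - (\<Sum>r\<in>R. (vip D (U r) z)\<^sup>2)" for f z
  proof -
    have sq: "(vip D v z)\<^sup>2 = (\<Sum>k<D. \<Sum>l<D. z k * (v k * v l) * z l)" for v
      by (simp add: vip_def power2_eq_square sum_product algebra_simps)
    have "vip D z (mvec D (sketch_err N R U f) z) =
        (\<Sum>k<D. \<Sum>l<D. \<Sum>a<N. z k * (count_sketch R f U a k * count_sketch R f U a l) * z l) - (\<Sum>k<D. \<Sum>l<D. \<Sum>r\<in>R. z k * (U r k * U r l) * z l)"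
      unfolding vip_def mvec_def sketch_err_def
      by (simp add: sum_subtractf right_diff_distrib left_diff_distrib sum_distrib_left sum_distrib_right mult.assoc)
    then show ?thesis unfolding sq by (simp add: sum.swap[of _ "{..<N}" "{..<D}"] sum.swap[of _ R "{..<D}"])
  qed
  have "1/16 \<le> ?F f" if "f \<in> ?B" for f
  proof (rule ccontr)
    assume "\<not> 1/16 \<le> ?F f"
    then have "sqrt (?F f) \<le> 1/4"
      by (intro real_le_lsqrt) (auto simp: power2_eq_square)
    then have "\<bar>vip D z (mvec D (sketch_err N R U f) z)\<bar> \<le> 1/4 * vip D z z" for z
      using order_trans[OF mip_bilinear_le mult_right_mono[OF _ vip_self_nonneg]] by blast
    then show False using that unfolding eq by blast
  qed
  then have "measure_pmf.prob (pmf_of_set (hashes N R)) ?B \<le> avg N R ?F / (1/16)"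
    by (intro avg_markov R N mip_self_nonneg) auto
  also have "\<dots> \<le> 4 * (\<Sum>r\<in>R. \<Sum>k<D. (U r k)\<^sup>2)\<^sup>2 / N / (1/16)"
    by (intro divide_right_mono avg_sketch_err_sq R N) simp
  also have "\<dots> \<le> 64 * (real D)\<^sup>2 / N"
  proof -
    have "(\<Sum>r\<in>R. \<Sum>k<D. (U r k)\<^sup>2)\<^sup>2 \<le> (real D)\<^sup>2"
      using T by (intro power_mono) (auto intro!: sum_nonneg)
    then show ?thesis by (simp add: divide_right_mono)
  qed
  finally show ?thesis .
qed

subsection \<open>Flattening by signed sums\<close>

lemma cosh_le_exp: "exp x + exp (- x) \<le> 2 * exp (x\<^sup>2 / 2 :: real)"
proof -
  have nonneg: "exp x + exp (- x) \<le> 2 * exp (x\<^sup>2 / 2)" if "0 \<le> x" for x :: real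
  proof -
    \<comment> \<open>With weight 1/2 and range \<open>2 * x\<close> the two-point variable of
      Hoeffding's lemma is, up to a shift, \<open>x\<close> with a fair sign.\<close>
    have "- (2 * x) * (1/2) + ln (1 + 1/2 * (exp (2 * x) - 1)) \<le> (2 * x)\<^sup>2 / 8"
      using that by (intro Hoeffdings_lemma_aux) auto
    then have "ln ((1 + exp (2 * x)) / 2) \<le> x\<^sup>2 / 2 + x"
      by (simp add: field_simps power2_eq_square)
    then have "(1 + exp (2 * x)) / 2 \<le> exp (x\<^sup>2 / 2 + x)"
      by (subst ln_le_cancel_iff[symmetric]) (auto simp: add_pos_pos)
    then have "(1 + exp (2 * x)) * exp (- x) \<le> 2 * exp (x\<^sup>2 / 2 + x) * exp (- x)"
      by (intro mult_right_mono) auto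
    then show ?thesis by (simp add: distrib_right mult.assoc exp_add[symmetric])
  qed
  show ?thesis using nonneg[of x] nonneg[of "-x"] by (cases "0 \<le> x") auto
qed

text \<open>All bucket coefficients have absolute value 1, so a row contributes \<open>U r k\<close>
  with a fair sign whichever bucket it falls into. Each row therefore costs one factor
  \<open>cosh (t * U r k)\<close>, independently of collisions.\<close>

lemma avg_exp_signed_sum:
  assumes "finite R" "0 < N" and H: "\<And>a. a < N \<Longrightarrow> \<bar>H a\<bar> = 1"
  shows "avg N R (\<lambda>f. exp (t * (\<Sum>a<N. H a * count_sketch R f U a k))) \<le> exp (t\<^sup>2 / 2 * (\<Sum>r\<in>R. (U r k)\<^sup>2))"
  using assms(1)
proof (induction R rule: finite_induct)
  case empty
  then show ?case using card_hashes[of "{}" N] by (simp add: avg_def count_sketch_def)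
next
  case (insert x R)
  let ?Z = "\<lambda>f. \<Sum>a<N. H a * count_sketch R f U a k"
  have Z: "(\<Sum>a<N. H a * count_sketch (insert x R) (f(x := w)) U a k) = ?Z f + hash_sign w * H (w div 2) * U x k"
    if "w < 2 * N" for f w
  proof -
    have v: "w div 2 < N" using that by auto
    have "(\<Sum>a<N. H a * count_sketch (insert x R) (f(x := w)) U a k)
       = (\<Sum>a<N. H a * count_sketch R f U a k + (if w div 2 = a then hash_sign w * H (w div 2) * U x k else 0))"
      using insert.hyps by (intro sum.cong) (auto simp: count_sketch_insert algebra_simps)
    then show ?thesis using v by (simp add: sum.distrib)
  qed
  have "(\<Sum>w<2 * N. exp (t * (\<Sum>a<N. H a * count_sketch (insert x R) (f(x := w)) U a k))) / (2 * N)
      \<le> exp (t\<^sup>2 / 2 * (U x k)\<^sup>2) * exp (t * ?Z f)" for f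
  proof -
    have "(\<Sum>w<2 * N. exp (t * (\<Sum>a<N. H a * count_sketch (insert x R) (f(x := w)) U a k)))
       = (\<Sum>w<2 * N. exp (t * (?Z f + hash_sign w * H (w div 2) * U x k)))"
      by (intro sum.cong) (auto simp: Z)
    also have "\<dots> = (\<Sum>a<N. exp (t * (?Z f + H a * U x k)) + exp (t * (?Z f - H a * U x k)))"
      by (simp add: sum_even_odd)
    also have "\<dots> = (\<Sum>a<N. exp (t * ?Z f) * (exp (t * H a * U x k) + exp (- (t * H a * U x k))))"
      by (simp add: algebra_simps exp_add[symmetric])
    also have "\<dots> \<le> (\<Sum>a<N. exp (t * ?Z f) * (2 * exp ((t * H a * U x k)\<^sup>2 / 2)))"
      by (intro sum_mono mult_left_mono cosh_le_exp) auto
    also have "\<dots> = (\<Sum>a<N. exp (t * ?Z f) * (2 * exp (t\<^sup>2 / 2 * (U x k)\<^sup>2)))"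
    proof (intro sum.cong refl)
      fix a assume "a \<in> {..<N}"
      then have "(H a)\<^sup>2 = 1" using H[of a] by (metis lessThan_iff one_power2 power2_abs)
      then show "exp (t * ?Z f) * (2 * exp ((t * H a * U x k)\<^sup>2 / 2)) = exp (t * ?Z f) * (2 * exp (t\<^sup>2 / 2 * (U x k)\<^sup>2))"
        by (simp add: power_mult_distrib)
    qed
    finally show ?thesis using assms(2) by (simp add: field_simps)
  qed
  then have "avg N (insert x R) (\<lambda>f. exp (t * (\<Sum>a<N. H a * count_sketch (insert x R) f U a k)))
     \<le> avg N R (\<lambda>f. exp (t\<^sup>2 / 2 * (U x k)\<^sup>2) * exp (t * ?Z f))"
    using insert.hyps by (subst avg_insert) (auto intro!: avg_mono)
  also have "\<dots> \<le> exp (t\<^sup>2 / 2 * (U x k)\<^sup>2) * exp (t\<^sup>2 / 2 * (\<Sum>r\<in>R. (U r k)\<^sup>2))"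
    unfolding avg_cmult by (intro mult_left_mono insert.IH) simp
  also have "\<dots> = exp (t\<^sup>2 / 2 * (\<Sum>r\<in>insert x R. (U r k)\<^sup>2))"
    using insert.hyps by (simp add: distrib_left exp_add)
  finally show ?case .
qed

lemma signed_sum_tail:
  assumes R: "finite R" and N: "0 < N" and H: "\<And>a. a < N \<Longrightarrow> \<bar>H a\<bar> = 1"
    and U: "(\<Sum>r\<in>R. (U r k)\<^sup>2) \<le> 1" and l: "0 \<le> l"
  shows "measure_pmf.prob (pmf_of_set (hashes N R)) {f. \<bar>\<Sum>a<N. H a * count_sketch R f U a k\<bar> > l}
     \<le> 2 * exp (- (l\<^sup>2 / 2))"
proof -
  let ?Z = "\<lambda>f. \<Sum>a<N. H a * count_sketch R f U a k"
  let ?P = "measure_pmf.prob (pmf_of_set (hashes N R))"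
  have tail: "?P {f. s * ?Z f > l} \<le> exp (- (l\<^sup>2 / 2))" if s: "s\<^sup>2 = 1" for s
  proof -
    \<comment> \<open>The Chernoff parameter \<open>l\<close> is optimal for variance 1;
      \<open>s\<close> selects the upper or the lower tail.\<close>
    have "?P {f. s * ?Z f > l} \<le> avg N R (\<lambda>f. exp ((l * s) * ?Z f)) / exp (l\<^sup>2)"
    proof (intro avg_markov R N)
      fix f assume "f \<in> {f. s * ?Z f > l}"
      then have "l * l \<le> l * (s * ?Z f)" using l by (intro mult_left_mono) auto
      then show "exp (l\<^sup>2) \<le> exp ((l * s) * ?Z f)" by (simp add: power2_eq_square mult.assoc)
    qed auto
    also have "\<dots> \<le> exp ((l * s)\<^sup>2 / 2 * (\<Sum>r\<in>R. (U r k)\<^sup>2)) / exp (l\<^sup>2)"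
      by (intro divide_right_mono avg_exp_signed_sum R N H) auto
    also have "\<dots> \<le> exp (l\<^sup>2 / 2) / exp (l\<^sup>2)"
      using mult_left_mono[OF U, of "l\<^sup>2 / 2"] s by (simp add: power_mult_distrib divide_right_mono)
    also have "\<dots> = exp (- (l\<^sup>2 / 2))" by (simp flip: exp_diff)
    finally show ?thesis .
  qed
  have "?P {f. \<bar>?Z f\<bar> > l} \<le> ?P ({f. 1 * ?Z f > l} \<union> {f. (-1) * ?Z f > l})"
    by (intro measure_pmf.finite_measure_mono) auto
  also have "\<dots> \<le> ?P {f. 1 * ?Z f > l} + ?P {f. (-1) * ?Z f > l}"
    by (intro measure_Un_le) auto
  also have "\<dots> \<le> 2 * exp (- (l\<^sup>2 / 2))" using tail[of 1] tail[of "-1"] by simp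
  finally show ?thesis .
qed

section \<open>The Hadamard transform\<close>

definition hbit :: "nat \<Rightarrow> nat \<Rightarrow> nat" where "hbit k i = i div 2 ^ k mod 2"

text \<open>This clears bit \<open>k\<close>: the inputs of a butterfly are \<open>hlow k i\<close>
  and \<open>hlow k i + 2 ^ k\<close>.\<close>

definition hlow :: "nat \<Rightarrow> nat \<Rightarrow> nat" where "hlow k i = i - hbit k i * 2 ^ k"

text \<open>The transform is left unnormalised, so that it uses field operations only; the growth of
  squared norms by \<open>2 ^ K\<close> is undone by averaging over the rows.\<close>

primrec hadamard :: "nat \<Rightarrow> (nat \<Rightarrow> real) \<Rightarrow> nat \<Rightarrow> real" where
  "hadamard 0 v = v"
| "hadamard (Suc k) v = (\<lambda>i. hadamard k v (hlow k i) + (1 - 2 * real (hbit k i)) * hadamard k v (hlow k i + 2 ^ k))"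

primrec hcoef :: "nat \<Rightarrow> nat \<Rightarrow> nat \<Rightarrow> real" where
  "hcoef 0 i a = (if i = a then 1 else 0)"
| "hcoef (Suc k) i a = hcoef k (hlow k i) a + (1 - 2 * real (hbit k i)) * hcoef k (hlow k i + 2 ^ k) a"

lemma hbit_cases: "hbit k i = 0 \<or> hbit k i = 1"
  unfolding hbit_def by auto

lemma hlow_decomp:
  obtains q r where "i = q * 2 ^ Suc k + hbit k i * 2 ^ k + r" "r < 2 ^ k" "hlow k i = q * 2 ^ Suc k + r"
proof
  let ?q = "i div 2 ^ k div 2" and ?r = "i mod 2 ^ k"
  have "i = i div 2 ^ k * 2 ^ k + ?r" by (rule div_mult_mod_eq[symmetric])
  also have "i div 2 ^ k = ?q * 2 + hbit k i" unfolding hbit_def by (rule div_mult_mod_eq[symmetric])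
  finally show i: "i = ?q * 2 ^ Suc k + hbit k i * 2 ^ k + ?r" by (simp add: algebra_simps)
  show "?r < 2 ^ k" by simp
  show "hlow k i = ?q * 2 ^ Suc k + ?r" unfolding hlow_def using i by linarith
qed

lemma hadamard_index_lt:
  assumes "i < 2 ^ K" "k < K"
  shows "hlow k i < 2 ^ K" "hlow k i + 2 ^ k < 2 ^ K"
proof -
  obtain q r where d: "i = q * 2 ^ Suc k + hbit k i * 2 ^ k + r" "r < 2 ^ k" "hlow k i = q * 2 ^ Suc k + r"
    by (rule hlow_decomp)
  have K: "(2::nat) ^ K = 2 ^ (K - Suc k) * 2 ^ Suc k" using assms by (simp flip: power_add power_Suc)
  have "q * 2 ^ Suc k < 2 ^ (K - Suc k) * 2 ^ Suc k" using d(1) assms(1) K by linarith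
  then have "Suc q \<le> 2 ^ (K - Suc k)" unfolding mult_less_cancel2 by simp
  then have "Suc q * 2 ^ Suc k \<le> 2 ^ K" unfolding K by (rule mult_right_mono) simp
  then show "hlow k i + 2 ^ k < 2 ^ K" using d by simp
  then show "hlow k i < 2 ^ K" by simp
qed

lemma hadamard_hcoef:
  assumes "k \<le> K" "i < 2 ^ K"
  shows "hadamard k v i = (\<Sum>a<2 ^ K. hcoef k i a * v a)"
  using assms
proof (induction k arbitrary: i)
  case 0
  have "(\<Sum>a<2 ^ K. hcoef 0 i a * v a) = (\<Sum>a<2 ^ K. if i = a then v a else 0)"
    by (intro sum.cong) auto
  then show ?case using 0 by simp
next
  case (Suc k)
  then show ?case
    using hadamard_index_lt[of i K k]
    by (simp add: sum.distrib distrib_right sum_distrib_left mult.assoc)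
qed

text \<open>After \<open>k\<close> layers the transform is block diagonal, its blocks being full
  sign matrices of size \<open>2 ^ k\<close>. For \<open>k = K\<close> all coefficients in range are
  signs, as the tail bound requires.\<close>

lemma hcoef_abs: "\<bar>hcoef k i a\<bar> = (if i div 2 ^ k = a div 2 ^ k then 1 else 0)"
proof (induction k arbitrary: i)
  case 0 show ?case by simp
next
  case (Suc k)
  obtain q r where d: "i = q * 2 ^ Suc k + hbit k i * 2 ^ k + r" "r < 2 ^ k" "hlow k i = q * 2 ^ Suc k + r"
    by (rule hlow_decomp)
  have l: "hlow k i div 2 ^ k = 2 * q" "(hlow k i + 2 ^ k) div 2 ^ k = 2 * q + 1"
  proof -
    have "hlow k i = r + 2 ^ k * (2 * q)" using d(3) by simp
    then show 1: "hlow k i div 2 ^ k = 2 * q" using d(2) by simp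
    show "(hlow k i + 2 ^ k) div 2 ^ k = 2 * q + 1" by (simp add: 1)
  qed
  have "i = (hbit k i * 2 ^ k + r) + 2 ^ Suc k * q" using d(1) by (metis add.assoc add.commute mult.commute)
  moreover have "hbit k i * 2 ^ k + r < 2 ^ Suc k" using hbit_cases[of k i] d(2) by auto
  ultimately have "i div 2 ^ Suc k = q" by (metis add.commute add_0 div_less div_mult_self2 power_not_zero zero_neq_numeral)
  moreover have "a div 2 ^ Suc k = a div 2 ^ k div 2" by (metis div_mult2_eq power_Suc2)
  ultimately have iff: "i div 2 ^ Suc k = a div 2 ^ Suc k \<longleftrightarrow> a div 2 ^ k = 2 * q \<or> a div 2 ^ k = 2 * q + 1"
    by auto
  show ?case
    using Suc[of "hlow k i"] Suc[of "hlow k i + 2 ^ k"] hbit_cases[of k i] unfolding iff l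
    by (auto split: if_splits)
qed

text \<open>The involution \<open>s\<close> flips bit \<open>k\<close> and so pairs the two outputs
  of a butterfly, for which \<open>(a + b)^2 + (a - b)^2 = 2 * (a^2 + b^2)\<close>.\<close>

lemma hadamard_norm:
  assumes "k \<le> K"
  shows "(\<Sum>i<2 ^ K. (hadamard k v i)\<^sup>2) = 2 ^ k * (\<Sum>i<2 ^ K. (v i)\<^sup>2)"
  using assms
proof (induction k)
  case 0 show ?case by simp
next
  case (Suc k)
  define s where "s i = (if hbit k i = 0 then i + 2 ^ k else i - 2 ^ k)" for i
  let ?h = "hadamard k v" and ?g = "hadamard (Suc k) v"
  have s: "s i < 2 ^ K \<and> s (s i) = i \<and> (?g i)\<^sup>2 + (?g (s i))\<^sup>2 = 2 * ((?h i)\<^sup>2 + (?h (s i))\<^sup>2)" if i: "i < 2 ^ K" for i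
  proof -
    have lt: "hlow k i < 2 ^ K" "hlow k i + 2 ^ k < 2 ^ K" using hadamard_index_lt[OF i] Suc.prems by auto
    show ?thesis
    proof (cases "hbit k i = 0")
      case True
      then have l: "hlow k i = i" "s i = i + 2 ^ k" by (auto simp: hlow_def s_def)
      have b: "hbit k (i + 2 ^ k) = 1" using True by (auto simp: hbit_def)
      then have "hlow k (i + 2 ^ k) = i" by (simp add: hlow_def)
      then show ?thesis using True l b lt
        by (simp add: power2_eq_square algebra_simps s_def)
    next
      case False
      then have b1: "hbit k i = 1" using hbit_cases[of k i] by auto
      have ge: "2 ^ k \<le> i" using b1 by (metis div_less hbit_def less_one linorder_not_less mod_0 zero_neq_one)
      have l: "hlow k i = i - 2 ^ k" "s i = i - 2 ^ k" using b1 by (auto simp: hlow_def s_def)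
      have b: "hbit k (i - 2 ^ k) = 0"
      proof -
        have "i div 2 ^ k = Suc ((i - 2 ^ k) div 2 ^ k)" using ge by (simp add: le_div_geq)
        moreover have "Suc x mod 2 = 1 \<Longrightarrow> x mod 2 = 0" for x :: nat by presburger
        ultimately show ?thesis using b1 unfolding hbit_def by metis
      qed
      then have "hlow k (i - 2 ^ k) = i - 2 ^ k" by (simp add: hlow_def)
      then show ?thesis using b1 l b lt ge
        by (simp add: power2_eq_square algebra_simps s_def)
    qed
  qed
  have re: "(\<Sum>i<2 ^ K. F (s i)) = (\<Sum>i<2 ^ K. F i)" for F :: "nat \<Rightarrow> real"
    by (rule sum.reindex_bij_witness[of _ s s]) (use s in auto)
  have "2 * (\<Sum>i<2 ^ K. (?g i)\<^sup>2) = (\<Sum>i<2 ^ K. (?g i)\<^sup>2 + (?g (s i))\<^sup>2)"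
    using re[of "\<lambda>i. (?g i)\<^sup>2"] by (simp add: sum.distrib)
  also have "\<dots> = (\<Sum>i<2 ^ K. 2 * ((?h i)\<^sup>2 + (?h (s i))\<^sup>2))"
    using s by (intro sum.cong) auto
  also have "\<dots> = 2 * (2 * (\<Sum>i<2 ^ K. (?h i)\<^sup>2))"
    using re[of "\<lambda>i. (?h i)\<^sup>2"] by (simp only: sum_distrib_left[symmetric] sum.distrib) simp
  finally show ?case using Suc by simp
qed

section \<open>Conjugate Gram--Schmidt\<close>

definition bil :: "nat \<Rightarrow> mtx \<Rightarrow> (nat \<Rightarrow> real) \<Rightarrow> (nat \<Rightarrow> real) \<Rightarrow> real" where
  "bil D G x y = (\<Sum>i<D. \<Sum>j<D. x i * G i j * y j)"

definition unit_fun :: "nat \<Rightarrow> nat \<Rightarrow> real" where "unit_fun j = (\<lambda>i. if i = j then 1 else 0)"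

text \<open>When \<open>P\<close> is the sum of \<open>q q^T / w\<close> over the earlier vectors
  \<open>q\<close>, the product \<open>P G\<close> is the projection to their span that is
  orthogonal for \<open>G\<close>. Maintaining \<open>P\<close> makes each stage a few loops of
  length \<open>D^2\<close> and leaves the preconditioner behind.\<close>

definition gs_vec :: "nat \<Rightarrow> mtx \<Rightarrow> mtx \<Rightarrow> nat \<Rightarrow> nat \<Rightarrow> real" where
  "gs_vec D G P j = (\<lambda>i. unit_fun j i - (\<Sum>c<D. P i c * G c j))"

primrec gs_inv :: "nat \<Rightarrow> mtx \<Rightarrow> nat \<Rightarrow> mtx" where
  "gs_inv D G 0 = (\<lambda>_ _. 0)"
| "gs_inv D G (Suc j) = (\<lambda>i c. gs_inv D G j i c +
     gs_vec D G (gs_inv D G j) j i * gs_vec D G (gs_inv D G j) j c /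
       bil D G (gs_vec D G (gs_inv D G j) j) (gs_vec D G (gs_inv D G j) j))"

definition gs :: "nat \<Rightarrow> mtx \<Rightarrow> nat \<Rightarrow> nat \<Rightarrow> real" where
  "gs D G j = gs_vec D G (gs_inv D G j) j"

lemma gs_inv_eq: "gs_inv D G j i c = (\<Sum>k<j. gs D G k i * gs D G k c / bil D G (gs D G k) (gs D G k))"
  by (induction j) (auto simp: gs_def)

lemma bil_diff_right: "bil D G x (\<lambda>i. y i - z i) = bil D G x y - bil D G x z"
  by (simp add: bil_def right_diff_distrib sum_subtractf)

lemma bil_scale_right: "bil D G x (\<lambda>i. c * y i) = c * bil D G x y"
  by (simp add: bil_def sum_distrib_left mult_ac)

lemma bil_sum_right: "bil D G x (\<lambda>i. \<Sum>k\<in>S. v k i * c k) = (\<Sum>k\<in>S. bil D G x (v k) * c k)"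
proof -
  have "bil D G x (\<lambda>i. \<Sum>k\<in>S. v k i * c k) = (\<Sum>i<D. \<Sum>j<D. \<Sum>k\<in>S. x i * G i j * v k j * c k)"
    by (simp add: bil_def sum_distrib_left mult.assoc)
  then show ?thesis
    by (simp add: bil_def sum_distrib_right sum.swap[of _ S "{..<D}"])
qed

lemma bil_cong: "(\<And>i. i < D \<Longrightarrow> x i = x' i) \<Longrightarrow> (\<And>i. i < D \<Longrightarrow> y i = y' i) \<Longrightarrow> bil D G x y = bil D G x' y'"
  unfolding bil_def by (intro sum.cong refl) auto

lemma bil_expand: "bil D G x y = (\<Sum>j<D. bil D G x (unit_fun j) * y j)"
proof -
  have "bil D G x y = bil D G x (\<lambda>i. \<Sum>j<D. unit_fun j i * y j)"
  proof (rule bil_cong)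
    fix i assume "i < D"
    have "(\<Sum>j<D. unit_fun j i * y j) = (\<Sum>j<D. if i = j then y j else 0)"
      by (intro sum.cong) (auto simp: unit_fun_def)
    then show "y i = (\<Sum>j<D. unit_fun j i * y j)" using \<open>i < D\<close> by simp
  qed simp
  then show ?thesis by (simp add: bil_sum_right)
qed

lemma bil_unit_right: "j < D \<Longrightarrow> bil D G x (unit_fun j) = (\<Sum>c<D. x c * G c j)"
proof -
  assume j: "j < D"
  have "bil D G x (unit_fun j) = (\<Sum>i<D. \<Sum>l<D. if l = j then x i * G i j else 0)"
    unfolding bil_def by (intro sum.cong refl) (auto simp: unit_fun_def)
  then show ?thesis using j by simp
qed

section \<open>Positive semidefinite forms with null directions\<close>

locale psd_form =
  fixes D :: nat and G :: mtx
  assumes sym: "\<And>i j. i < D \<Longrightarrow> j < D \<Longrightarrow> G i j = G j i"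
    and psd: "\<And>x. 0 \<le> bil D G x x"
begin

abbreviation "B \<equiv> bil D G"
abbreviation "Q \<equiv> gs D G"
abbreviation "w k \<equiv> B (Q k) (Q k)"

lemma bil_sym: "B x y = B y x"
  unfolding bil_def by (subst sum.swap) (intro sum.cong refl, auto simp: sym)

lemma bil_diff_self: "B (\<lambda>i. x i - y i) (\<lambda>i. x i - y i) = B x x - 2 * B x y + B y y"
  using bil_sym[of "\<lambda>i. x i - y i" x] bil_sym[of "\<lambda>i. x i - y i" y] bil_sym[of x y]
  by (simp add: bil_diff_right)

lemma bil_sum_left: "B (\<lambda>i. \<Sum>k\<in>S. v k i * c k) x = (\<Sum>k\<in>S. B (v k) x * c k)"
  by (simp only: bil_sym[of _ x] bil_sum_right)

text \<open>The degenerate case of Cauchy--Schwarz: a null vector belongs to the radical.\<close>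

lemma null_bil: assumes "B x x = 0" shows "B y x = 0"
proof (rule ccontr)
  assume ne: "B y x \<noteq> 0"
  \<comment> \<open>Along a null vector the quadratic polynomial is affine in \<open>t\<close>; this
    is where it takes the value -1.\<close>
  define t where "t = (B y y + 1) / (2 * B y x)"
  have "0 \<le> B (\<lambda>i. y i - t * x i) (\<lambda>i. y i - t * x i)" by (rule psd)
  also have "\<dots> = B y y - 2 * (t * B y x) + t * (t * B x x)"
    unfolding bil_diff_self
    using bil_sym[of "\<lambda>i. t * x i" x] by (simp add: bil_scale_right)
  also have "\<dots> = -1" using ne assms by (simp add: t_def field_simps)
  finally show False by simp
qed

lemma null_weight: "w k = 0 \<Longrightarrow> B x (Q k) = 0" "w k = 0 \<Longrightarrow> B (Q k) x = 0"
  using null_bil[of "Q k" x] bil_sym by auto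

text \<open>A vector of weight 0 is in the radical, so both sides vanish together. This spares the
  later sums a case distinction on null directions.\<close>

lemma weight_cancel: "w k * (B (Q k) x / w k) = B (Q k) x" "B x (Q k) * (w k / w k) = B x (Q k)"
proof -
  show "w k * (B (Q k) x / w k) = B (Q k) x"
    using null_weight(2)[of k x] by (cases "w k = 0") simp_all
  show "B x (Q k) * (w k / w k) = B x (Q k)"
    using null_weight(1)[of k x] by (cases "w k = 0") simp_all
qed

lemma gs_expand:
  assumes j: "j < D"
  shows "Q j = (\<lambda>i. unit_fun j i - (\<Sum>k<j. Q k i * (B (Q k) (unit_fun j) / w k)))"
proof
  fix i
  have "(\<Sum>c<D. gs_inv D G j i c * G c j) = (\<Sum>c<D. \<Sum>k<j. Q k i * Q k c / w k * G c j)"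
    by (simp add: gs_inv_eq sum_distrib_right)
  also have "\<dots> = (\<Sum>k<j. \<Sum>c<D. Q k i * Q k c / w k * G c j)" by (rule sum.swap)
  also have "\<dots> = (\<Sum>k<j. Q k i * (B (Q k) (unit_fun j) / w k))"
    by (simp add: bil_unit_right[OF j] sum_distrib_left sum_divide_distrib mult.assoc)
  finally show "Q j i = unit_fun j i - (\<Sum>k<j. Q k i * (B (Q k) (unit_fun j) / w k))"
    by (simp add: gs_def gs_vec_def)
qed

lemma gs_supp: "j < D \<Longrightarrow> j < i \<Longrightarrow> Q j i = 0"
proof (induction j rule: less_induct)
  case (less j)
  then have "(\<Sum>k<j. Q k i * (B (Q k) (unit_fun j) / w k)) = 0" by (intro sum.neutral) auto
  then show ?case using less.prems by (subst gs_expand) (auto simp: unit_fun_def)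
qed

lemma gs_diag: "j < D \<Longrightarrow> Q j j = 1"
proof -
  assume j: "j < D"
  then have "(\<Sum>k<j. Q k j * (B (Q k) (unit_fun j) / w k)) = 0"
    by (intro sum.neutral) (auto simp: gs_supp)
  then show "Q j j = 1" using j by (subst gs_expand) (auto simp: unit_fun_def)
qed

lemma bil_gs_right: "j < D \<Longrightarrow> B x (Q j) = B x (unit_fun j) - (\<Sum>k<j. B x (Q k) * (B (Q k) (unit_fun j) / w k))"
  by (drule gs_expand, drule arg_cong[of _ _ "B x"]) (simp only: bil_diff_right bil_sum_right)

lemma gs_orthogonal_less: "j < D \<Longrightarrow> i < j \<Longrightarrow> B (Q i) (Q j) = 0"
proof (induction j arbitrary: i rule: less_induct)
  case (less j)
  have "(\<Sum>k<j. B (Q i) (Q k) * (B (Q k) (unit_fun j) / w k)) = (\<Sum>k<j. if k = i then B (Q i) (unit_fun j) else 0)"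
  proof (intro sum.cong refl)
    fix k assume k: "k \<in> {..<j}"
    consider "k = i" | "k < i" | "i < k" by linarith
    then show "B (Q i) (Q k) * (B (Q k) (unit_fun j) / w k) = (if k = i then B (Q i) (unit_fun j) else 0)"
    proof cases
      case 1 then show ?thesis by (simp only: weight_cancel simp_thms if_True)
    next
      case 2 then show ?thesis using less.IH[of i k] less.prems bil_sym[of "Q i" "Q k"] by simp
    next
      case 3 then show ?thesis using less.IH[of k i] less.prems k by simp
    qed
  qed
  then show ?case using bil_gs_right[OF less.prems(1), of "Q i"] less.prems by simp
qed

lemma gs_orthogonal: "i < D \<Longrightarrow> j < D \<Longrightarrow> i \<noteq> j \<Longrightarrow> B (Q i) (Q j) = 0"
  using gs_orthogonal_less[of i j] gs_orthogonal_less[of j i] bil_sym[of "Q i" "Q j"]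
  by (cases "i < j") auto

lemma gs_unit: "j < D \<Longrightarrow> i < j \<Longrightarrow> B (Q j) (unit_fun i) = 0"
proof -
  assume ij: "j < D" "i < j"
  have "(\<Sum>k<i. B (Q j) (Q k) * (B (Q k) (unit_fun i) / w k)) = 0"
    using ij by (intro sum.neutral) (auto simp: gs_orthogonal)
  then show ?thesis using bil_gs_right[of i "Q j"] gs_orthogonal[of j i] ij by simp
qed

lemma gs_unit_self: "j < D \<Longrightarrow> B (Q j) (unit_fun j) = w j"
proof -
  assume j: "j < D"
  have "(\<Sum>k<j. B (Q j) (Q k) * (B (Q k) (unit_fun j) / w k)) = 0"
    using j by (intro sum.neutral) (auto simp: gs_orthogonal)
  then show ?thesis using bil_gs_right[OF j, of "Q j"] by simp
qed

lemma bil_gs_supp: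
  assumes "k < D" "d \<le> k" and y: "\<And>j. d \<le> j \<Longrightarrow> j < D \<Longrightarrow> y j = 0"
  shows "B (Q k) y = 0"
  unfolding bil_expand[of D G "Q k" y]
proof (rule sum.neutral, intro ballI)
  fix j assume "j \<in> {..<D}"
  then show "B (Q k) (unit_fun j) * y j = 0"
    using assms gs_unit[of k j] y[of j] by (cases "j < d") auto
qed

text \<open>The Gram--Schmidt vectors are unit triangular, so they recover every unit vector up to
  the radical; those from index \<open>d\<close> on are orthogonal to the first \<open>d\<close>
  coordinates and drop out. In this sense the matrix with terms \<open>k < d\<close> is a
  generalised inverse of the leading block.\<close>

lemma parseval:
  assumes d: "d \<le> D" and y: "\<And>j. d \<le> j \<Longrightarrow> j < D \<Longrightarrow> y j = 0"
  shows "B x y = (\<Sum>k<d. B x (Q k) * (B (Q k) y / w k))"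
proof -
  have unit_fun: "B x (unit_fun j) = (\<Sum>k<D. B x (Q k) * (B (Q k) (unit_fun j) / w k))" if j: "j < D" for j
  proof -
    have "(\<Sum>k<D. B x (Q k) * (B (Q k) (unit_fun j) / w k)) = (\<Sum>k<Suc j. B x (Q k) * (B (Q k) (unit_fun j) / w k))"
      using j by (intro sum.mono_neutral_right) (auto simp: gs_unit)
    also have "\<dots> = B x (unit_fun j) - B x (Q j) + B x (Q j) * (w j / w j)"
      using bil_gs_right[OF j, of x] by (simp add: gs_unit_self[OF j])
    also have "\<dots> = B x (unit_fun j)" unfolding weight_cancel(2) by simp
    finally show ?thesis by simp
  qed
  have "B x y = (\<Sum>j<D. (\<Sum>k<D. B x (Q k) * (B (Q k) (unit_fun j) / w k)) * y j)"
    unfolding bil_expand[of D G x y] by (intro sum.cong refl) (simp add: unit_fun)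
  also have "\<dots> = (\<Sum>k<D. B x (Q k) * (\<Sum>j<D. B (Q k) (unit_fun j) * y j) / w k)"
    by (simp add: sum_distrib_left sum_distrib_right sum_divide_distrib) (subst sum.swap, simp add: mult.assoc)
  also have "\<dots> = (\<Sum>k<D. B x (Q k) * (B (Q k) y / w k))"
    by (simp flip: bil_expand)
  also have "\<dots> = (\<Sum>k<d. B x (Q k) * (B (Q k) y / w k))"
    using d y by (intro sum.mono_neutral_right) (auto simp: bil_gs_supp)
  finally show ?thesis .
qed

end

section \<open>Orthonormal coordinates\<close>

definition gram :: "nat set \<Rightarrow> mtx \<Rightarrow> mtx" where
  "gram R A = (\<lambda>i j. \<Sum>r\<in>R. A r i * A r j)"

lemma bil_gram: "bil D (gram R A) x y = (\<Sum>r\<in>R. vip D (A r) x * vip D (A r) y)"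
proof -
  have "bil D (gram R A) x y = (\<Sum>i<D. \<Sum>j<D. \<Sum>r\<in>R. (A r i * x i) * (A r j * y j))"
    unfolding bil_def gram_def
    by (intro sum.cong refl) (simp add: sum_distrib_left sum_distrib_right mult_ac)
  then show ?thesis
    by (simp add: vip_def sum_product sum.swap[of _ R "{..<D}"])
qed

lemma psd_gram: "psd_form D (gram R A)"
proof
  show "gram R A i j = gram R A j i" for i j by (simp add: gram_def mult.commute)
  show "0 \<le> bil D (gram R A) x x" for x by (auto simp: bil_gram intro!: sum_nonneg)
qed

text \<open>The columns of \<open>U\<close> are the images of the Gram--Schmidt vectors divided by
  their norms: orthonormal, except that null directions give zero columns. \<open>U\<close> occurs
  only in the analysis, where it turns a relative error for \<open>A y\<close> into an absolute
  error for a coordinate vector \<open>z\<close> of the same norm.\<close>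

lemma orthonormal_coordinates:
  fixes A :: mtx
  assumes R: "finite R"
  obtains U :: mtx where "\<And>k. k < D \<Longrightarrow> (\<Sum>r\<in>R. (U r k)\<^sup>2) \<le> 1"
    and "\<And>z. (\<Sum>r\<in>R. (vip D (U r) z)\<^sup>2) \<le> vip D z z"
    and "\<And>y. \<exists>z. vip D z z = (\<Sum>r\<in>R. (vip D (A r) y)\<^sup>2) \<and> (\<forall>r\<in>R. vip D (U r) z = vip D (A r) y)"
proof -
  interpret psd_form D "gram R A" by (rule psd_gram)
  define U where "U r k = vip D (A r) (Q k) / sqrt (w k)" for r k
  have w: "0 \<le> w k" for k by (rule psd)
  have ortho: "(\<Sum>r\<in>R. U r k * U r l) = (if k = l \<and> w k \<noteq> 0 then 1 else 0)" if "k < D" "l < D" for k l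
  proof -
    have "(\<Sum>r\<in>R. U r k * U r l) = B (Q k) (Q l) / (sqrt (w k) * sqrt (w l))"
      unfolding U_def bil_gram[of D R A "Q k" "Q l"] by (simp add: sum_divide_distrib)
    then show ?thesis using gs_orthogonal[OF that] w[of k] by (auto simp flip: real_sqrt_mult)
  qed
  show ?thesis
  proof (rule that[of U])
    fix k assume "k < D"
    then show "(\<Sum>r\<in>R. (U r k)\<^sup>2) \<le> 1" using ortho[of k k] by (simp add: power2_eq_square)
  next
    fix z
    have "(\<Sum>r\<in>R. (vip D (U r) z)\<^sup>2) = bil D (gram R U) z z"
      by (simp add: bil_gram power2_eq_square)
    also have "\<dots> = (\<Sum>k<D. \<Sum>l<D. if k = l then (if w k \<noteq> 0 then z k * z k else 0) else 0)"
      unfolding bil_def[of D "gram R U" z z] by (intro sum.cong refl) (simp add: gram_def[of R U] ortho)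
    also have "\<dots> \<le> vip D z z" unfolding vip_def by (auto intro!: sum_mono)
    finally show "(\<Sum>r\<in>R. (vip D (U r) z)\<^sup>2) \<le> vip D z z" .
  next
    fix y
    define z where "z k = B (Q k) y / sqrt (w k)" for k
    have pv: "B x y = (\<Sum>k<D. B x (Q k) * (B (Q k) y / w k))" for x
      by (rule parseval) auto
    have "vip D z z = (\<Sum>k<D. B y (Q k) * (B (Q k) y / w k))"
      unfolding vip_def by (intro sum.cong refl) (auto simp: z_def bil_sym[of y] w simp flip: real_sqrt_mult)
    also have "\<dots> = (\<Sum>r\<in>R. (vip D (A r) y)\<^sup>2)"
      unfolding pv[symmetric] by (simp add: bil_gram power2_eq_square)
    finally have 1: "vip D z z = (\<Sum>r\<in>R. (vip D (A r) y)\<^sup>2)" .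
    \<comment> \<open>\<open>y'\<close> is the expansion of \<open>y\<close> in the non-null
      vectors. The difference is null, hence mapped to 0 by every row in \<open>R\<close>.\<close>
    define y' where "y' = (\<lambda>i. \<Sum>k<D. Q k i * (B (Q k) y / w k))"
    have y': "B x y' = (\<Sum>k<D. B x (Q k) * (B (Q k) y / w k))" for x
      unfolding y'_def bil_sum_right ..
    have "B (\<lambda>i. y' i - y i) (\<lambda>i. y' i - y i) = B (\<lambda>i. y' i - y i) y' - B (\<lambda>i. y' i - y i) y"
      by (rule bil_diff_right)
    also have "\<dots> = 0" by (simp only: y' pv[of "\<lambda>i. y' i - y i"] diff_self)
    finally have "(\<Sum>r\<in>R. (vip D (A r) (\<lambda>i. y' i - y i))\<^sup>2) = 0"
      by (simp add: bil_gram power2_eq_square)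
    then have 2: "vip D (A r) (\<lambda>i. y' i - y i) = 0" if "r \<in> R" for r
      using R that by (simp add: sum_nonneg_eq_0_iff)
    have "vip D (U r) z = vip D (A r) y" if r: "r \<in> R" for r
    proof -
      have "vip D (U r) z = (\<Sum>k<D. vip D (A r) (Q k) * (B (Q k) y / w k))"
        unfolding vip_def[of D "U r"] by (intro sum.cong refl) (auto simp: U_def z_def w simp flip: real_sqrt_mult)
      also have "\<dots> = vip D (A r) y'"
        by (simp add: vip_def y'_def sum_distrib_left sum_distrib_right sum_divide_distrib) (subst sum.swap, simp add: mult.assoc)
      also have "\<dots> = vip D (A r) y"
        using 2[OF r] by (simp add: vip_def right_diff_distrib sum_subtractf)
      finally show ?thesis .
    qed
    with 1 show "\<exists>z. vip D z z = (\<Sum>r\<in>R. (vip D (A r) y)\<^sup>2) \<and> (\<forall>r\<in>R. vip D (U r) z = vip D (A r) y)"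
      by blast
  qed
qed

section \<open>Preconditioned iteration\<close>

text \<open>For \<open>u = (-x, 1)\<close> and \<open>M\<close> the Gram matrix of the augmented
  matrix, these are the entries of \<open>A^T (b - A x)\<close>; the last coordinate of
  \<open>u\<close> brings in \<open>b\<close>.\<close>

definition grad :: "nat \<Rightarrow> mtx \<Rightarrow> (nat \<Rightarrow> real) \<Rightarrow> nat \<Rightarrow> real" where
  "grad d M u c = (\<Sum>j<Suc d. M c j * u j)"

definition direction :: "nat \<Rightarrow> mtx \<Rightarrow> mtx \<Rightarrow> (nat \<Rightarrow> real) \<Rightarrow> nat \<Rightarrow> real" where
  "direction d M G u i = (\<Sum>c<d. gs_inv (Suc d) G d i c * grad d M u c)"

primrec iterate :: "nat \<Rightarrow> mtx \<Rightarrow> mtx \<Rightarrow> nat \<Rightarrow> nat \<Rightarrow> real" where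
  "iterate d M G 0 = gs (Suc d) G d"
| "iterate d M G (Suc t) = (\<lambda>i. iterate d M G t i - direction d M G (iterate d M G t) i)"

locale preconditioned = M: psd_form "Suc d" M + G: psd_form "Suc d" G
  for d :: nat and M G :: mtx +
  assumes lower: "\<And>y. bil (Suc d) M y y \<le> bil (Suc d) G y y"
    and upper: "\<And>y. bil (Suc d) G y y \<le> 3 * bil (Suc d) M y y"
begin

text \<open>A candidate \<open>x\<close> is represented by \<open>(-x, 1)\<close>, whose image is
  the residual \<open>b - A x\<close>. The last Gram--Schmidt vector ends in 1 and is orthogonal to
  the first \<open>d\<close> coordinates, so it represents a least squares solution.\<close>

definition opt :: "nat \<Rightarrow> real" where "opt = M.Q d"

lemma optimal:
  assumes "u d = 1"
  shows "M.B u u = M.B opt opt + M.B (\<lambda>i. u i - opt i) (\<lambda>i. u i - opt i)"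
proof -
  let ?e = "\<lambda>i. u i - opt i"
  have "M.B opt ?e = 0"
    unfolding opt_def by (rule M.bil_gs_supp[where d = d]) (use assms in \<open>auto simp: le_less_Suc_eq M.gs_diag\<close>)
  then have "M.B opt u = M.B opt opt" by (simp add: bil_diff_right)
  then show ?thesis unfolding M.bil_diff_self using M.bil_sym[of u opt] by simp
qed

lemma optimal_le: "u d = 1 \<Longrightarrow> M.B opt opt \<le> M.B u u"
  using optimal[of u] M.psd[of "\<lambda>i. u i - opt i"] by linarith

text \<open>\<open>G.Q d\<close> is optimal for \<open>G\<close>, so its value under
  \<open>M\<close> is at most three times the optimum; Pythagoras around \<open>opt\<close> takes
  one of the three away.\<close>

lemma initial:
  "M.B (\<lambda>i. G.Q d i - opt i) (\<lambda>i. G.Q d i - opt i) \<le> 2 * M.B opt opt"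
proof -
  let ?e = "\<lambda>i. opt i - G.Q d i"
  have "G.B (G.Q d) ?e = 0"
    unfolding opt_def by (rule G.bil_gs_supp[where d = d]) (auto simp: le_less_Suc_eq M.gs_diag G.gs_diag)
  then have "G.B (G.Q d) opt = G.B (G.Q d) (G.Q d)" by (simp add: bil_diff_right)
  then have "G.B ?e ?e = G.B opt opt - G.B (G.Q d) (G.Q d)"
    unfolding G.bil_diff_self using G.bil_sym[of opt "G.Q d"] by simp
  then have "G.B (G.Q d) (G.Q d) \<le> G.B opt opt" using G.psd[of ?e] by linarith
  then have "M.B (G.Q d) (G.Q d) \<le> 3 * M.B opt opt"
    using lower[of "G.Q d"] upper[of opt] by linarith
  then show ?thesis using optimal[of "G.Q d"] by (simp add: G.gs_diag)
qed

text \<open>For the step \<open>h\<close> both the \<open>M\<close>-product with \<open>e\<close>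
  and the \<open>G\<close>-square equal \<open>S\<close>, and \<open>M \<le> G\<close>, so the
  squared error drops by at least \<open>2 * S - S\<close>. Conversely, Cauchy--Schwarz in the
  \<open>G\<close>-orthogonal coordinates gives \<open>M(e,e)^2 \<le> S * G(e,e)\<close>, and
  \<open>G \<le> 3 M\<close> makes \<open>S\<close> at least a third of the squared error.\<close>

lemma contraction:
  assumes u: "u d = 1"
  defines "e \<equiv> (\<lambda>i. u i - opt i)"
  defines "e' \<equiv> (\<lambda>i. u i - direction d M G u i - opt i)"
  shows "M.B e' e' \<le> 2/3 * M.B e e" and "direction d M G u d = 0"
proof -
  let ?Q = G.Q and ?w = G.w
  define \<beta> where "\<beta> k = M.B (?Q k) e" for k
  define \<gamma> where "\<gamma> k = G.B (?Q k) e" for k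
  define S where "S = (\<Sum>k<d. \<beta> k * (\<beta> k / ?w k))"
  have e_supp: "d \<le> j \<Longrightarrow> j < Suc d \<Longrightarrow> e j = 0" for j
    using u by (auto simp: e_def opt_def le_less_Suc_eq M.gs_diag)
  \<comment> \<open>\<open>opt\<close> is orthogonal to these unit vectors, so the gradient sees
    only the error.\<close>
  have grad: "grad d M u c = M.B (unit_fun c) e" if c: "c < d" for c
  proof -
    have "grad d M u c = M.B u (unit_fun c)"
      unfolding grad_def using c by (auto simp: bil_unit_right M.sym mult.commute intro!: sum.cong)
    also have "\<dots> = M.B (unit_fun c) e"
      using M.gs_unit[of d c] c M.bil_sym[of "unit_fun c" opt] M.bil_sym[of u "unit_fun c"] by (simp add: e_def bil_diff_right opt_def)
    finally show ?thesis .
  qed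
  have qg: "(\<Sum>c<d. ?Q k c * grad d M u c) = \<beta> k" if k: "k < d" for k
  proof -
    have "\<beta> k = (\<Sum>c<Suc d. M.B e (unit_fun c) * ?Q k c)"
      unfolding \<beta>_def M.bil_sym[of "?Q k"] by (rule bil_expand)
    also have "\<dots> = (\<Sum>c<d. ?Q k c * grad d M u c)"
      using k by (simp add: G.gs_supp grad M.bil_sym[of e] mult.commute)
    finally show ?thesis by simp
  qed
  have dir: "direction d M G u = (\<lambda>i. \<Sum>k<d. ?Q k i * (\<beta> k / ?w k))"
  proof
    fix i
    have "direction d M G u i = (\<Sum>c<d. \<Sum>k<d. ?Q k i * ?Q k c / ?w k * grad d M u c)"
      by (simp add: direction_def gs_inv_eq sum_distrib_right)
    also have "\<dots> = (\<Sum>k<d. ?Q k i * ((\<Sum>c<d. ?Q k c * grad d M u c) / ?w k))"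
      by (subst sum.swap) (simp add: sum_distrib_left sum_divide_distrib mult.assoc)
    finally show "direction d M G u i = (\<Sum>k<d. ?Q k i * (\<beta> k / ?w k))" by (simp add: qg)
  qed
  show "direction d M G u d = 0"
    unfolding dir by (rule sum.neutral) (auto simp: G.gs_supp)
  let ?h = "direction d M G u"
  have he: "M.B ?h e = S"
    unfolding dir M.bil_sum_left S_def \<beta>_def ..
  have w: "0 \<le> ?w k" for k by (rule G.psd)
  have "G.B ?h ?h = (\<Sum>k<d. (\<Sum>l<d. G.B (?Q l) (?Q k) * (\<beta> l / ?w l)) * (\<beta> k / ?w k))"
    unfolding dir bil_sum_right G.bil_sum_left ..
  also have "\<dots> = (\<Sum>k<d. (\<Sum>l<d. if l = k then \<beta> k * (?w k / ?w k) else 0) * (\<beta> k / ?w k))"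
    by (intro sum.cong arg_cong2[where f = "(*)"] refl) (auto simp: G.gs_orthogonal)
  also have "\<dots> = S" unfolding S_def by (intro sum.cong refl) auto
  finally have hh: "M.B ?h ?h \<le> S" using lower[of ?h] by simp
  have e'_eq: "e' = (\<lambda>i. e i - ?h i)" by (auto simp: e_def e'_def)
  have 1: "M.B e' e' \<le> M.B e e - S"
    unfolding e'_eq M.bil_diff_self using hh he M.bil_sym[of e ?h] by simp
  \<comment> \<open>The expansion \<open>e2\<close> may differ from \<open>e\<close> if
    \<open>G\<close> is singular, but only by a vector that is null for \<open>G\<close> and hence,
    by \<open>lower\<close>, for \<open>M\<close>.\<close>
  define e2 where "e2 = (\<lambda>i. \<Sum>k<d. ?Q k i * (\<gamma> k / ?w k))"
  have pv: "G.B x e = (\<Sum>k<d. G.B x (?Q k) * (\<gamma> k / ?w k))" for x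
    unfolding \<gamma>_def by (rule G.parseval) (auto simp: e_supp)
  have "G.B x (\<lambda>i. e i - e2 i) = 0" for x
    unfolding bil_diff_right e2_def bil_sum_right pv[of x] by simp
  then have "M.B (\<lambda>i. e i - e2 i) (\<lambda>i. e i - e2 i) \<le> 0"
    using lower[of "\<lambda>i. e i - e2 i"] by simp
  then have "M.B (\<lambda>i. e i - e2 i) (\<lambda>i. e i - e2 i) = 0" using M.psd[of "\<lambda>i. e i - e2 i"] by simp
  from M.null_bil[OF this, of e] have "M.B e e = M.B e e2" by (simp add: bil_diff_right)
  also have "\<dots> = (\<Sum>k<d. (\<beta> k / sqrt (?w k)) * (\<gamma> k / sqrt (?w k)))"
    unfolding e2_def bil_sum_right by (simp add: \<beta>_def M.bil_sym[of e] w flip: real_sqrt_mult)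
  finally have "(M.B e e)\<^sup>2 \<le> (\<Sum>k<d. (\<beta> k / sqrt (?w k))\<^sup>2) * (\<Sum>k<d. (\<gamma> k / sqrt (?w k))\<^sup>2)"
    by (simp only: Cauchy_Schwarz_ineq_sum)
  also have "(\<Sum>k<d. (\<beta> k / sqrt (?w k))\<^sup>2) = S"
    unfolding S_def by (simp add: power_divide w power2_eq_square)
  also have "(\<Sum>k<d. (\<gamma> k / sqrt (?w k))\<^sup>2) = G.B e e"
    unfolding pv[of e] by (simp add: power_divide w power2_eq_square \<gamma>_def G.bil_sym[of e])
  finally have 2: "(M.B e e)\<^sup>2 \<le> S * G.B e e" .
  have S0: "0 \<le> S" unfolding S_def using w by (intro sum_nonneg) auto
  have "(M.B e e)\<^sup>2 \<le> S * (3 * M.B e e)"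
    using 2 mult_left_mono[OF upper[of e] S0] by linarith
  then have "M.B e e \<le> 3 * S"
    using M.psd[of e] S0 by (cases "M.B e e = 0") (auto simp: power2_eq_square)
  with 1 show "M.B e' e' \<le> 2/3 * M.B e e" by simp
qed

lemma iterate_last: "iterate d M G t d = 1"
  by (induction t) (auto simp: G.gs_diag contraction(2))

theorem iterate_error: "M.B (iterate d M G t) (iterate d M G t) \<le> (1 + 2 * (2/3) ^ t) * M.B opt opt"
proof -
  have "M.B (\<lambda>i. iterate d M G t i - opt i) (\<lambda>i. iterate d M G t i - opt i) \<le> (2/3) ^ t * (2 * M.B opt opt)"
  proof (induction t)
    case 0 show ?case using initial by simp
  next
    case (Suc t)
    show ?case using contraction(1)[of "iterate d M G t", OF iterate_last] Suc by simp
  qed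
  then show ?thesis using optimal[of "iterate d M G t", OF iterate_last] by (simp add: algebra_simps)
qed

end

section \<open>The random embedding\<close>

definition sketch_rows :: "nat \<Rightarrow> nat set \<Rightarrow> mtx \<Rightarrow> (nat \<Rightarrow> nat) \<Rightarrow> mtx" where
  "sketch_rows K R A f = (\<lambda>a l. hadamard K (\<lambda>b. count_sketch R f A b l) a)"

text \<open>Two distortions of 1/4 leave squared norms between 1/2 and 3/2 of the original; the
  factor 2 moves this range to the bounds 1 and 3 of \<open>preconditioned\<close>.\<close>

definition good_sample :: "nat \<Rightarrow> nat \<Rightarrow> nat \<Rightarrow> nat set \<Rightarrow> mtx \<Rightarrow> (nat \<Rightarrow> nat) \<Rightarrow> (nat \<Rightarrow> nat) \<Rightarrow> bool" where
  "good_sample D K m R A f s \<longleftrightarrow> (\<forall>y.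
     (\<Sum>r\<in>R. (vip D (A r) y)\<^sup>2) \<le> 2 / m * (\<Sum>q<m. (vip D (sketch_rows K R A f (s q)) y)\<^sup>2) \<and>
     2 / m * (\<Sum>q<m. (vip D (sketch_rows K R A f (s q)) y)\<^sup>2) \<le> 3 * (\<Sum>r\<in>R. (vip D (A r) y)\<^sup>2))"

lemma vip_count_sketch:
  "vip D (count_sketch R f A a) y = (\<Sum>r\<in>R. if f r div 2 = a then hash_sign (f r) * vip D (A r) y else 0)"
proof -
  have "vip D (count_sketch R f A a) y = (\<Sum>l<D. \<Sum>r\<in>R. if f r div 2 = a then hash_sign (f r) * (A r l * y l) else 0)"
    unfolding vip_def count_sketch_def
    by (intro sum.cong refl) (auto simp: sum_distrib_right if_distrib[of "\<lambda>x. x * _"] mult.assoc cong: if_cong)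
  also have "\<dots> = (\<Sum>r\<in>R. if f r div 2 = a then hash_sign (f r) * vip D (A r) y else 0)"
    by (subst sum.swap) (intro sum.cong refl, auto simp: vip_def sum_distrib_left)
  finally show ?thesis .
qed

lemma vip_sketch_rows:
  assumes "a < 2 ^ K"
  shows "vip D (sketch_rows K R A f a) y = hadamard K (\<lambda>b. vip D (count_sketch R f A b) y) a"
proof -
  have "vip D (sketch_rows K R A f a) y = (\<Sum>l<D. \<Sum>b<2 ^ K. hcoef K a b * (count_sketch R f A b l * y l))"
    unfolding vip_def sketch_rows_def using assms
    by (intro sum.cong refl) (simp add: hadamard_hcoef[of K K] sum_distrib_right mult.assoc)
  also have "\<dots> = (\<Sum>b<2 ^ K. hcoef K a b * vip D (count_sketch R f A b) y)"
    by (subst sum.swap) (simp add: vip_def sum_distrib_left)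
  finally show ?thesis using assms by (simp add: hadamard_hcoef[of K K])
qed

lemma sum_sketch_rows:
  "(\<Sum>a<2 ^ K. (vip D (sketch_rows K R A f a) y)\<^sup>2) = 2 ^ K * (\<Sum>b<2 ^ K. (vip D (count_sketch R f A b) y)\<^sup>2)"
proof -
  have "(\<Sum>a<2 ^ K. (vip D (sketch_rows K R A f a) y)\<^sup>2) = (\<Sum>a<2 ^ K. (hadamard K (\<lambda>b. vip D (count_sketch R f A b) y) a)\<^sup>2)"
    by (intro sum.cong refl) (simp add: vip_sketch_rows)
  then show ?thesis by (simp add: hadamard_norm)
qed

lemma prob_mono_support:
  assumes "\<And>x. x \<in> set_pmf p \<Longrightarrow> x \<in> A \<Longrightarrow> x \<in> B"
  shows "measure_pmf.prob p A \<le> measure_pmf.prob p B"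
  by (rule measure_pmf.finite_measure_mono_AE) (use assms in \<open>auto simp: AE_measure_pmf_iff\<close>)

lemma expectation_le_prob_plus:
  fixes g :: "'a \<Rightarrow> real"
  assumes "\<And>x. g x \<le> 1" "\<And>x. 0 \<le> g x" "\<And>x. x \<notin> E \<Longrightarrow> g x \<le> c" "0 \<le> c"
  shows "measure_pmf.expectation p g \<le> measure_pmf.prob p E + c"
proof -
  have "measure_pmf.expectation p g \<le> measure_pmf.expectation p (\<lambda>x. indicator E x + c)"
  proof (rule integral_mono)
    show "integrable (measure_pmf p) g"
      by (rule measure_pmf.integrable_const_bound[where B = 1]) (use assms in auto)
    show "integrable (measure_pmf p) (\<lambda>x. indicat_real E x + c)"
      by (rule measure_pmf.integrable_const_bound[where B = "1 + c"]) (use assms in \<open>auto simp: indicator_def\<close>)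
    show "g x \<le> indicator E x + c" for x
      using assms(1)[of x] assms(4) assms(3)[of x] by (cases "x \<in> E") auto
  qed
  also have "\<dots> = measure_pmf.prob p E + c"
    by (subst Bochner_Integration.integral_add) (auto intro: measure_pmf.integrable_const_bound[where B = 1])
  finally show ?thesis .
qed

text \<open>Hashing fails with probability at most \<open>64 D^2 / N \<le> 1/512\<close>. A
  transformed entry exceeds \<open>2 * sqrt K\<close> with probability at most
  \<open>2 * exp (-2 K) \<le> 2 / N^2\<close>, small enough for a union bound over
  \<open>N * D\<close> entries. Otherwise the squared row norms are at most \<open>4 K D\<close>,
  and moments of order \<open>p = K\<close> call for \<open>512 * K * (4 K D)\<close> samples, which
  is exactly \<open>m\<close>; sampling then fails with probability at most
  \<open>D / 2 ^ K\<close>. In total 3/512 is below 1/100.\<close>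

theorem good_sample_probability:
  assumes R: "finite R" and D: "1 \<le> D" and KD: "32768 * D\<^sup>2 \<le> 2 ^ K" and m_eq: "m = 2048 * K\<^sup>2 * D"
  defines "N \<equiv> 2 ^ K"
  shows "measure_pmf.prob (pair_pmf (Pi_pmf R 0 (\<lambda>_. pmf_of_set {..<2 * N})) (Pi_pmf {..<m} 0 (\<lambda>_. pmf_of_set {..<N})))
     {(f, s). good_sample D K m R A f s} \<ge> 99/100"
proof -
  obtain U where U1: "\<And>k. k < D \<Longrightarrow> (\<Sum>r\<in>R. (U r k)\<^sup>2) \<le> 1"
    and U2: "\<And>z. (\<Sum>r\<in>R. (vip D (U r) z)\<^sup>2) \<le> vip D z z"
    and U3: "\<And>y. \<exists>z. vip D z z = (\<Sum>r\<in>R. (vip D (A r) y)\<^sup>2) \<and> (\<forall>r\<in>R. vip D (U r) z = vip D (A r) y)"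
    by (rule orthonormal_coordinates[OF R, of D A]) blast
  have N: "0 < N" "real N = 2 ^ K" by (auto simp: N_def)
  have DN: "32768 * (real D)\<^sup>2 \<le> real N"
    using of_nat_mono[OF KD, where 'a = real] by (simp add: N_def)
  have DN1: "32768 * real D \<le> real N"
  proof -
    have "real D * 1 \<le> (real D)\<^sup>2" unfolding power2_eq_square using D by (intro mult_left_mono) auto
    then show ?thesis using DN by linarith
  qed
  have K: "0 < K" using DN1 D by (cases K) (auto simp: N_def)
  have m0: "0 < m" using m_eq K D by simp
  define p where "p = pmf_of_set (hashes N R)"
  have p: "Pi_pmf R 0 (\<lambda>_. pmf_of_set {..<2 * N}) = p"
    unfolding p_def hashes_def using R N by (intro Pi_pmf_of_set) (auto simp: lessThan_empty_iff)
  let ?q = "Pi_pmf {..<m} 0 (\<lambda>_. pmf_of_set {..<N})"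
  define E1 where "E1 = {f. \<not> (\<forall>z. \<bar>(\<Sum>a<N. (vip D (count_sketch R f U a) z)\<^sup>2) - (\<Sum>r\<in>R. (vip D (U r) z)\<^sup>2)\<bar> \<le> 1/4 * vip D z z)}"
  define F where "F i k = {f. \<bar>\<Sum>a<N. hcoef K i a * count_sketch R f U a k\<bar> > 2 * sqrt K}" for i k
  define E2 where "E2 = (\<Union>i<N. \<Union>k<D. F i k)"
  have "(\<Sum>r\<in>R. \<Sum>k<D. (U r k)\<^sup>2) \<le> D"
    using sum_mono[of "{..<D}" "\<lambda>k. \<Sum>r\<in>R. (U r k)\<^sup>2" "\<lambda>_. 1"] U1
    by (subst sum.swap) simp
  then have "measure_pmf.prob p E1 \<le> 64 * (real D)\<^sup>2 / N"
    unfolding E1_def p_def by (rule sketch_concentration[OF R N(1)])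
  also have "\<dots> \<le> 1/512" using DN N by (simp add: field_simps)
  finally have P1: "measure_pmf.prob p E1 \<le> 1/512" .
  have PF: "measure_pmf.prob p (F i k) \<le> 2 / (real N)\<^sup>2" if "i < N" "k < D" for i k
  proof -
    have "measure_pmf.prob p (F i k) \<le> 2 * exp (- ((2 * sqrt K)\<^sup>2 / 2))"
      unfolding p_def F_def
    proof (rule signed_sum_tail[OF R N(1)])
      fix a assume "a < N"
      then show "\<bar>hcoef K i a\<bar> = 1" using that by (simp add: hcoef_abs N_def)
    qed (use U1 that in auto)
    also have "\<dots> = 2 / exp 1 ^ (2 * K)"
      by (simp add: power_mult_distrib exp_minus inverse_eq_divide flip: exp_of_nat_mult)
    also have "\<dots> \<le> 2 / 2 ^ (2 * K)"
      using exp_ge_add_one_self[of 1] by (intro divide_left_mono power_mono) auto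
    finally show ?thesis by (simp add: N power_mult power2_eq_square flip: power_mult_distrib)
  qed
  have "measure_pmf.prob p E2 \<le> (\<Sum>i<N. measure_pmf.prob p (\<Union>k<D. F i k))"
    unfolding E2_def by (intro measure_UNION_le) auto
  also have "\<dots> \<le> (\<Sum>i<N. \<Sum>k<D. measure_pmf.prob p (F i k))"
    by (intro sum_mono measure_UNION_le) auto
  also have "\<dots> \<le> (\<Sum>i<N. \<Sum>k<D. 2 / (real N)\<^sup>2)"
    by (intro sum_mono PF) auto
  also have "\<dots> = 2 * real D / real N" using N by (simp add: power2_eq_square)
  also have "\<dots> \<le> 1/512" using DN1 N(1) by (simp add: field_simps)
  finally have P2: "measure_pmf.prob p E2 \<le> 1/512" .
  have P12: "measure_pmf.prob p (E1 \<union> E2) \<le> 1/256"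
  proof -
    have "measure_pmf.prob p (E1 \<union> E2) \<le> measure_pmf.prob p E1 + measure_pmf.prob p E2"
      by (rule measure_Un_le) auto
    then show ?thesis using P1 P2 by linarith
  qed
  have DN2: "real D / 2 ^ K \<le> 1/512" using DN1 N(1) unfolding N(2)[symmetric] by (simp add: field_simps)
  have cond: "measure_pmf.prob ?q {s. \<not> good_sample D K m R A f s} \<le> 1/512" if f: "f \<notin> E1 \<union> E2" for f
  proof -
    define y where "y = sketch_rows K R U f"
    have e1: "\<bar>(\<Sum>a<N. (vip D (count_sketch R f U a) z)\<^sup>2) - (\<Sum>r\<in>R. (vip D (U r) z)\<^sup>2)\<bar> \<le> 1/4 * vip D z z" for z
      using f unfolding E1_def by blast
    have e2: "(y a k)\<^sup>2 \<le> 4 * K" if "a < N" "k < D" for a k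
    proof -
      have "\<bar>y a k\<bar> \<le> 2 * sqrt K"
      proof -
        have "f \<notin> F a k" using f that unfolding E2_def by blast
        then show ?thesis using that(1) unfolding F_def y_def sketch_rows_def N_def
          by (simp add: hadamard_hcoef[of K K] not_less)
      qed
      then have "\<bar>y a k\<bar>\<^sup>2 \<le> (2 * sqrt K)\<^sup>2" by (intro power_mono) auto
      then show ?thesis by (simp add: power_mult_distrib)
    qed
    have sumy: "(\<Sum>a<N. (vip D (y a) z)\<^sup>2) = N * (\<Sum>a<N. (vip D (count_sketch R f U a) z)\<^sup>2)" for z
      unfolding y_def N_def using sum_sketch_rows[where y = z] by simp
    interpret row_sampling D m N y "4 * real K * real D"
    proof
      show "0 < m" "0 < N" by fact+
      show "vip D (y a) (y a) \<le> 4 * real K * real D" if "a < N" for a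
        using sum_mono[of "{..<D}" "\<lambda>k. (y a k)\<^sup>2" "\<lambda>_. 4 * real K"] e2 that
        by (simp add: vip_def power2_eq_square mult.commute)
      show "(\<Sum>a<N. (vip D (y a) z)\<^sup>2) \<le> real N * (5/4 * vip D z z)" for z
      proof -
        have "(\<Sum>a<N. (vip D (count_sketch R f U a) z)\<^sup>2) \<le> 5/4 * vip D z z"
          using e1[of z] U2[of z] by linarith
        then show ?thesis unfolding sumy by (rule mult_left_mono) simp
      qed
    qed
    have "measure_pmf.prob ?q {s. \<not> good_sample D K m R A f s} \<le> measure_pmf.prob ?q
      {s. \<not> (\<forall>z. \<bar>(\<Sum>r<m. (vip D (y (s r)) z)\<^sup>2) / m - (\<Sum>a<N. (vip D (y a) z)\<^sup>2) / N\<bar> \<le> 1/4 * vip D z z)}"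
    proof (rule prob_mono_support)
      fix s assume sq: "s \<in> set_pmf ?q" and "s \<in> {s. \<not> good_sample D K m R A f s}"
      then have bad: "\<not> good_sample D K m R A f s" by simp
      have s: "s q < N" if "q < m" for q
        using that N(1) sq set_Pi_pmf[of "{..<m}" 0 "\<lambda>_. pmf_of_set {..<N}"]
        by (auto simp: PiE_dflt_def lessThan_empty_iff)
      have "\<not> (\<forall>z. \<bar>(\<Sum>r<m. (vip D (y (s r)) z)\<^sup>2) / m - (\<Sum>a<N. (vip D (y a) z)\<^sup>2) / N\<bar> \<le> 1/4 * vip D z z)"
      proof
        assume close: "\<forall>z. \<bar>(\<Sum>r<m. (vip D (y (s r)) z)\<^sup>2) / m - (\<Sum>a<N. (vip D (y a) z)\<^sup>2) / N\<bar> \<le> 1/4 * vip D z z"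
        have "good_sample D K m R A f s"
          unfolding good_sample_def
        proof
          fix x
          let ?M = "\<Sum>r\<in>R. (vip D (A r) x)\<^sup>2"
          obtain z where z: "vip D z z = ?M" "\<And>r. r \<in> R \<Longrightarrow> vip D (U r) z = vip D (A r) x"
            using U3[of x] by blast
          \<comment> \<open>The sketch is linear in the rows, so it sees only the values
            \<open>vip D (A r) x\<close>, and these are reproduced by \<open>U\<close> and
            \<open>z\<close>.\<close>
          have cs: "vip D (count_sketch R f A b) x = vip D (count_sketch R f U b) z" for b
            unfolding vip_count_sketch by (intro sum.cong refl) (auto simp: z)
          have "vip D (sketch_rows K R A f a) x = vip D (y a) z" if "a < N" for a
            using that unfolding y_def N_def by (simp add: vip_sketch_rows cs)
          then have rows: "(\<Sum>q<m. (vip D (sketch_rows K R A f (s q)) x)\<^sup>2) = (\<Sum>q<m. (vip D (y (s q)) z)\<^sup>2)"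
            by (intro sum.cong refl) (auto simp: s)
          have "(\<Sum>r\<in>R. (vip D (U r) z)\<^sup>2) = ?M" by (intro sum.cong refl) (simp add: z)
          then have "\<bar>(\<Sum>a<N. (vip D (y a) z)\<^sup>2) / N - ?M\<bar> \<le> 1/4 * ?M"
            using e1[of z] N unfolding sumy by (simp add: z(1))
          moreover have "\<bar>(\<Sum>r<m. (vip D (y (s r)) z)\<^sup>2) / m - (\<Sum>a<N. (vip D (y a) z)\<^sup>2) / N\<bar> \<le> 1/4 * ?M"
            using close z(1) by metis
          ultimately have "?M \<le> 2 * ((\<Sum>r<m. (vip D (y (s r)) z)\<^sup>2) / m) \<and> 2 * ((\<Sum>r<m. (vip D (y (s r)) z)\<^sup>2) / m) \<le> 3 * ?M"
            by (intro conjI; linarith)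
          then show "?M \<le> 2 / m * (\<Sum>q<m. (vip D (sketch_rows K R A f (s q)) x)\<^sup>2) \<and>
             2 / m * (\<Sum>q<m. (vip D (sketch_rows K R A f (s q)) x)\<^sup>2) \<le> 3 * ?M"
            unfolding rows by simp
        qed
        then show False using bad by blast
      qed
      then show "s \<in> {s. \<not> (\<forall>z. \<bar>(\<Sum>r<m. (vip D (y (s r)) z)\<^sup>2) / m - (\<Sum>a<N. (vip D (y a) z)\<^sup>2) / N\<bar> \<le> 1/4 * vip D z z)}"
        by simp
    qed
    also have "\<dots> \<le> D / 2 ^ K"
      by (rule sampling_concentration) (use K in \<open>auto simp: m_eq power2_eq_square\<close>)
    also note DN2
    finally show ?thesis .
  qed
  let ?bad = "{(f, s). \<not> good_sample D K m R A f s}"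
  have "measure_pmf.prob (pair_pmf p ?q) ?bad
     = measure_pmf.expectation p (\<lambda>f. measure_pmf.prob ?q {s. \<not> good_sample D K m R A f s})"
  proof -
    have "pair_pmf p ?q = bind_pmf p (\<lambda>f. map_pmf (Pair f) ?q)"
      by (simp add: pair_pmf_def map_pmf_def)
    then have "ennreal (measure_pmf.prob (pair_pmf p ?q) ?bad)
       = (\<integral>\<^sup>+ f. ennreal (measure_pmf.prob ?q {s. \<not> good_sample D K m R A f s}) \<partial>measure_pmf p)"
      by (simp add: measure_pmf.emeasure_eq_measure[symmetric] vimage_def)
    also have "\<dots> = ennreal (measure_pmf.expectation p (\<lambda>f. measure_pmf.prob ?q {s. \<not> good_sample D K m R A f s}))"
      by (intro nn_integral_eq_integral measure_pmf.integrable_const_bound[where B = 1]) auto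
    finally show ?thesis by simp
  qed
  also have "\<dots> \<le> measure_pmf.prob p (E1 \<union> E2) + 1/512"
    by (rule expectation_le_prob_plus) (use cond in auto)
  also have "\<dots> \<le> 1/100" using P12 by simp
  finally have bad: "measure_pmf.prob (pair_pmf p ?q) ?bad \<le> 1/100" .
  have "measure_pmf.prob (pair_pmf p ?q) {(f, s). good_sample D K m R A f s} = 1 - measure_pmf.prob (pair_pmf p ?q) ?bad"
    by (subst measure_pmf.prob_compl[symmetric]) (auto intro!: arg_cong[where f = "measure _"])
  then show ?thesis using bad unfolding p by simp
qed

section \<open>Reasoning about programs\<close>

lemma run_add: "run W (s + t) c = bind_pmf (run W s c) (run W t)"
  by (induction s arbitrary: c) (auto simp: bind_return_pmf bind_assoc_pmf intro!: bind_pmf_cong)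

lemma run_halted: "run W t (Some ([], m)) = return_pmf (Some ([], m))"
  by (induction t) (simp_all add: bind_return_pmf)

text \<open>Quantifying over the rest \<open>cs\<close> of the stack makes executions composable.
  The result is a point mass, so this describes deterministic code only; the loops that draw are
  treated separately by \<open>run_draws\<close>.\<close>

definition reach :: "nat \<Rightarrow> nat \<Rightarrow> com \<Rightarrow> memory \<Rightarrow> memory \<Rightarrow> bool" where
  "reach W t c m m' \<longleftrightarrow> (\<forall>cs. run W t (Some (c # cs, m)) = return_pmf (Some (cs, m')))"

definition triple :: "nat \<Rightarrow> memory \<Rightarrow> com \<Rightarrow> nat \<Rightarrow> (memory \<Rightarrow> bool) \<Rightarrow> bool" where
  "triple W m c T Q \<longleftrightarrow> (\<exists>t m'. t \<le> T \<and> reach W t c m m' \<and> Q m')"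

lemma triple_run:
  assumes "triple W m c T Q" "T \<le> T'"
  shows "\<exists>m'. run W T' (Some ([c], m)) = return_pmf (Some ([], m')) \<and> Q m'"
proof -
  obtain t m' where t: "t \<le> T" "reach W t c m m'" "Q m'" using assms(1) by (auto simp: triple_def)
  have "run W (t + (T' - t)) (Some ([c], m)) = return_pmf (Some ([], m'))"
    using t(2) unfolding run_add by (simp add: reach_def bind_return_pmf run_halted)
  then show ?thesis using t assms(2) by auto
qed

lemma reach_Seq:
  assumes "reach W s c m m1" "reach W t d m1 m2"
  shows "reach W (Suc (s + t)) (Seq c d) m m2"
  using assms unfolding reach_def by (simp add: bind_return_pmf run_add)

lemma triple_Seq:
  assumes "triple W m c T1 Q1" "\<And>m'. Q1 m' \<Longrightarrow> triple W m' d T2 Q2" "Suc (T1 + T2) \<le> T"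
  shows "triple W m (Seq c d) T Q2"
proof -
  obtain t1 m1 where 1: "t1 \<le> T1" "reach W t1 c m m1" "Q1 m1" using assms(1) by (auto simp: triple_def)
  obtain t2 m2 where 2: "t2 \<le> T2" "reach W t2 d m1 m2" "Q2 m2"
    using assms(2)[OF 1(3)] by (auto simp: triple_def)
  show ?thesis unfolding triple_def
    using reach_Seq[OF 1(2) 2(2)] 1 2 assms(3) by (intro exI[of _ "Suc (t1 + t2)"] exI[of _ m2]) auto
qed

lemma triple_RWrite:
  assumes "Q (write_real x (ival e m) (rval f m) m)" "1 \<le> T"
  shows "triple W m (RWrite x e f) T Q"
  unfolding triple_def reach_def
  using assms by (intro exI[of _ 1] exI[of _ "write_real x (ival e m) (rval f m) m"]) (simp add: bind_return_pmf)

lemma triple_IWrite: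
  assumes "Q (write_word x (ival e m) (ival f m) m)" "ival f m \<le> W" "1 \<le> T"
  shows "triple W m (IWrite x e f) T Q"
  unfolding triple_def reach_def
  using assms by (intro exI[of _ 1] exI[of _ "write_word x (ival e m) (ival f m) m"]) (simp add: bind_return_pmf)

lemma triple_weaken:
  assumes "triple W m c T Q" "\<And>m'. Q m' \<Longrightarrow> Q' m'" "T \<le> T'"
  shows "triple W m c T' Q'"
  using assms unfolding triple_def by (meson order_trans)

lemma triple_While:
  assumes "\<And>i m. i < n \<Longrightarrow> J i m \<Longrightarrow> bval b m \<and> triple W m c T (J (Suc i))"
    and "\<And>m. J n m \<Longrightarrow> \<not> bval b m" and "J 0 m"
  shows "triple W m (While b c) (n * Suc T + 1) (J n)"
proof -
  have "triple W m (While b c) ((n - i) * Suc T + 1) (J n)" if "i \<le> n" "J i m" for i m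
    using that
  proof (induction "n - i" arbitrary: i m)
    case 0
    then have "reach W 1 (While b c) m m" using assms(2) by (simp add: reach_def bind_return_pmf)
    then show ?case using 0 unfolding triple_def by (intro exI[of _ 1] exI[of _ m]) auto
  next
    case (Suc k)
    then have i: "i < n" by simp
    have b: "bval b m" and "triple W m c T (J (Suc i))" using assms(1)[OF i Suc.prems(2)] by auto
    then obtain t m1 where 1: "t \<le> T" "reach W t c m m1" "J (Suc i) m1" by (auto simp: triple_def)
    have "triple W m1 (While b c) ((n - Suc i) * Suc T + 1) (J n)"
      using Suc.hyps(1)[of "Suc i" m1] Suc.hyps(2) i 1(3) by simp
    then obtain t' m2 where 2: "t' \<le> (n - Suc i) * Suc T + 1" "reach W t' (While b c) m1 m2" "J n m2"
      by (auto simp: triple_def)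
    have "reach W (Suc (t + t')) (While b c) m m2"
      using b 1(2) 2(2) unfolding reach_def by (simp add: bind_return_pmf run_add)
    moreover have "Suc (t + t') \<le> (n - i) * Suc T + 1"
    proof -
      have "n - i = Suc (n - Suc i)" using i by simp
      then show ?thesis using 1(1) 2(1) by simp
    qed
    ultimately show ?case using 2(3) unfolding triple_def by blast
  qed
  from this[of 0 m] assms(3) show ?thesis by simp
qed

section \<open>Counting loops and their running times\<close>

abbreviation var :: "name \<Rightarrow> iexp" where "var v \<equiv> IRead v (INum 0)"

definition For :: "name \<Rightarrow> iexp \<Rightarrow> com \<Rightarrow> com" where
  "For v e c = Seq (IWrite v (INum 0) (INum 0))
     (While (ILess (var v) e) (Seq c (IWrite v (INum 0) (IAdd (var v) (INum 1)))))"

lemma write_word_simps [simp]: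
  "words (write_word x i v m) = (words m)(x := (words m x)(i := v))"
  "reals (write_word x i v m) = reals m"
  by (simp_all add: write_word_def)

lemma write_real_simps [simp]:
  "reals (write_real x i v m) = (reals m)(x := (reals m x)(i := v))"
  "words (write_real x i v m) = words m"
  by (simp_all add: write_real_def)

text \<open>A round costs the test, the unfolding of the sequence, the body and the increment; the
  other three steps are the outer sequence, the initialisation and the final test. The body has to
  establish \<open>J\<close> for the memory with the increment already made, because
  \<open>J\<close> may mention the counter.\<close>

lemma triple_For:
  assumes n: "n \<le> W"
    and bound: "\<And>i m. i \<le> n \<Longrightarrow> J i m \<Longrightarrow> words m v 0 = i \<Longrightarrow> ival e m = n"
    and body: "\<And>i m. i < n \<Longrightarrow> J i m \<Longrightarrow> words m v 0 = i \<Longrightarrow>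
       triple W m c T (\<lambda>m'. J (Suc i) (write_word v 0 (Suc i) m') \<and> words m' v 0 = i)"
    and init: "J 0 (write_word v 0 0 m)"
  shows "triple W m (For v e c) (n * (T + 3) + 3) (\<lambda>m'. J n m' \<and> words m' v 0 = n)"
  unfolding For_def
proof (rule triple_Seq)
  show "triple W m (IWrite v (INum 0) (INum 0)) 1 (\<lambda>m'. J 0 m' \<and> words m' v 0 = 0)"
    by (rule triple_IWrite) (use init in auto)
  fix m assume m: "J 0 m \<and> words m v 0 = 0"
  show "triple W m (While (ILess (var v) e) (Seq c (IWrite v (INum 0) (IAdd (var v) (INum 1)))))
     (n * Suc (T + 2) + 1) (\<lambda>m'. J n m' \<and> words m' v 0 = n)"
  proof (rule triple_While[where J = "\<lambda>i m. J i m \<and> words m v 0 = i"])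
    fix i m assume i: "i < n" and m: "J i m \<and> words m v 0 = i"
    have "triple W m (Seq c (IWrite v (INum 0) (IAdd (var v) (INum 1)))) (T + 2) (\<lambda>m. J (Suc i) m \<and> words m v 0 = Suc i)"
    proof (rule triple_Seq[OF body[OF i]])
      fix m' assume m': "J (Suc i) (write_word v 0 (Suc i) m') \<and> words m' v 0 = i"
      then show "triple W m' (IWrite v (INum 0) (IAdd (var v) (INum 1))) 1 (\<lambda>m. J (Suc i) m \<and> words m v 0 = Suc i)"
        using n i by (intro triple_IWrite) auto
    qed (use m in auto)
    then show "bval (ILess (var v) e) m \<and> triple W m (Seq c (IWrite v (INum 0) (IAdd (var v) (INum 1)))) (T + 2) (\<lambda>m. J (Suc i) m \<and> words m v 0 = Suc i)"
      using bound[of i m] i m by simp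
  next
    fix m assume "J n m \<and> words m v 0 = n"
    then show "\<not> bval (ILess (var v) e) m" using bound[of n m] by simp
  qed (use m in auto)
qed (simp add: algebra_simps)

definition upd :: "name \<Rightarrow> name \<Rightarrow> memory \<Rightarrow> nat \<Rightarrow> (nat \<Rightarrow> real) \<Rightarrow> memory" where
  "upd v x m i X = m\<lparr>words := (words m)(v := (words m v)(0 := i)), reals := (reals m)(x := X)\<rparr>"

lemma upd_simps [simp]:
  "words (upd v x m i X) = (words m)(v := (words m v)(0 := i))"
  "reals (upd v x m i X) = (reals m)(x := X)"
  by (simp_all add: upd_def)

lemma write_word_upd: "write_word v 0 k (upd v x m i X) = upd v x m k X"
  by (simp add: upd_def write_word_def)

lemma write_real_upd: "write_real x j y (upd v x m i X) = upd v x m i (X(j := y))"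
  by (simp add: upd_def write_real_def)

lemma write_word_eq_upd: "write_word v 0 k m = upd v x m k (reals m x)"
  by (simp add: upd_def write_word_def)

text \<open>In the next two lemmas the right-hand side \<open>f\<close> must not depend on the array \<open>x\<close> being
  written, which is what the quantification over \<open>X\<close> expresses.\<close>

lemma triple_accumulate:
  assumes n: "n \<le> W"
    and bound: "\<And>i X. i \<le> n \<Longrightarrow> ival e (upd v x m i X) = n"
    and addr: "\<And>i X. i < n \<Longrightarrow> ival a (upd v x m i X) = \<alpha> i"
    and val: "\<And>i X. i < n \<Longrightarrow> rval f (upd v x m i X) = \<phi> i"
  shows "triple W m (For v e (RWrite x a (RAdd (RRead x a) f))) (4 * n + 3)
    (\<lambda>m'. m' = upd v x m n (\<lambda>j. reals m x j + (\<Sum>i<n. if \<alpha> i = j then \<phi> i else 0)))"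
proof -
  let ?S = "\<lambda>i j. reals m x j + (\<Sum>i<i. if \<alpha> i = j then \<phi> i else 0)"
  have "triple W m (For v e (RWrite x a (RAdd (RRead x a) f))) (n * (1 + 3) + 3)
    (\<lambda>m'. m' = upd v x m n (?S n) \<and> words m' v 0 = n)"
  proof (rule triple_For[where J = "\<lambda>i m'. m' = upd v x m i (?S i)", OF n])
    fix i m' assume i: "i < n" and m': "m' = upd v x m i (?S i)"
    have "(?S i)(\<alpha> i := ?S i (\<alpha> i) + \<phi> i) = ?S (Suc i)" by (auto simp: fun_eq_iff)
    then show "triple W m' (RWrite x a (RAdd (RRead x a) f)) 1
       (\<lambda>m'. write_word v 0 (Suc i) m' = upd v x m (Suc i) (?S (Suc i)) \<and> words m' v 0 = i)"
      by (intro triple_RWrite) (simp_all add: m' addr[OF i] val[OF i] write_real_upd write_word_upd)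
  next
    show "write_word v 0 0 m = upd v x m 0 (?S 0)" by (simp add: write_word_eq_upd[where x = x])
  qed (use bound in auto)
  then show ?thesis by (rule triple_weaken) auto
qed

lemma triple_fill:
  assumes n: "n \<le> W"
    and bound: "\<And>i X. i \<le> n \<Longrightarrow> ival e (upd v x m i X) = n"
    and val: "\<And>i X. i < n \<Longrightarrow> rval f (upd v x m i X) = \<phi> i"
  shows "triple W m (For v e (RWrite x (var v) f)) (4 * n + 3)
    (\<lambda>m'. m' = upd v x m n (\<lambda>j. if j < n then \<phi> j else reals m x j))"
proof -
  let ?S = "\<lambda>i j. if j < i then \<phi> j else reals m x j"
  have "triple W m (For v e (RWrite x (var v) f)) (n * (1 + 3) + 3)
    (\<lambda>m'. m' = upd v x m n (?S n) \<and> words m' v 0 = n)"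
  proof (rule triple_For[where J = "\<lambda>i m'. m' = upd v x m i (?S i)", OF n])
    fix i m' assume i: "i < n" and m': "m' = upd v x m i (?S i)"
    have "(?S i)(i := \<phi> i) = ?S (Suc i)" by (auto simp: fun_eq_iff)
    then show "triple W m' (RWrite x (var v) f) 1
       (\<lambda>m'. write_word v 0 (Suc i) m' = upd v x m (Suc i) (?S (Suc i)) \<and> words m' v 0 = i)"
      by (intro triple_RWrite) (simp_all add: m' val[OF i] write_real_upd write_word_upd)
  next
    show "write_word v 0 0 m = upd v x m 0 (?S 0)" by (simp add: write_word_eq_upd[where x = x])
  qed (use bound in auto)
  then show ?thesis by (rule triple_weaken) auto
qed

section \<open>Loops of random draws\<close>

text \<open>A row is hashed anew at each of its nonzeros and the last draw wins. Redrawing one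
  coordinate of a product distribution does not change the distribution.\<close>

lemma Pi_pmf_overwrite:
  assumes "finite A"
  shows "bind_pmf (Pi_pmf A d (\<lambda>_. p)) (\<lambda>f. map_pmf (\<lambda>v. f(x := v)) p) = Pi_pmf (insert x A) d (\<lambda>_. p)"
proof -
  have fresh: "bind_pmf (Pi_pmf B d (\<lambda>_. p)) (\<lambda>f. map_pmf (\<lambda>v. f(x := v)) p) = Pi_pmf (insert x B) d (\<lambda>_. p)"
    if "finite B" "x \<notin> B" for B
    using that unfolding Pi_pmf_insert'[OF that] map_pmf_def by (subst bind_commute_pmf) simp
  show ?thesis
  proof (cases "x \<in> A")
    case False then show ?thesis using fresh assms by simp
  next
    case True
    let ?P = "Pi_pmf (A - {x}) d (\<lambda>_. p)"
    have A: "Pi_pmf A d (\<lambda>_. p) = bind_pmf ?P (\<lambda>f. map_pmf (\<lambda>v. f(x := v)) p)"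
      using fresh[of "A - {x}"] assms True by (simp add: insert_absorb)
    have "bind_pmf (Pi_pmf A d (\<lambda>_. p)) (\<lambda>f. map_pmf (\<lambda>v. f(x := v)) p)
      = bind_pmf ?P (\<lambda>f. map_pmf (\<lambda>v. f(x := v)) p)"
      unfolding A by (simp add: map_pmf_def bind_assoc_pmf bind_return_pmf)
    then show ?thesis using A True by (simp add: insert_absorb)
  qed
qed

definition updw :: "name \<Rightarrow> name \<Rightarrow> memory \<Rightarrow> nat \<Rightarrow> (nat \<Rightarrow> nat) \<Rightarrow> memory" where
  "updw v x m i f = m\<lparr>words := (words m)(x := f, v := (words m v)(0 := i))\<rparr>"

lemma updw_simps [simp]:
  "words (updw v x m i f) = (words m)(x := f, v := (words m v)(0 := i))"
  "reals (updw v x m i f) = reals m"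
  by (simp_all add: updw_def)

text \<open>The number of steps is exact, so after it every branch is at the same point of the
  program. Cells that are never addressed keep the initial 0, which is the default value of the
  product distribution.\<close>

lemma run_draws:
  assumes n: "n \<le> W" and vx: "v \<noteq> x" and M: "0 < M" "M \<le> W" and zero: "words m x = (\<lambda>_. 0)"
    and bound: "\<And>i f. i \<le> n \<Longrightarrow> ival e (updw v x m i f) = n"
    and addr: "\<And>i f. i < n \<Longrightarrow> ival a (updw v x m i f) = \<alpha> i"
    and range: "\<And>i f. i < n \<Longrightarrow> ival g (updw v x m i f) = M"
  shows "run W (4 * n + 3) (Some (For v e (Draw x a g) # cs, m))
    = map_pmf (\<lambda>f. Some (cs, updw v x m n f)) (Pi_pmf (\<alpha> ` {..<n}) 0 (\<lambda>_. pmf_of_set {..<M}))"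
proof -
  let ?c = "Seq (Draw x a g) (IWrite v (INum 0) (IAdd (var v) (INum 1)))"
  let ?w = "While (ILess (var v) e) ?c"
  let ?P = "\<lambda>i. Pi_pmf (\<alpha> ` {..<i}) 0 (\<lambda>_. pmf_of_set {..<M})"
  have start: "run W 2 (Some (For v e (Draw x a g) # cs, m)) = return_pmf (Some (?w # cs, updw v x m 0 (\<lambda>_. 0)))"
  proof -
    have "write_word v 0 0 m = updw v x m 0 (\<lambda>_. 0)"
      using vx zero by (simp add: write_word_def updw_def fun_upd_twist fun_upd_idem)
    then show ?thesis by (simp add: For_def bind_return_pmf numeral_2_eq_2)
  qed
  have iter: "run W 4 (Some (?w # cs, updw v x m i f))
     = map_pmf (\<lambda>w. Some (?w # cs, updw v x m (Suc i) (f(\<alpha> i := w)))) (pmf_of_set {..<M})" if i: "i < n" for i f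
  proof -
    have eq: "write_word v 0 (Suc i) (write_word x (\<alpha> i) w (updw v x m i f)) = updw v x m (Suc i) (f(\<alpha> i := w))" for w
      using vx by (simp add: write_word_def updw_def fun_eq_iff)
    have "run W 4 (Some (?w # cs, updw v x m i f)) =
      bind_pmf (pmf_of_set {..<M}) (\<lambda>w. run W 1 (Some (IWrite v (INum 0) (IAdd (var v) (INum 1)) # ?w # cs, write_word x (\<alpha> i) w (updw v x m i f))))"
      using i M bound[of i f] addr[OF i, of f] range[OF i, of f]
      by (simp add: numeral_eq_Suc bind_return_pmf map_pmf_def bind_assoc_pmf)
    then show ?thesis
      using vx n i eq by (simp add: bind_return_pmf map_pmf_def)
  qed
  have loop: "run W (4 * i) (Some (?w # cs, updw v x m 0 (\<lambda>_. 0))) = map_pmf (\<lambda>f. Some (?w # cs, updw v x m i f)) (?P i)"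
    if "i \<le> n" for i
    using that
  proof (induction i)
    case 0
    then show ?case by simp
  next
    case (Suc i)
    have "run W (4 * Suc i) (Some (?w # cs, updw v x m 0 (\<lambda>_. 0)))
      = bind_pmf (?P i) (\<lambda>f. run W 4 (Some (?w # cs, updw v x m i f)))"
      using Suc run_add[of W "4 * i" 4] by (simp add: bind_map_pmf add.commute)
    also have "\<dots> = map_pmf (\<lambda>f. Some (?w # cs, updw v x m (Suc i) f))
       (bind_pmf (?P i) (\<lambda>f. map_pmf (\<lambda>w. f(\<alpha> i := w)) (pmf_of_set {..<M})))"
      using Suc.prems iter by (simp add: map_bind_pmf pmf.map_comp o_def)
    also have "bind_pmf (?P i) (\<lambda>f. map_pmf (\<lambda>w. f(\<alpha> i := w)) (pmf_of_set {..<M})) = ?P (Suc i)"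
      by (simp add: Pi_pmf_overwrite lessThan_Suc)
    finally show ?case .
  qed
  have "run W (4 * n + 3) (Some (For v e (Draw x a g) # cs, m))
     = bind_pmf (run W 2 (Some (For v e (Draw x a g) # cs, m))) (\<lambda>c. bind_pmf (run W (4 * n) c) (run W 1))"
  proof -
    have "run W (4 * n + 1) = (\<lambda>c. bind_pmf (run W (4 * n) c) (run W 1))"
      by (intro ext run_add)
    moreover have "4 * n + 3 = 2 + (4 * n + 1)" by simp
    ultimately show ?thesis by (simp only: run_add[of W 2])
  qed
  also have "\<dots> = bind_pmf (?P n) (\<lambda>f. run W 1 (Some (?w # cs, updw v x m n f)))"
    using loop[of n] by (simp add: start bind_return_pmf bind_map_pmf)
  also have "\<dots> = map_pmf (\<lambda>f. Some (cs, updw v x m n f)) (?P n)"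
    using bound[of n] by (simp add: map_pmf_def bind_return_pmf)
  finally show ?thesis .
qed

section \<open>The algorithm\<close>

text \<open>The single counter \<open>t\<close> of a loop encodes several indices in mixed radix.\<close>

abbreviation "tt \<equiv> var ''t''"
abbreviation "jj \<equiv> var ''j''"
abbreviation "DD \<equiv> IAdd (var ''d'') (INum 1)"

definition Acc :: "name \<Rightarrow> iexp \<Rightarrow> iexp \<Rightarrow> rexp \<Rightarrow> com" where
  "Acc x e a f = For ''t'' e (RWrite x a (RAdd (RRead x a) f))"

definition Fill :: "name \<Rightarrow> iexp \<Rightarrow> rexp \<Rightarrow> com" where
  "Fill x e f = For ''t'' e (RWrite x tt f)"

text \<open>Words have no exponentiation, so the powers of two are tabulated in \<open>p\<close>;
  the table serves again as the strides of the Hadamard layers.\<close>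

definition Sizes :: com where
  "Sizes = Seq (IWrite ''p'' (INum 0) (INum 1))
   (Seq (While (ILess (IRead ''p'' (var ''K'')) (IMul (INum 32768) (IMul DD DD)))
      (Seq (IWrite ''p'' (IAdd (var ''K'') (INum 1)) (IMul (INum 2) (IRead ''p'' (var ''K''))))
           (IWrite ''K'' (INum 0) (IAdd (var ''K'') (INum 1)))))
   (Seq (IWrite ''N'' (INum 0) (IRead ''p'' (var ''K'')))
        (IWrite ''m'' (INum 0) (IMul (INum 2048) (IMul (IMul (var ''K'') (var ''K'')) DD)))))"

text \<open>Looping over nonzeros rather than rows keeps the cost independent of \<open>n\<close>
  and leaves the zero rows unhashed.\<close>

definition Draw_Hash :: com where
  "Draw_Hash = For ''t'' (var ''nnz'') (Draw ''h'' (IRead ''row'' tt) (IMul (INum 2) (var ''N'')))"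

definition Draw_Samples :: com where
  "Draw_Samples = For ''t'' (var ''m'') (Draw ''s'' tt (var ''N''))"

abbreviation "hash_row \<equiv> IRead ''h'' (IRead ''row'' tt)"
abbreviation "sign_row \<equiv> RSub (ROfNat (INum 1)) (RMul (ROfNat (INum 2)) (ROfNat (IMod hash_row (INum 2))))"

definition Count :: com where
  "Count = Acc ''c'' (var ''nnz'') (IRead ''row'' tt) (ROfNat (INum 1))"

definition Sketch_Matrix :: com where
  "Sketch_Matrix = Acc ''B'' (var ''nnz'') (IAdd (IMul (IDiv hash_row (INum 2)) DD) (IRead ''col'' tt))
     (RMul sign_row (RRead ''val'' tt))"

text \<open>The right-hand side entry \<open>b r\<close> is spread evenly over the nonzeros of row \<open>r\<close>, so that no
  row has to be recognised as seen before.\<close>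

definition Sketch_Vector :: com where
  "Sketch_Vector = Acc ''B'' (var ''nnz'') (IAdd (IMul (IDiv hash_row (INum 2)) DD) (var ''d''))
     (RMul sign_row (RDiv (RRead ''b'' (IRead ''row'' tt)) (RRead ''c'' (IRead ''row'' tt))))"

definition Sketch :: com where
  "Sketch = Seq Count (Seq Sketch_Matrix Sketch_Vector)"

abbreviation "ND \<equiv> IMul (var ''N'') DD"
abbreviation "lsize \<equiv> IRead ''p'' (IDiv tt ND)"
abbreviation "lbit \<equiv> IMod (IDiv (IMod (IDiv tt DD) (var ''N'')) lsize) (INum 2)"
abbreviation "lowaddr \<equiv> ISub tt (IMul lbit (IMul lsize DD))"

abbreviation "butterfly \<equiv> RAdd (RRead ''B'' lowaddr)
       (RMul (RSub (ROfNat (INum 1)) (RMul (ROfNat (INum 2)) (ROfNat lbit)))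
             (RRead ''B'' (IAdd lowaddr (IMul lsize DD))))"

text \<open>The layers are stored one after another in blocks of \<open>N * D\<close> cells, so no
  butterfly destroys an input of another one; \<open>t\<close> encodes layer, row and
  column.\<close>

definition Hadamard :: com where
  "Hadamard = For ''t'' (IMul (var ''K'') ND) (RWrite ''B'' (IAdd tt ND) butterfly)"

abbreviation "rowaddr \<equiv> IAdd (IMul (var ''K'') ND) (IMul (IRead ''s'' (IDiv tt (IMul DD DD))) DD)"

definition Gram :: com where
  "Gram = Acc ''G'' (IMul (var ''m'') (IMul DD DD)) (IAdd (IMul (IMod (IDiv tt DD) DD) DD) (IMod tt DD))
     (RMul (RDiv (ROfNat (INum 2)) (ROfNat (var ''m'')))
       (RMul (RRead ''B'' (IAdd rowaddr (IMod (IDiv tt DD) DD))) (RRead ''B'' (IAdd rowaddr (IMod tt DD)))))"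

abbreviation "qaddr i \<equiv> IAdd (IMul jj DD) i"

definition GS_Reduce :: com where
  "GS_Reduce = Acc ''Q'' (IMul DD DD) (qaddr (IDiv tt DD))
     (RSub (ROfNat (INum 0)) (RMul (RRead ''P'' tt) (RRead ''G'' (IAdd (IMul (IMod tt DD) DD) jj))))"

definition GS_Vec :: com where
  "GS_Vec = Seq (RWrite ''Q'' (qaddr jj) (ROfNat (INum 1))) GS_Reduce"

definition GS_Weight :: com where
  "GS_Weight = Acc ''w'' (IMul DD DD) jj
     (RMul (RMul (RRead ''Q'' (qaddr (IDiv tt DD))) (RRead ''G'' tt)) (RRead ''Q'' (qaddr (IMod tt DD))))"

definition GS_Inv :: com where
  "GS_Inv = Acc ''P'' (IMul DD DD) tt
     (RDiv (RMul (RRead ''Q'' (qaddr (IDiv tt DD))) (RRead ''Q'' (qaddr (IMod tt DD)))) (RRead ''w'' jj))"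

text \<open>After the loop \<open>j\<close> equals \<open>d\<close>, the column of \<open>b\<close>.
  Its vector is computed but not added to \<open>P\<close>, which stays a generalised inverse for
  the block of \<open>A\<close>.\<close>

definition Gram_Schmidt :: com where
  "Gram_Schmidt = Seq (For ''j'' (var ''d'') (Seq GS_Vec (Seq GS_Weight GS_Inv))) GS_Vec"

definition Move_Point :: com where
  "Move_Point = Acc ''x'' (var ''d'') tt (RRead ''z'' tt)"

text \<open>The array \<open>b\<close> is overwritten by the residual.\<close>

definition Move_Residual :: com where
  "Move_Residual = Acc ''b'' (var ''nnz'') (IRead ''row'' tt)
     (RSub (ROfNat (INum 0)) (RMul (RRead ''val'' tt) (RRead ''z'' (IRead ''col'' tt))))"

definition Move :: com where
  "Move = Seq Move_Point Move_Residual"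

text \<open>The last Gram--Schmidt vector is \<open>(-x, 1)\<close> for the sketched minimiser
  \<open>x\<close>. Moving there from 0 also turns \<open>b\<close> into the residual.\<close>

definition Start :: com where
  "Start = Seq (Acc ''z'' (var ''d'') tt (RSub (ROfNat (INum 0)) (RRead ''Q'' (qaddr tt))))
     (Seq Move (RWrite ''rho'' (INum 0) (ROfNat (INum 1))))"

definition Gradient :: com where
  "Gradient = Acc ''g'' (var ''nnz'') (IRead ''col'' tt) (RMul (RRead ''val'' tt) (RRead ''b'' (IRead ''row'' tt)))"

definition Precondition :: com where
  "Precondition = Acc ''z'' (IMul (var ''d'') (var ''d'')) (IDiv tt (var ''d''))
     (RMul (RRead ''P'' (IAdd (IMul (IDiv tt (var ''d'')) DD) (IMod tt (var ''d'')))) (RRead ''g'' (IMod tt (var ''d''))))"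

text \<open>Tracking \<open>(2/3) ^ t\<close> lets the stopping test do without logarithms and fixes
  the number of rounds independently of the random choices.\<close>

definition Shrink :: com where
  "Shrink = RWrite ''rho'' (INum 0) (RMul (RRead ''rho'' (INum 0)) (RDiv (ROfNat (INum 2)) (ROfNat (INum 3))))"

definition Improve :: com where
  "Improve = Seq (Fill ''z'' (var ''d'') (ROfNat (INum 0))) (Seq (Fill ''g'' (var ''d'') (ROfNat (INum 0)))
     (Seq Gradient (Seq Precondition (Seq Move Shrink))))"

definition Iterate :: com where
  "Iterate = While (RLess (RRead ''eps'' (INum 0)) (RRead ''rho'' (INum 0))) Improve"

definition Solve :: com where
  "Solve = Seq Sketch (Seq Hadamard (Seq Gram (Seq Gram_Schmidt (Seq Start Iterate))))"

definition Least_Squares :: com where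
  "Least_Squares = Seq Sizes (Seq Draw_Hash (Seq Draw_Samples Solve))"

section \<open>Correctness\<close>

lemma radix_eq: "(c::nat) < D \<Longrightarrow> l < D \<Longrightarrow> x * D + c = a * D + l \<longleftrightarrow> x = a \<and> c = l"
  by (metis add.commute add_left_cancel div_mult_self3 div_less add_0 not_less0)

lemma radix3:
  fixes a N D k l :: nat
  assumes "a < N" "l < D"
  shows "(k * (N * D) + a * D + l) div D mod N = a" "(k * (N * D) + a * D + l) mod D = l"
    "(k * (N * D) + a * D + l) div (N * D) = k"
proof -
  have eq: "k * (N * D) + a * D + l = (k * N + a) * D + l" by (simp add: algebra_simps)
  have 1: "(k * (N * D) + a * D + l) div D = k * N + a" unfolding eq using assms by simp
  show "(k * (N * D) + a * D + l) mod D = l" unfolding eq using assms by simp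
  show "(k * (N * D) + a * D + l) div D mod N = a" unfolding 1 using assms by simp
  have "(k * (N * D) + a * D + l) div (N * D) = (k * (N * D) + a * D + l) div D div N"
    by (simp only: mult.commute[of N] div_mult2_eq)
  then show "(k * (N * D) + a * D + l) div (N * D) = k" unfolding 1 using assms by simp
qed

lemma radix3_decomp: "(i::nat) = i div (N * D) * (N * D) + i div D mod N * D + i mod D"
proof -
  have "i = i div D * D + i mod D" by simp
  also have "i div D = i div (N * D) * N + i div D mod N"
    by (simp only: mult.commute[of N] div_mult2_eq div_mult_mod_eq)
  finally show ?thesis by (simp add: algebra_simps)
qed

lemma sum_div_mod:
  fixes F :: "nat \<Rightarrow> nat \<Rightarrow> real"
  assumes "0 < D"
  shows "(\<Sum>t<M * D. F (t div D) (t mod D)) = (\<Sum>i<M. \<Sum>l<D. F i l)"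
proof -
  have "(\<Sum>t<M * D. F (t div D) (t mod D)) = (\<Sum>(i, l)\<in>{..<M} \<times> {..<D}. F i l)"
  proof (rule sum.reindex_bij_witness[where i = "\<lambda>(i, l). i * D + l" and j = "\<lambda>t. (t div D, t mod D)"])
    fix p assume p: "p \<in> {..<M} \<times> {..<D}"
    obtain i l where il: "p = (i, l)" "i < M" "l < D" using p by auto
    have "Suc i * D \<le> M * D" using il by (intro mult_right_mono) auto
    then show "(case p of (i, l) \<Rightarrow> i * D + l) \<in> {..<M * D}" using il by auto
  qed (use assms in \<open>auto simp: less_mult_imp_div_less\<close>)
  then show ?thesis by (simp add: sum.cartesian_product)
qed

lemma sum_div_mod2:
  fixes F :: "nat \<Rightarrow> nat \<Rightarrow> nat \<Rightarrow> real"
  assumes D: "0 < D"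
  shows "(\<Sum>t<M * (D * D). F (t div (D * D)) (t div D mod D) (t mod D)) = (\<Sum>q<M. \<Sum>i<D. \<Sum>l<D. F q i l)"
proof -
  have "(\<Sum>t<M * (D * D). F (t div (D * D)) (t div D mod D) (t mod D))
     = (\<Sum>t<M * (D * D). F (t div (D * D)) (t mod (D * D) div D) (t mod (D * D) mod D))"
    using D by (intro sum.cong refl) (simp add: mod_mult2_eq)
  also have "\<dots> = (\<Sum>q<M. \<Sum>t<D * D. F q (t div D) (t mod D))"
    using D by (intro sum_div_mod[where F = "\<lambda>q t. F q (t div D) (t mod D)"]) simp
  also have "\<dots> = (\<Sum>q<M. \<Sum>i<D. \<Sum>l<D. F q i l)"
    using D by (intro sum.cong refl sum_div_mod)
  finally show ?thesis .
qed

locale lsq =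
  fixes n d :: nat and A :: "real mat" and b :: "real vec" and \<epsilon> :: real and ps :: "(nat \<times> nat) list"
    and K W :: nat
  assumes n: "1 \<le> n" and d: "1 \<le> d" and A: "A \<in> carrier_mat n d" and b: "b \<in> carrier_vec n"
    and eps: "0 < \<epsilon>" "\<epsilon> < 1" and ps: "lists_nonzeros ps A"
begin

definition "D = Suc d"
definition "N = (2::nat) ^ K"
definition "m = 2048 * K\<^sup>2 * D"
definition "nz = length ps"
definition "ro t = fst (ps ! t)"
definition "co t = snd (ps ! t)"
definition "R = fst ` set ps"
definition aug :: mtx where "aug r l = (if l < d then A $$ (r, l) else b $ r)"

lemma D_pos [simp]: "0 < D" by (simp add: D_def)

lemma d_lt_D [simp]: "d < D" by (simp add: D_def)

lemma less_D_iff: "l < D \<longleftrightarrow> l < d \<or> l = d" by (auto simp: D_def)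

text \<open>Keeps the simplifier from multiplying out \<open>Suc d\<close>.\<close>
lemma Suc_d [simp]: "Suc d = D" by (simp add: D_def)

lemma ps_set: "distinct ps" "set ps = {(i, j). i < n \<and> j < d \<and> A $$ (i, j) \<noteq> 0}"
  using ps A unfolding lists_nonzeros_def by auto

lemma co_lt: "t < nz \<Longrightarrow> co t < d"
  unfolding nz_def co_def using ps_set(2) nth_mem[of t ps] by force

lemma ro_R: "t < nz \<Longrightarrow> ro t \<in> R"
  unfolding nz_def ro_def R_def by simp

lemma R_eq: "R = ro ` {..<nz}"
  unfolding R_def ro_def nz_def by (auto simp: set_conv_nth image_iff)

lemma R_lt: "r \<in> R \<Longrightarrow> r < n" unfolding R_def using ps_set by auto

lemma finite_R: "finite R" unfolding R_def by simp

text \<open>Each nonzero position is listed exactly once, so a pass over the list in any order is a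
  sum over rows and columns.\<close>

lemma sparse_sum:
  fixes F :: "nat \<Rightarrow> nat \<Rightarrow> real"
  shows "(\<Sum>t<nz. F (ro t) (co t)) = (\<Sum>r\<in>R. \<Sum>c<d. if A $$ (r, c) \<noteq> 0 then F r c else 0)"
proof -
  have "(\<Sum>t<nz. F (ro t) (co t)) = (\<Sum>p\<in>set ps. F (fst p) (snd p))"
    unfolding nz_def ro_def co_def
    using sum.reindex_bij_betw[OF bij_betw_nth[OF ps_set(1) refl refl], of "\<lambda>p. F (fst p) (snd p)"]
    by simp
  also have "\<dots> = (\<Sum>p\<in>R \<times> {..<d}. if A $$ p \<noteq> 0 then F (fst p) (snd p) else 0)"
  proof (rule sum.mono_neutral_cong_left)
    show "set ps \<subseteq> R \<times> {..<d}" using ps_set unfolding R_def by force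
    show "\<forall>i\<in>R \<times> {..<d} - set ps. (if A $$ i \<noteq> 0 then F (fst i) (snd i) else 0) = 0"
      using ps_set(2) R_lt by auto
  qed (use finite_R ps_set in auto)
  finally show ?thesis by (simp add: sum.cartesian_product case_prod_unfold)
qed

definition params :: "memory \<Rightarrow> bool" where
  "params m' \<longleftrightarrow> words m' ''d'' 0 = d \<and> words m' ''nnz'' 0 = nz \<and>
     (\<forall>t<nz. words m' ''row'' t = ro t) \<and> (\<forall>t<nz. words m' ''col'' t = co t) \<and>
     words m' ''K'' 0 = K \<and> words m' ''N'' 0 = N \<and> words m' ''m'' 0 = m \<and> (\<forall>i\<le>K. words m' ''p'' i = 2 ^ i) \<and>
     (\<forall>t<nz. reals m' ''val'' t = A $$ (ro t, co t)) \<and> reals m' ''eps'' 0 = \<epsilon>"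

end

text \<open>The outcomes \<open>f\<close> and \<open>s\<close> of the draws are fixed here, which
  makes the rest of the program deterministic. The bounds on \<open>W\<close> let the loop counters
  fit into machine words.\<close>

locale lsq_run = lsq +
  fixes f s :: "nat \<Rightarrow> nat"
  assumes f: "\<And>r. r \<in> R \<Longrightarrow> f r < 2 * N" and s: "\<And>q. q < m \<Longrightarrow> s q < N"
    and K: "0 < K"
    and W1: "K * (N * D) \<le> W" and W2: "m * (D * D) \<le> W" and W3: "nz \<le> W"
begin

definition ready :: "memory \<Rightarrow> bool" where
  "ready m' \<longleftrightarrow> params m' \<and> words m' ''h'' = f \<and> words m' ''s'' = s"

text \<open>What can be relied on in the middle of a loop that writes \<open>x\<close>;
  \<open>after\<close> is the corresponding statement once the loop has ended.\<close>

definition view :: "name \<Rightarrow> memory \<Rightarrow> nat \<Rightarrow> memory \<Rightarrow> bool" where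
  "view x m0 i m' \<longleftrightarrow> ready m' \<and> words m' ''t'' 0 = i \<and> words m' ''j'' 0 = words m0 ''j'' 0 \<and>
     (\<forall>y. y \<noteq> x \<longrightarrow> reals m' y = reals m0 y)"

definition after :: "name \<Rightarrow> memory \<Rightarrow> (nat \<Rightarrow> real) \<Rightarrow> memory \<Rightarrow> bool" where
  "after x m0 X m' \<longleftrightarrow> ready m' \<and> words m' ''j'' 0 = words m0 ''j'' 0 \<and> reals m' = (reals m0)(x := X)"

lemmas ready_simps = ready_def params_def view_def after_def

lemma m_pos: "0 < m" unfolding m_def using K by simp

lemma W_D: "D * D \<le> W" using W2 m_pos by (metis Suc_leI le_trans mult_1 mult_le_mono1 One_nat_def)

lemma W_d: "d \<le> W" "d * d \<le> W"
proof -
  have "d * d \<le> D * D" by (intro mult_le_mono) (simp_all add: less_imp_le)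
  moreover have "d \<le> d * d" using mult_le_mono2[OF d, of d] by simp
  ultimately show "d \<le> W" "d * d \<le> W" using W_D by linarith+
qed

lemma view_upd:
  assumes "ready m0" "x \<notin> {''val'', ''eps''}"
  shows "view x m0 i (upd ''t'' x m0 i X)"
  using assms unfolding ready_simps by auto

lemma triple_Acc:
  assumes "ready m0" "x \<notin> {''val'', ''eps''}" "k \<le> W"
    and "\<And>i m'. view x m0 i m' \<Longrightarrow> ival e m' = k"
    and "\<And>i m'. i < k \<Longrightarrow> view x m0 i m' \<Longrightarrow> ival a m' = \<alpha> i"
    and "\<And>i m'. i < k \<Longrightarrow> view x m0 i m' \<Longrightarrow> rval g m' = \<phi> i"
  shows "triple W m0 (Acc x e a g) (4 * k + 3)
    (after x m0 (\<lambda>j. reals m0 x j + (\<Sum>i<k. if \<alpha> i = j then \<phi> i else 0)))"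
  unfolding Acc_def
  by (rule triple_weaken[OF triple_accumulate[where n = k and \<alpha> = \<alpha> and \<phi> = \<phi>]])
     (use assms view_upd[OF assms(1,2)] in \<open>auto simp: ready_simps\<close>)

lemma triple_Fill:
  assumes "ready m0" "x \<notin> {''val'', ''eps''}" "k \<le> W"
    and "\<And>i m'. view x m0 i m' \<Longrightarrow> ival e m' = k"
    and "\<And>i m'. i < k \<Longrightarrow> view x m0 i m' \<Longrightarrow> rval g m' = \<phi> i"
  shows "triple W m0 (Fill x e g) (4 * k + 3)
    (after x m0 (\<lambda>j. if j < k then \<phi> j else reals m0 x j))"
  unfolding Fill_def
  by (rule triple_weaken[OF triple_fill[where n = k and \<phi> = \<phi>]])
     (use assms view_upd[OF assms(1,2)] in \<open>auto simp: ready_simps\<close>)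

subsection \<open>Sketching\<close>

definition only :: "name set \<Rightarrow> memory \<Rightarrow> memory \<Rightarrow> bool" where
  "only X m0 m' \<longleftrightarrow> ready m' \<and> (\<forall>y. y \<notin> X \<longrightarrow> reals m' y = reals m0 y)"

definition "cnt r = (\<Sum>t<nz. if ro t = r then 1 else 0 :: real)"

lemma cnt_eq: "r \<in> R \<Longrightarrow> cnt r = (\<Sum>c<d. if A $$ (r, c) \<noteq> 0 then 1 else 0)"
proof -
  assume r: "r \<in> R"
  have "cnt r = (\<Sum>q\<in>R. \<Sum>c<d. if A $$ (q, c) \<noteq> 0 then (if q = r then 1 else 0) else 0)"
    unfolding cnt_def by (rule sparse_sum[where F = "\<lambda>q c. if q = r then 1 else 0"])
  also have "\<dots> = (\<Sum>q\<in>R. if q = r then \<Sum>c<d. if A $$ (r, c) \<noteq> 0 then 1 else 0 else 0)"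
    by (intro sum.cong refl) (auto intro: sum.neutral)
  finally show ?thesis using r finite_R by simp
qed

lemma cnt_pos: "r \<in> R \<Longrightarrow> cnt r > 0"
proof -
  assume "r \<in> R"
  then obtain t where "t < nz" "ro t = r" unfolding R_eq by auto
  then show ?thesis unfolding cnt_def by (intro sum_pos2[of _ t]) auto
qed

text \<open>The share \<open>b r / cnt r\<close> is added \<open>cnt r\<close> times, once for each
  nonzero of row \<open>r\<close>, and \<open>cnt r\<close> is positive because \<open>R\<close>
  consists of the nonzero rows.\<close>

lemma sketch_value:
  assumes l: "l < D"
  shows "(\<Sum>t<nz. if f (ro t) div 2 * D + co t = a * D + l then hash_sign (f (ro t)) * A $$ (ro t, co t) else 0)
     + (\<Sum>t<nz. if f (ro t) div 2 * D + d = a * D + l then hash_sign (f (ro t)) * (b $ ro t / cnt (ro t)) else 0)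
     = count_sketch R f aug a l" (is "?S1 + ?S2 = _")
proof -
  let ?h = "\<lambda>r. hash_sign (f r)" and ?e = "\<lambda>r. f r div 2 = a"
  have "?S1 = (\<Sum>t<nz. if ?e (ro t) \<and> co t = l then ?h (ro t) * A $$ (ro t, co t) else 0)"
    using l co_lt by (intro sum.cong refl if_cong radix_eq) (auto simp: less_D_iff)
  also have "\<dots> = (\<Sum>r\<in>R. \<Sum>c<d. if A $$ (r, c) \<noteq> 0 then (if ?e r \<and> c = l then ?h r * A $$ (r, c) else 0) else 0)"
    by (rule sparse_sum)
  also have "\<dots> = (\<Sum>r\<in>R. \<Sum>c<d. if c = l then (if ?e r then ?h r * A $$ (r, l) else 0) else 0)"
    by (intro sum.cong refl) auto
  also have "\<dots> = (\<Sum>r\<in>R. if l < d \<and> ?e r then ?h r * A $$ (r, l) else 0)"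
    by (intro sum.cong refl) auto
  finally have 1: "?S1 = (\<Sum>r\<in>R. if l < d \<and> ?e r then ?h r * A $$ (r, l) else 0)" .
  have "?S2 = (\<Sum>t<nz. if ?e (ro t) \<and> d = l then ?h (ro t) * (b $ ro t / cnt (ro t)) else 0)"
    using l by (intro sum.cong refl if_cong radix_eq) auto
  also have "\<dots> = (\<Sum>r\<in>R. \<Sum>c<d. if A $$ (r, c) \<noteq> 0 then (if ?e r \<and> d = l then ?h r * (b $ r / cnt r) else 0) else 0)"
    by (rule sparse_sum)
  also have "\<dots> = (\<Sum>r\<in>R. (if ?e r \<and> d = l then ?h r * (b $ r / cnt r) else 0) * cnt r)"
    by (intro sum.cong refl) (auto simp: cnt_eq sum_distrib_left intro!: sum.cong)
  also have "\<dots> = (\<Sum>r\<in>R. if d = l \<and> ?e r then ?h r * b $ r else 0)"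
    using cnt_pos by (intro sum.cong refl) force
  finally have 2: "?S2 = (\<Sum>r\<in>R. if d = l \<and> ?e r then ?h r * b $ r else 0)" .
  show ?thesis
    unfolding 1 2 count_sketch_def sum.distrib[symmetric] using l
    by (intro sum.cong refl) (auto simp: aug_def less_D_iff)
qed

lemma triple_Sketch:
  assumes m0: "ready m0" "reals m0 ''c'' = (\<lambda>_. 0)" "reals m0 ''B'' = (\<lambda>_. 0)" "\<And>r. r \<in> R \<Longrightarrow> reals m0 ''b'' r = b $ r"
  shows "triple W m0 Sketch (12 * nz + 11)
    (\<lambda>m'. only {''c'', ''B''} m0 m' \<and> (\<forall>a l. l < D \<longrightarrow> reals m' ''B'' (a * D + l) = count_sketch R f aug a l))"
    (is "triple W m0 _ _ ?Q")
  unfolding Sketch_def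
proof (rule triple_Seq)
  show "triple W m0 Count (4 * nz + 3)
    (after ''c'' m0 (\<lambda>j. reals m0 ''c'' j + (\<Sum>i<nz. if ro i = j then 1 else 0)))"
    unfolding Count_def by (rule triple_Acc) (use m0 W3 in \<open>auto simp: ready_simps\<close>)
next
  fix m1 assume m1: "after ''c'' m0 (\<lambda>j. reals m0 ''c'' j + (\<Sum>i<nz. if ro i = j then 1 else 0)) m1"
  then have r1: "ready m1" "reals m1 ''c'' = cnt" "reals m1 ''B'' = (\<lambda>_. 0)"
    "\<And>r. r \<in> R \<Longrightarrow> reals m1 ''b'' r = b $ r" "\<And>y. y \<noteq> ''c'' \<Longrightarrow> reals m1 y = reals m0 y"
    using m0 by (auto simp: after_def cnt_def fun_eq_iff)
  let ?X2 = "\<lambda>j. reals m1 ''B'' j + (\<Sum>t<nz. if f (ro t) div 2 * D + co t = j then hash_sign (f (ro t)) * A $$ (ro t, co t) else 0)"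
  show "triple W m1 (Seq Sketch_Matrix Sketch_Vector) (8 * nz + 7)
     ?Q"
  proof (rule triple_Seq)
    show "triple W m1 Sketch_Matrix
      (4 * nz + 3) (after ''B'' m1 ?X2)"
      unfolding Sketch_Matrix_def by (rule triple_Acc) (use r1 W3 in \<open>auto simp: ready_simps hash_sign_def\<close>)
  next
    fix m2 assume m2: "after ''B'' m1 ?X2 m2"
    then have r2: "ready m2" "reals m2 ''c'' = cnt" "reals m2 ''B'' = ?X2"
      "\<And>r. r \<in> R \<Longrightarrow> reals m2 ''b'' r = b $ r" "\<And>y. y \<noteq> ''c'' \<Longrightarrow> y \<noteq> ''B'' \<Longrightarrow> reals m2 y = reals m0 y"
      using r1 by (auto simp: after_def)
    let ?X3 = "\<lambda>j. reals m2 ''B'' j + (\<Sum>t<nz. if f (ro t) div 2 * D + d = j then hash_sign (f (ro t)) * (b $ ro t / cnt (ro t)) else 0)"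
    have "triple W m2 Sketch_Vector (4 * nz + 3) (after ''B'' m2 ?X3)"
      unfolding Sketch_Vector_def by (rule triple_Acc) (use r2 W3 ro_R in \<open>auto simp: ready_simps hash_sign_def\<close>)
    then show "triple W m2 Sketch_Vector (4 * nz + 3)
       ?Q"
    proof (rule triple_weaken)
      fix m3 assume m3: "after ''B'' m2 ?X3 m3"
      have "reals m3 ''B'' (a * D + l) = count_sketch R f aug a l" if "l < D" for a l
        using m3 r2(3) r1(3) sketch_value[OF that, of a] by (simp add: after_def)
      then show "only {''c'', ''B''} m0 m3 \<and> (\<forall>a l. l < D \<longrightarrow> reals m3 ''B'' (a * D + l) = count_sketch R f aug a l)"
        using m3 r2 by (auto simp: after_def only_def)
    qed simp
  qed simp
qed simp

lemma triple_Hadamard: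
  assumes m0: "ready m0" and B: "\<And>a l. l < D \<Longrightarrow> reals m0 ''B'' (a * D + l) = count_sketch R f aug a l"
  shows "triple W m0 Hadamard (4 * (K * (N * D)) + 3)
    (\<lambda>m'. only {''B''} m0 m' \<and> (\<forall>a l. a < N \<longrightarrow> l < D \<longrightarrow> reals m' ''B'' (K * (N * D) + a * D + l) = sketch_rows K R aug f a l))"
proof -
  \<comment> \<open>\<open>V i\<close> is the final content of cell \<open>i\<close>, for all layers
    at once. When the counter is \<open>i\<close>, the cells below \<open>i + N * D\<close> hold it
    already, and cell \<open>i + N * D\<close> is written next.\<close>
  define V where "V i = hadamard (i div (N * D)) (\<lambda>b. count_sketch R f aug b (i mod D)) (i div D mod N)" for i
  have N0: "0 < N" by (simp add: N_def)
  have V: "V (k * (N * D) + a * D + l) = hadamard k (\<lambda>b. count_sketch R f aug b l) a" if "a < N" "l < D" for k a l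
    using radix3[OF that, of k] by (simp add: V_def)
  let ?J = "\<lambda>i m'. view ''B'' m0 (words m' ''t'' 0) m' \<and> (\<forall>q < i + N * D. reals m' ''B'' q = V q)"
  have "triple W m0 Hadamard (K * (N * D) * (1 + 3) + 3) (\<lambda>m'. ?J (K * (N * D)) m' \<and> words m' ''t'' 0 = K * (N * D))"
    unfolding Hadamard_def
  proof (rule triple_For[OF W1])
    fix i m' assume i: "i \<le> K * (N * D)" "?J i m'"
    then show "ival (IMul (var ''K'') ND) m' = K * (N * D)" by (simp add: ready_simps)
  next
    show "?J 0 (write_word ''t'' 0 0 m0)"
    proof -
      have "reals m0 ''B'' q = V q" if q: "q < N * D" for q
      proof -
        have lt: "q div D < N" using q by (simp add: less_mult_imp_div_less)
        have "reals m0 ''B'' (q div D * D + q mod D) = count_sketch R f aug (q div D) (q mod D)" by (rule B) simp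
        then show ?thesis using V[of "q div D" "q mod D" 0] lt by simp
      qed
      then show ?thesis using m0 by (auto simp: ready_simps)
    qed
  next
    fix i m' assume i: "i < K * (N * D)" and J: "?J i m'" and t: "words m' ''t'' 0 = i"
    define k where "k = i div (N * D)"
    define a where "a = i div D mod N"
    define l where "l = i mod D"
    have k: "k < K" using i N0 unfolding k_def by (simp add: less_mult_imp_div_less)
    have a: "a < N" and l: "l < D" using N0 by (auto simp: a_def l_def)
    have i_eq: "i = k * (N * D) + a * D + l"
      unfolding k_def a_def l_def by (rule radix3_decomp)
    have p: "words m' ''p'' k = 2 ^ k" and nm: "words m' ''N'' 0 = N" "words m' ''d'' 0 = d"
      using J k by (auto simp: ready_simps)
    have hb: "hlow k a < N" "hlow k a + 2 ^ k < N"
      using hadamard_index_lt[of a K k] a k by (auto simp: N_def)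
    have low: "i - hbit k a * (2 ^ k * D) = k * (N * D) + hlow k a * D + l"
    proof -
      have "hbit k a * 2 ^ k \<le> a" by (rule hlow_decomp[of a k]) linarith
      then have "a = hlow k a + hbit k a * 2 ^ k" by (simp add: hlow_def)
      then have "a * D = hlow k a * D + hbit k a * (2 ^ k * D)" by (metis distrib_right mult.assoc)
      then show ?thesis unfolding i_eq by linarith
    qed
    have addr: "ival lowaddr m' = k * (N * D) + hlow k a * D + l" "ival lbit m' = hbit k a" "ival lsize m' = 2 ^ k"
      using t p nm low by (simp_all add: k_def[symmetric] a_def[symmetric] hbit_def)
    \<comment> \<open>Both inputs lie in the block of layer \<open>k\<close>, which ends at or
      before \<open>i + N * D\<close>.\<close>
    have lt: "k * (N * D) + hlow k a * D + l < i + N * D" "k * (N * D) + (hlow k a + 2 ^ k) * D + l < i + N * D"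
    proof -
      have *: "k * (N * D) + c * D + l < i + N * D" if "c < N" for c
      proof -
        have "Suc c * D \<le> N * D" using that by (intro mult_right_mono) auto
        then show ?thesis using l unfolding i_eq by simp
      qed
      show "k * (N * D) + hlow k a * D + l < i + N * D" by (rule *[OF hb(1)])
      show "k * (N * D) + (hlow k a + 2 ^ k) * D + l < i + N * D" by (rule *[OF hb(2)])
    qed
    have val: "reals m' ''B'' (k * (N * D) + hlow k a * D + l) + (1 - 2 * real (hbit k a)) * reals m' ''B'' (k * (N * D) + (hlow k a + 2 ^ k) * D + l)
        = V (i + N * D)"
    proof -
      have e: "i + N * D = Suc k * (N * D) + a * D + l" unfolding i_eq by simp
      have "V (i + N * D) = hadamard (Suc k) (\<lambda>b. count_sketch R f aug b l) a"
        unfolding e by (rule V[OF a l])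
      then show ?thesis using J lt V[OF hb(1) l, of k] V[OF hb(2) l, of k] by simp
    qed
    show "triple W m' (RWrite ''B'' (IAdd tt ND) butterfly) 1
       (\<lambda>m'. ?J (Suc i) (write_word ''t'' 0 (Suc i) m') \<and> words m' ''t'' 0 = i)"
    proof (rule triple_RWrite)
      have e1: "ival (IAdd lowaddr (IMul lsize DD)) m' = k * (N * D) + (hlow k a + 2 ^ k) * D + l"
        unfolding ival.simps(3)[of lowaddr] addr(1) using addr(3) nm by (simp add: algebra_simps)
      have e2: "ival (IAdd tt ND) m' = i + N * D" using t nm by simp
      have e3: "rval butterfly m' = V (i + N * D)"
        unfolding rval.simps e1 addr val[symmetric] by simp
      show "?J (Suc i) (write_word ''t'' 0 (Suc i) (write_real ''B'' (ival (IAdd tt ND) m') (rval butterfly m') m')) \<and>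
          words (write_real ''B'' (ival (IAdd tt ND) m') (rval butterfly m') m') ''t'' 0 = i"
        unfolding e2 e3 using J t by (auto simp: ready_simps less_Suc_eq)
    qed simp
  qed
  then show ?thesis
  proof (rule triple_weaken)
    fix m' assume m': "?J (K * (N * D)) m' \<and> words m' ''t'' 0 = K * (N * D)"
    have "reals m' ''B'' (K * (N * D) + a * D + l) = sketch_rows K R aug f a l" if al: "a < N" "l < D" for a l
    proof -
      have "Suc a * D \<le> N * D" using al by (intro mult_right_mono) auto
      then have "K * (N * D) + a * D + l < K * (N * D) + N * D" using al by simp
      then show ?thesis using m' V[OF al, of K] by (simp add: sketch_rows_def)
    qed
    then show "only {''B''} m0 m' \<and> (\<forall>a l. a < N \<longrightarrow> l < D \<longrightarrow> reals m' ''B'' (K * (N * D) + a * D + l) = sketch_rows K R aug f a l)"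
      using m' by (auto simp: only_def view_def)
  qed simp
qed

end

context lsq_run
begin

subsection \<open>The preconditioner\<close>

definition Gm :: mtx where
  "Gm i l = 2 / real m * (\<Sum>q<m. sketch_rows K R aug f (s q) i * sketch_rows K R aug f (s q) l)"

lemma triple_Gram:
  assumes m0: "ready m0" "reals m0 ''G'' = (\<lambda>_. 0)"
    and B: "\<And>a l. a < N \<Longrightarrow> l < D \<Longrightarrow> reals m0 ''B'' (K * (N * D) + a * D + l) = sketch_rows K R aug f a l"
  shows "triple W m0 Gram (4 * (m * (D * D)) + 3)
    (\<lambda>m'. only {''G''} m0 m' \<and> (\<forall>i l. i < D \<longrightarrow> l < D \<longrightarrow> reals m' ''G'' (i * D + l) = Gm i l))" (is "triple W m0 _ _ ?Q")
proof -
  let ?Y = "sketch_rows K R aug f"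
  let ?\<phi> = "\<lambda>q i l. 2 / real m * (?Y (s q) i * ?Y (s q) l)"
  have "triple W m0 Gram (4 * (m * (D * D)) + 3)
    (after ''G'' m0 (\<lambda>j. reals m0 ''G'' j + (\<Sum>t<m * (D * D). if t div D mod D * D + t mod D = j
        then ?\<phi> (t div (D * D)) (t div D mod D) (t mod D) else 0)))"
    unfolding Gram_def
  proof (rule triple_Acc[OF m0(1) _ W2])
    fix i m' assume i: "i < m * (D * D)" and v: "view ''G'' m0 i m'"
    have q: "i div (D * D) < m" using i by (simp add: less_mult_imp_div_less)
    have w: "words m' ''d'' 0 = d" "words m' ''K'' 0 = K" "words m' ''N'' 0 = N" "words m' ''m'' 0 = m"
      "words m' ''s'' = s" "words m' ''t'' 0 = i" "reals m' ''B'' = reals m0 ''B''"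
      using v by (auto simp: ready_simps)
    show "ival (IAdd (IMul (IMod (IDiv tt DD) DD) DD) (IMod tt DD)) m' = i div D mod D * D + i mod D"
      using w by simp
    show "rval (RMul (RDiv (ROfNat (INum 2)) (ROfNat (var ''m'')))
       (RMul (RRead ''B'' (IAdd rowaddr (IMod (IDiv tt DD) DD))) (RRead ''B'' (IAdd rowaddr (IMod tt DD))))) m'
       = ?\<phi> (i div (D * D)) (i div D mod D) (i mod D)"
      using w B[OF s[OF q]] by simp
  qed (auto simp: ready_simps)
  then show ?thesis
  proof (rule triple_weaken)
    fix m' assume m': "after ''G'' m0 (\<lambda>j. reals m0 ''G'' j + (\<Sum>t<m * (D * D). if t div D mod D * D + t mod D = j
        then ?\<phi> (t div (D * D)) (t div D mod D) (t mod D) else 0)) m'"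
    have "reals m' ''G'' (i * D + l) = Gm i l" if il: "i < D" "l < D" for i l
    proof -
      have "reals m' ''G'' (i * D + l) = (\<Sum>t<m * (D * D). if t div D mod D * D + t mod D = i * D + l
        then ?\<phi> (t div (D * D)) (t div D mod D) (t mod D) else 0)"
        using m' m0(2) by (simp add: after_def)
      also have "\<dots> = (\<Sum>t<m * (D * D). if t div D mod D = i \<and> t mod D = l
        then ?\<phi> (t div (D * D)) (t div D mod D) (t mod D) else 0)"
        using il by (intro sum.cong refl if_cong radix_eq) auto
      also have "\<dots> = (\<Sum>q<m. \<Sum>i'<D. \<Sum>l'<D. if i' = i \<and> l' = l then ?\<phi> q i' l' else 0)"
        by (rule sum_div_mod2[where F = "\<lambda>q i' l'. if i' = i \<and> l' = l then ?\<phi> q i' l' else 0"]) simp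
      also have "\<dots> = (\<Sum>q<m. \<Sum>i'<D. if i' = i then (\<Sum>l'<D. if l' = l then ?\<phi> q i l else 0) else 0)"
        by (intro sum.cong refl) (auto intro!: sum.cong)
      also have "\<dots> = Gm i l" using il by (simp add: Gm_def sum_distrib_left)
      finally show ?thesis .
    qed
    then show "only {''G''} m0 m' \<and> (\<forall>i l. i < D \<longrightarrow> l < D \<longrightarrow> reals m' ''G'' (i * D + l) = Gm i l)"
      using m' by (auto simp: only_def after_def)
  qed simp
qed

definition holds_G :: "memory \<Rightarrow> bool" where
  "holds_G m' \<longleftrightarrow> (\<forall>i l. i < D \<longrightarrow> l < D \<longrightarrow> reals m' ''G'' (i * D + l) = Gm i l)"

definition holds_P :: "nat \<Rightarrow> memory \<Rightarrow> bool" where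
  "holds_P j m' \<longleftrightarrow> (\<forall>i c. i < D \<longrightarrow> c < D \<longrightarrow> reals m' ''P'' (i * D + c) = gs_inv D Gm j i c)"

definition holds_Q :: "nat \<Rightarrow> memory \<Rightarrow> bool" where
  "holds_Q j m' \<longleftrightarrow> (\<forall>i<D. reals m' ''Q'' (j * D + i) = gs D Gm j i)"

text \<open>The vector and the weight of stage \<open>j\<close> are built by accumulation, which
  starts correctly only if their cells are still zero.\<close>

definition fresh :: "nat \<Rightarrow> memory \<Rightarrow> bool" where
  "fresh j m' \<longleftrightarrow> (\<forall>a\<ge>j * D. reals m' ''Q'' a = 0) \<and> (\<forall>i\<ge>j. reals m' ''w'' i = 0)"

lemma square_index:
  assumes "t < D * D"
  shows "t div D < D" "t mod D < D" "t div D * D + t mod D = t"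
  using assms by (auto simp: less_mult_imp_div_less)

lemma sum_square:
  fixes F :: "nat \<Rightarrow> nat \<Rightarrow> real"
  shows "(\<Sum>t<D * D. F (t div D) (t mod D)) = (\<Sum>i<D. \<Sum>c<D. F i c)"
  by (rule sum_div_mod) simp

lemma triple_GS_Vec:
  assumes m1: "ready m1" "words m1 ''j'' 0 = j" "holds_G m1" "holds_P j m1" "fresh j m1" and j: "j \<le> d"
  shows "triple W m1 GS_Vec (4 * (D * D) + 5)
    (\<lambda>m'. only {''Q''} m1 m' \<and> words m' ''j'' 0 = j \<and> holds_Q j m' \<and> (\<forall>a\<ge>Suc j * D. reals m' ''Q'' a = 0))" (is "triple W m1 _ _ ?Q")
  unfolding GS_Vec_def
proof (rule triple_Seq)
  have jD: "j < D" using j by (simp add: less_D_iff) linarith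
  let ?m2 = "write_real ''Q'' (j * D + j) 1 m1"
  show "triple W m1 (RWrite ''Q'' (qaddr jj) (ROfNat (INum 1))) 1 (\<lambda>m'. m' = ?m2)"
    by (rule triple_RWrite) (use m1 in \<open>auto simp: ready_simps\<close>)
  fix m2 assume m2: "m2 = ?m2"
  let ?\<phi> = "\<lambda>i c. - (gs_inv D Gm j i c * Gm c j)"
  let ?X = "\<lambda>a. reals m2 ''Q'' a + (\<Sum>t<D * D. if j * D + t div D = a then ?\<phi> (t div D) (t mod D) else 0)"
  have "triple W m2 GS_Reduce (4 * (D * D) + 3) (after ''Q'' m2 ?X)"
    unfolding GS_Reduce_def
  proof (rule triple_Acc[OF _ _ W_D])
    show "ready m2" using m1(1) m2 by (auto simp: ready_simps)
    fix t m' assume t: "t < D * D" and v: "view ''Q'' m2 t m'"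
    have w: "words m' ''d'' 0 = d" "words m' ''t'' 0 = t" "words m' ''j'' 0 = j"
      "reals m' ''P'' = reals m1 ''P''" "reals m' ''G'' = reals m1 ''G''"
      using v m1 m2 by (auto simp: ready_simps)
    have P: "reals m1 ''P'' t = gs_inv D Gm j (t div D) (t mod D)"
      using m1(4) square_index[OF t] unfolding holds_P_def by metis
    show "ival (qaddr (IDiv tt DD)) m' = j * D + t div D" using w by simp
    show "rval (RSub (ROfNat (INum 0)) (RMul (RRead ''P'' tt) (RRead ''G'' (IAdd (IMul (IMod tt DD) DD) jj)))) m'
       = ?\<phi> (t div D) (t mod D)"
      using w P m1(3) jD by (simp add: holds_G_def)
  qed (auto simp: ready_simps)
  then show "triple W m2 GS_Reduce (4 * (D * D) + 3)
    ?Q"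
  proof (rule triple_weaken)
    fix m' assume m': "after ''Q'' m2 ?X m'"
    have "reals m' ''Q'' (j * D + i) = gs D Gm j i" if i: "i < D" for i
    proof -
      have "(\<Sum>t<D * D. if j * D + t div D = j * D + i then ?\<phi> (t div D) (t mod D) else 0)
         = (\<Sum>i'<D. \<Sum>c<D. if j * D + i' = j * D + i then ?\<phi> i' c else 0)"
        by (rule sum_square)
      also have "\<dots> = (\<Sum>i'<D. if i' = i then (\<Sum>c<D. ?\<phi> i c) else 0)"
        by (intro sum.cong refl) auto
      also have "\<dots> = - (\<Sum>c<D. gs_inv D Gm j i c * Gm c j)" using i by (simp add: sum_negf)
      finally show ?thesis
        using m' m1(5) m2 by (simp add: after_def gs_def gs_vec_def unit_fun_def fresh_def)
    qed
    moreover have "reals m' ''Q'' a = 0" if a: "a \<ge> Suc j * D" for a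
    proof -
      have 0: "reals m2 ''Q'' a = 0" using a jD m1(5) by (auto simp: m2 fresh_def)
      have "j * D + t div D \<noteq> a" if "t < D * D" for t
        using square_index(1)[OF that] a by auto
      then have "(\<Sum>t<D * D. if j * D + t div D = a then ?\<phi> (t div D) (t mod D) else 0) = 0"
        by (intro sum.neutral) auto
      then show ?thesis using m' 0 by (simp add: after_def)
    qed
    ultimately show "only {''Q''} m1 m' \<and> words m' ''j'' 0 = j \<and> holds_Q j m' \<and> (\<forall>a\<ge>Suc j * D. reals m' ''Q'' a = 0)"
      using m' m1 m2 by (auto simp: after_def only_def holds_Q_def)
  qed simp
qed simp

lemma triple_GS_step:
  assumes m1: "ready m1" "words m1 ''j'' 0 = j" "holds_G m1" "holds_P j m1" "fresh j m1" and j: "j < d"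
  shows "triple W m1 (Seq GS_Vec (Seq GS_Weight GS_Inv)) (12 * (D * D) + 13)
    (\<lambda>m'. only {''Q'', ''w'', ''P''} m1 m' \<and> words m' ''j'' 0 = j \<and> holds_P (Suc j) m' \<and> fresh (Suc j) m')" (is "triple W m1 _ _ ?Q")
proof (rule triple_Seq[OF triple_GS_Vec[OF m1]])
  show "j \<le> d" using j by simp
  let ?q = "gs D Gm j" and ?w = "bil D Gm (gs D Gm j) (gs D Gm j)"
  fix m2 assume m2: "only {''Q''} m1 m2 \<and> words m2 ''j'' 0 = j \<and> holds_Q j m2 \<and> (\<forall>a\<ge>Suc j * D. reals m2 ''Q'' a = 0)"
  let ?\<phi> = "\<lambda>i c. ?q i * Gm i c * ?q c"
  let ?X = "\<lambda>a. reals m2 ''w'' a + (\<Sum>t<D * D. if j = a then ?\<phi> (t div D) (t mod D) else 0)"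
  show "triple W m2 (Seq GS_Weight GS_Inv) (8 * (D * D) + 7)
     ?Q"
  proof (rule triple_Seq)
    show "triple W m2 GS_Weight (4 * (D * D) + 3) (after ''w'' m2 ?X)"
      unfolding GS_Weight_def
    proof (rule triple_Acc[OF _ _ W_D])
      show "ready m2" using m2 by (simp add: only_def)
      fix t m' assume t: "t < D * D" and v: "view ''w'' m2 t m'"
      have w: "words m' ''d'' 0 = d" "words m' ''t'' 0 = t" "words m' ''j'' 0 = j"
        "reals m' ''Q'' = reals m2 ''Q''" "reals m' ''G'' = reals m1 ''G''"
        using v m2 by (auto simp: ready_simps only_def)
      have G: "reals m1 ''G'' t = Gm (t div D) (t mod D)"
        using m1(3) square_index[OF t] unfolding holds_G_def by metis
      show "ival jj m' = j" using w by simp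
      show "rval (RMul (RMul (RRead ''Q'' (qaddr (IDiv tt DD))) (RRead ''G'' tt)) (RRead ''Q'' (qaddr (IMod tt DD)))) m'
         = ?\<phi> (t div D) (t mod D)"
        using w G m2 square_index[OF t] by (simp add: holds_Q_def)
    qed (auto simp: ready_simps)
  next
    fix m3 assume m3: "after ''w'' m2 ?X m3"
    have w3: "reals m3 ''w'' j = ?w"
    proof -
      have "reals m2 ''w'' j = 0" using m1(5) m2 by (simp add: only_def fresh_def)
      then have "reals m3 ''w'' j = (\<Sum>t<D * D. ?\<phi> (t div D) (t mod D))" using m3 by (simp add: after_def)
      also have "\<dots> = ?w" unfolding bil_def by (rule sum_square)
      finally show ?thesis .
    qed
    have m3': "ready m3" "words m3 ''j'' 0 = j" "only {''Q'', ''w''} m1 m3" "holds_Q j m3" "fresh (Suc j) m3" "holds_P j m3"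
      using m1 m2 m3 by (auto simp: after_def only_def holds_Q_def fresh_def holds_P_def)
    let ?\<psi> = "\<lambda>i c. ?q i * ?q c / ?w"
    let ?Z = "\<lambda>a. reals m3 ''P'' a + (\<Sum>t<D * D. if t = a then ?\<psi> (t div D) (t mod D) else 0)"
    have "triple W m3 GS_Inv (4 * (D * D) + 3) (after ''P'' m3 ?Z)"
      unfolding GS_Inv_def
    proof (rule triple_Acc[OF m3'(1) _ W_D])
      fix t m' assume t: "t < D * D" and v: "view ''P'' m3 t m'"
      have w: "words m' ''d'' 0 = d" "words m' ''t'' 0 = t" "words m' ''j'' 0 = j"
        "reals m' ''Q'' = reals m3 ''Q''" "reals m' ''w'' = reals m3 ''w''"
        using v m3' by (auto simp: ready_simps)
      show "ival tt m' = t" using w by simp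
      show "rval (RDiv (RMul (RRead ''Q'' (qaddr (IDiv tt DD))) (RRead ''Q'' (qaddr (IMod tt DD)))) (RRead ''w'' jj)) m'
         = ?\<psi> (t div D) (t mod D)"
        using w w3 m3'(4) square_index[OF t] by (simp add: holds_Q_def)
    qed (auto simp: ready_simps)
    then show "triple W m3 GS_Inv (4 * (D * D) + 3)
       ?Q"
    proof (rule triple_weaken)
      fix m' assume m': "after ''P'' m3 ?Z m'"
      have "reals m' ''P'' (i * D + c) = gs_inv D Gm (Suc j) i c" if ic: "i < D" "c < D" for i c
      proof -
        have "Suc i * D \<le> D * D" using ic by (intro mult_right_mono) auto
        then have "i * D + c < D * D" using ic by simp
        then have "?Z (i * D + c) = reals m3 ''P'' (i * D + c) + ?\<psi> ((i * D + c) div D) ((i * D + c) mod D)" by simp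
        also have "\<dots> = gs_inv D Gm j i c + ?\<psi> i c"
          using ic m3'(6) by (simp add: holds_P_def)
        finally show ?thesis using m' by (simp add: after_def gs_def)
      qed
      then show "only {''Q'', ''w'', ''P''} m1 m' \<and> words m' ''j'' 0 = j \<and> holds_P (Suc j) m' \<and> fresh (Suc j) m'"
        using m' m3' by (auto simp: after_def only_def holds_P_def fresh_def)
    qed simp
  qed simp
qed simp

lemma triple_Gram_Schmidt:
  assumes m0: "ready m0" "holds_G m0" "reals m0 ''P'' = (\<lambda>_. 0)" "reals m0 ''Q'' = (\<lambda>_. 0)" "reals m0 ''w'' = (\<lambda>_. 0)"
  shows "triple W m0 Gram_Schmidt (16 * (D * D * D) + 16 * D + 9)
    (\<lambda>m'. only {''Q'', ''w'', ''P''} m0 m' \<and> words m' ''j'' 0 = d \<and> holds_P d m' \<and> holds_Q d m')"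
  unfolding Gram_Schmidt_def
proof (rule triple_Seq)
  let ?J = "\<lambda>j m'. only {''Q'', ''w'', ''P''} m0 m' \<and> holds_P j m' \<and> fresh j m'"
  show "triple W m0 (For ''j'' (var ''d'') (Seq GS_Vec (Seq GS_Weight GS_Inv))) (d * (12 * (D * D) + 13 + 3) + 3)
     (\<lambda>m'. ?J d m' \<and> words m' ''j'' 0 = d)"
  proof (rule triple_For[where J = ?J, OF W_d(1)])
    fix j m1 assume j: "j < d" and J: "?J j m1" and w: "words m1 ''j'' 0 = j"
    have "triple W m1 (Seq GS_Vec (Seq GS_Weight GS_Inv)) (12 * (D * D) + 13)
      (\<lambda>m'. only {''Q'', ''w'', ''P''} m1 m' \<and> words m' ''j'' 0 = j \<and> holds_P (Suc j) m' \<and> fresh (Suc j) m')"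
      by (rule triple_GS_step) (use J w j m0 in \<open>auto simp: only_def holds_G_def\<close>)
    then show "triple W m1 (Seq GS_Vec (Seq GS_Weight GS_Inv)) (12 * (D * D) + 13)
      (\<lambda>m'. ?J (Suc j) (write_word ''j'' 0 (Suc j) m') \<and> words m' ''j'' 0 = j)"
      by (rule triple_weaken) (use J in \<open>auto simp: only_def holds_P_def fresh_def ready_simps\<close>)
  qed (use m0 in \<open>auto simp: only_def holds_P_def fresh_def ready_simps\<close>)
  fix m1 assume m1: "?J d m1 \<and> words m1 ''j'' 0 = d"
  have "triple W m1 GS_Vec (4 * (D * D) + 5)
    (\<lambda>m'. only {''Q''} m1 m' \<and> words m' ''j'' 0 = d \<and> holds_Q d m' \<and> (\<forall>a\<ge>Suc d * D. reals m' ''Q'' a = 0))"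
    by (rule triple_GS_Vec) (use m1 m0 in \<open>auto simp: only_def holds_G_def\<close>)
  then show "triple W m1 GS_Vec (4 * (D * D) + 5)
    (\<lambda>m'. only {''Q'', ''w'', ''P''} m0 m' \<and> words m' ''j'' 0 = d \<and> holds_P d m' \<and> holds_Q d m')"
    by (rule triple_weaken) (use m1 in \<open>auto simp: only_def holds_P_def\<close>)
next
  have "d * (12 * (D * D)) + 4 * (D * D) \<le> 16 * (D * D * D)"
  proof -
    have "d * (12 * (D * D)) \<le> D * (12 * (D * D))" by (intro mult_right_mono) (simp_all add: less_imp_le)
    moreover have "D * D * 1 \<le> D * D * D" by (intro mult_left_mono) (simp_all add: Suc_leI)
    ultimately show ?thesis by linarith
  qed
  then show "Suc (d * (12 * (D * D) + 13 + 3) + 3 + (4 * (D * D) + 5)) \<le> 16 * (D * D * D) + 16 * D + 9"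
    using less_imp_le[OF d_lt_D] unfolding add_mult_distrib2 by linarith
qed

subsection \<open>The iteration\<close>

definition res :: "(nat \<Rightarrow> real) \<Rightarrow> nat \<Rightarrow> real" where
  "res x r = b $ r - (\<Sum>c<d. A $$ (r, c) * x c)"

definition pgrad :: "(nat \<Rightarrow> real) \<Rightarrow> nat \<Rightarrow> real" where
  "pgrad x i = (\<Sum>c<d. gs_inv D Gm d i c * (\<Sum>r\<in>R. A $$ (r, c) * res x r))"

text \<open>The program stores \<open>x\<close> and not the vector \<open>(-x, 1)\<close> of
  \<open>iterate\<close>, which reverses the sign of the step.\<close>

primrec xs :: "nat \<Rightarrow> nat \<Rightarrow> real" where
  "xs 0 = (\<lambda>i. - gs D Gm d i)"
| "xs (Suc t) = (\<lambda>i. xs t i + pgrad (xs t) i)"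

lemma triple_Move:
  assumes m0: "ready m0" and z: "\<And>i. i < d \<Longrightarrow> reals m0 ''z'' i = z i"
    and x: "\<And>i. i < d \<Longrightarrow> reals m0 ''x'' i = x i" and b: "\<And>r. r \<in> R \<Longrightarrow> reals m0 ''b'' r = res x r"
  shows "triple W m0 Move (4 * d + 4 * nz + 7) (\<lambda>m'. only {''x'', ''b''} m0 m' \<and>
     (\<forall>i<d. reals m' ''x'' i = x i + z i) \<and> (\<forall>r\<in>R. reals m' ''b'' r = res (\<lambda>i. x i + z i) r))"
  unfolding Move_def
proof (rule triple_Seq)
  let ?X = "\<lambda>j. reals m0 ''x'' j + (\<Sum>t<d. if t = j then z t else 0)"
  show "triple W m0 Move_Point (4 * d + 3) (after ''x'' m0 ?X)"
    unfolding Move_Point_def by (rule triple_Acc[OF m0 _ W_d(1)]) (use z in \<open>auto simp: ready_simps\<close>)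
  fix m1 assume m1: "after ''x'' m0 ?X m1"
  let ?Y = "\<lambda>j. reals m1 ''b'' j + (\<Sum>t<nz. if ro t = j then - (A $$ (ro t, co t) * z (co t)) else 0)"
  have "triple W m1 Move_Residual (4 * nz + 3) (after ''b'' m1 ?Y)"
    unfolding Move_Residual_def by (rule triple_Acc[OF _ _ W3]) (use m1 z co_lt in \<open>auto simp: ready_simps\<close>)
  then show "triple W m1 Move_Residual (4 * nz + 3)
     (\<lambda>m'. only {''x'', ''b''} m0 m' \<and> (\<forall>i<d. reals m' ''x'' i = x i + z i) \<and>
       (\<forall>r\<in>R. reals m' ''b'' r = res (\<lambda>i. x i + z i) r))"
  proof (rule triple_weaken)
    fix m' assume m': "after ''b'' m1 ?Y m'"
    have "reals m' ''b'' r = res (\<lambda>i. x i + z i) r" if r: "r \<in> R" for r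
    proof -
      have "(\<Sum>t<nz. if ro t = r then - (A $$ (ro t, co t) * z (co t)) else 0)
        = (\<Sum>q\<in>R. \<Sum>c<d. if A $$ (q, c) \<noteq> 0 then (if q = r then - (A $$ (q, c) * z c) else 0) else 0)"
        by (rule sparse_sum)
      also have "\<dots> = (\<Sum>q\<in>R. if q = r then (\<Sum>c<d. - (A $$ (r, c) * z c)) else 0)"
        by (intro sum.cong refl) (auto intro!: sum.cong sum.neutral)
      also have "\<dots> = - (\<Sum>c<d. A $$ (r, c) * z c)" using r finite_R by (simp add: sum_negf)
      finally show ?thesis using m' m1 b[OF r] by (simp add: after_def res_def distrib_left sum.distrib)
    qed
    then show "only {''x'', ''b''} m0 m' \<and> (\<forall>i<d. reals m' ''x'' i = x i + z i) \<and>
       (\<forall>r\<in>R. reals m' ''b'' r = res (\<lambda>i. x i + z i) r)"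
      using m' m1 x by (auto simp: after_def only_def)
  qed simp
qed simp

definition solving :: "nat \<Rightarrow> memory \<Rightarrow> bool" where
  "solving t m' \<longleftrightarrow> ready m' \<and> holds_P d m' \<and> reals m' ''rho'' 0 = (2/3) ^ t \<and>
     (\<forall>i<d. reals m' ''x'' i = xs t i) \<and> (\<forall>r\<in>R. reals m' ''b'' r = res (xs t) r)"

lemma triple_Start:
  assumes m0: "ready m0" "words m0 ''j'' 0 = d" "holds_Q d m0" "holds_P d m0"
    "reals m0 ''z'' = (\<lambda>_. 0)" "reals m0 ''x'' = (\<lambda>_. 0)" "\<And>r. r \<in> R \<Longrightarrow> reals m0 ''b'' r = b $ r"
  shows "triple W m0 Start (8 * d + 4 * nz + 13) (solving 0)"
  unfolding Start_def
proof (rule triple_Seq)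
  let ?X = "\<lambda>j. reals m0 ''z'' j + (\<Sum>t<d. if t = j then xs 0 t else 0)"
  show "triple W m0 (Acc ''z'' (var ''d'') tt (RSub (ROfNat (INum 0)) (RRead ''Q'' (qaddr tt)))) (4 * d + 3) (after ''z'' m0 ?X)"
    by (rule triple_Acc[OF m0(1) _ W_d(1)]) (use m0(2,3) in \<open>auto simp: ready_simps holds_Q_def less_D_iff\<close>)
  fix m1 assume m1: "after ''z'' m0 ?X m1"
  show "triple W m1 (Seq Move (RWrite ''rho'' (INum 0) (ROfNat (INum 1)))) (4 * d + 4 * nz + 9) (solving 0)"
  proof (rule triple_Seq)
    show "triple W m1 Move (4 * d + 4 * nz + 7) (\<lambda>m'. only {''x'', ''b''} m1 m' \<and>
      (\<forall>i<d. reals m' ''x'' i = 0 + xs 0 i) \<and> (\<forall>r\<in>R. reals m' ''b'' r = res (\<lambda>i. 0 + xs 0 i) r))"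
      by (rule triple_Move) (use m1 m0 in \<open>auto simp: after_def res_def\<close>)
    fix m2 assume "only {''x'', ''b''} m1 m2 \<and>
      (\<forall>i<d. reals m2 ''x'' i = 0 + xs 0 i) \<and> (\<forall>r\<in>R. reals m2 ''b'' r = res (\<lambda>i. 0 + xs 0 i) r)"
    then show "triple W m2 (RWrite ''rho'' (INum 0) (ROfNat (INum 1))) 1 (solving 0)"
      using m1 m0(4) by (intro triple_RWrite) (auto simp: solving_def after_def only_def holds_P_def ready_def params_def)
  qed simp
qed simp

lemma triple_Improve:
  assumes m0: "solving k m0"
  shows "triple W m0 Improve (12 * d + 8 * nz + 4 * (d * d) + 25) (solving (Suc k))"
  unfolding Improve_def
proof (rule triple_Seq)
  let ?x = "xs k"
  let ?g = "\<lambda>c. \<Sum>r\<in>R. A $$ (r, c) * res ?x r"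
  have r0: "ready m0" using m0 by (simp add: solving_def)
  show "triple W m0 (Fill ''z'' (var ''d'') (ROfNat (INum 0))) (4 * d + 3) (after ''z'' m0 (\<lambda>j. if j < d then 0 else reals m0 ''z'' j))"
    by (rule triple_Fill[OF r0 _ W_d(1)]) (auto simp: ready_simps)
  fix m1 assume m1: "after ''z'' m0 (\<lambda>j. if j < d then 0 else reals m0 ''z'' j) m1"
  show "triple W m1 (Seq (Fill ''g'' (var ''d'') (ROfNat (INum 0)))
    (Seq Gradient (Seq Precondition (Seq Move Shrink))))
    (8 * d + 8 * nz + 4 * (d * d) + 21) (solving (Suc k))"
  proof (rule triple_Seq)
    show "triple W m1 (Fill ''g'' (var ''d'') (ROfNat (INum 0))) (4 * d + 3) (after ''g'' m1 (\<lambda>j. if j < d then 0 else reals m1 ''g'' j))"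
      by (rule triple_Fill[OF _ _ W_d(1)]) (use m1 in \<open>auto simp: ready_simps\<close>)
    fix m2 assume m2: "after ''g'' m1 (\<lambda>j. if j < d then 0 else reals m1 ''g'' j) m2"
    let ?X = "\<lambda>j. reals m2 ''g'' j + (\<Sum>t<nz. if co t = j then A $$ (ro t, co t) * res ?x (ro t) else 0)"
    show "triple W m2 (Seq Gradient (Seq Precondition (Seq Move Shrink)))
      (4 * d + 8 * nz + 4 * (d * d) + 17) (solving (Suc k))"
    proof (rule triple_Seq)
      show "triple W m2 Gradient (4 * nz + 3) (after ''g'' m2 ?X)"
        unfolding Gradient_def by (rule triple_Acc[OF _ _ W3]) (use m0 m1 m2 ro_R in \<open>auto simp: ready_simps solving_def\<close>)
      fix m3 assume m3: "after ''g'' m2 ?X m3"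
      have g: "reals m3 ''g'' c = ?g c" if c: "c < d" for c
      proof -
        have "(\<Sum>t<nz. if co t = c then A $$ (ro t, co t) * res ?x (ro t) else 0)
          = (\<Sum>r\<in>R. \<Sum>c'<d. if A $$ (r, c') \<noteq> 0 then (if c' = c then A $$ (r, c') * res ?x r else 0) else 0)"
          by (rule sparse_sum)
        also have "\<dots> = (\<Sum>r\<in>R. \<Sum>c'<d. if c' = c then A $$ (r, c) * res ?x r else 0)"
          by (intro sum.cong refl) auto
        also have "\<dots> = ?g c" using c by simp
        finally show ?thesis using m3 m2 c by (simp add: after_def)
      qed
      have m3': "ready m3" "only {''z'', ''g''} m0 m3" "\<And>i. i < d \<Longrightarrow> reals m3 ''z'' i = 0" "holds_P d m3"
        using m0 m1 m2 m3 by (auto simp: after_def only_def solving_def holds_P_def)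
      let ?\<phi> = "\<lambda>i c. gs_inv D Gm d i c * ?g c"
      let ?Y = "\<lambda>j. reals m3 ''z'' j + (\<Sum>t<d * d. if t div d = j then ?\<phi> (t div d) (t mod d) else 0)"
      show "triple W m3 (Seq Precondition (Seq Move Shrink))
        (4 * d + 4 * nz + 4 * (d * d) + 13) (solving (Suc k))"
      proof (rule triple_Seq)
        show "triple W m3 Precondition (4 * (d * d) + 3) (after ''z'' m3 ?Y)"
          unfolding Precondition_def
        proof (rule triple_Acc[OF m3'(1) _ W_d(2)])
          fix t m' assume t: "t < d * d" and v: "view ''z'' m3 t m'"
          have w: "words m' ''d'' 0 = d" "words m' ''t'' 0 = t"
            "reals m' ''P'' = reals m3 ''P''" "reals m' ''g'' = reals m3 ''g''"
            using v by (auto simp: ready_simps)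
          have i: "t div d < d" "t mod d < d" using t d by (auto simp: less_mult_imp_div_less)
          show "ival (IDiv tt (var ''d'')) m' = t div d" using w by simp
          show "rval (RMul (RRead ''P'' (IAdd (IMul (IDiv tt (var ''d'')) DD) (IMod tt (var ''d'')))) (RRead ''g'' (IMod tt (var ''d'')))) m'
            = ?\<phi> (t div d) (t mod d)"
            using w i m3'(4) g[OF i(2)] by (simp add: holds_P_def less_D_iff)
        qed (auto simp: ready_simps)
        fix m4 assume m4: "after ''z'' m3 ?Y m4"
        have z: "reals m4 ''z'' i = pgrad ?x i" if i: "i < d" for i
        proof -
          have "(\<Sum>t<d * d. if t div d = i then ?\<phi> (t div d) (t mod d) else 0) = (\<Sum>i'<d. \<Sum>c<d. if i' = i then ?\<phi> i' c else 0)"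
            using d by (intro sum_div_mod[where F = "\<lambda>i' c. if i' = i then ?\<phi> i' c else 0"]) simp
          also have "\<dots> = (\<Sum>i'<d. if i' = i then pgrad ?x i else 0)"
            by (intro sum.cong refl) (auto simp: pgrad_def)
          also have "\<dots> = pgrad ?x i" using i by simp
          finally show ?thesis using m4 m3'(3)[OF i] by (simp add: after_def)
        qed
        have m4': "ready m4" "only {''z'', ''g''} m0 m4"
          using m3' m4 by (auto simp: after_def only_def)
        show "triple W m4 (Seq Move Shrink)
          (4 * d + 4 * nz + 9) (solving (Suc k))"
        proof (rule triple_Seq)
          show "triple W m4 Move (4 * d + 4 * nz + 7) (\<lambda>m'. only {''x'', ''b''} m4 m' \<and>
            (\<forall>i<d. reals m' ''x'' i = ?x i + pgrad ?x i) \<and> (\<forall>r\<in>R. reals m' ''b'' r = res (\<lambda>i. ?x i + pgrad ?x i) r))"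
            by (rule triple_Move) (use m4' z m0 in \<open>auto simp: only_def solving_def\<close>)
          fix m5 assume "only {''x'', ''b''} m4 m5 \<and>
            (\<forall>i<d. reals m5 ''x'' i = ?x i + pgrad ?x i) \<and> (\<forall>r\<in>R. reals m5 ''b'' r = res (\<lambda>i. ?x i + pgrad ?x i) r)"
          then show "triple W m5 Shrink 1 (solving (Suc k))"
            unfolding Shrink_def using m4' m0 by (intro triple_RWrite) (auto simp: solving_def only_def holds_P_def ready_def params_def)
        qed simp
      qed simp
    qed simp
  qed simp
qed simp

lemma triple_Solve:
  assumes m0: "ready m0" "\<And>y. y \<notin> {''val'', ''b'', ''eps''} \<Longrightarrow> reals m0 y = (\<lambda>_. 0)" "\<And>r. r \<in> R \<Longrightarrow> reals m0 ''b'' r = b $ r"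
    and k: "\<And>i. i < k \<Longrightarrow> \<epsilon> < (2/3) ^ i" "(2/3) ^ k \<le> \<epsilon>"
  shows "triple W m0 Solve
    (16 * nz + 4 * (K * (N * D)) + 4 * (m * (D * D)) + 16 * (D * D * D) + 16 * D + 8 * d + 45 + k * (12 * d + 8 * nz + 4 * (d * d) + 26))
    (\<lambda>m'. \<forall>i<d. reals m' ''x'' i = xs k i)" (is "triple W m0 _ _ ?Q")
  unfolding Solve_def
proof (rule triple_Seq[OF triple_Sketch])
  fix m1 assume m1: "only {''c'', ''B''} m0 m1 \<and> (\<forall>a l. l < D \<longrightarrow> reals m1 ''B'' (a * D + l) = count_sketch R f aug a l)"
  show "triple W m1 (Seq Hadamard (Seq Gram (Seq Gram_Schmidt (Seq Start Iterate))))
    (4 * nz + 4 * (K * (N * D)) + 4 * (m * (D * D)) + 16 * (D * D * D) + 16 * D + 8 * d + 33 + k * (12 * d + 8 * nz + 4 * (d * d) + 26))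
    ?Q"
  proof (rule triple_Seq[OF triple_Hadamard])
    fix m2 assume m2: "only {''B''} m1 m2 \<and> (\<forall>a l. a < N \<longrightarrow> l < D \<longrightarrow> reals m2 ''B'' (K * (N * D) + a * D + l) = sketch_rows K R aug f a l)"
    show "triple W m2 (Seq Gram (Seq Gram_Schmidt (Seq Start Iterate)))
      (4 * nz + 4 * (m * (D * D)) + 16 * (D * D * D) + 16 * D + 8 * d + 29 + k * (12 * d + 8 * nz + 4 * (d * d) + 26))
      ?Q"
    proof (rule triple_Seq[OF triple_Gram])
      fix m3 assume m3: "only {''G''} m2 m3 \<and> (\<forall>i l. i < D \<longrightarrow> l < D \<longrightarrow> reals m3 ''G'' (i * D + l) = Gm i l)"
      show "triple W m3 (Seq Gram_Schmidt (Seq Start Iterate))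
        (4 * nz + 16 * (D * D * D) + 16 * D + 8 * d + 25 + k * (12 * d + 8 * nz + 4 * (d * d) + 26))
        ?Q"
      proof (rule triple_Seq[OF triple_Gram_Schmidt])
        fix m4 assume m4: "only {''Q'', ''w'', ''P''} m3 m4 \<and> words m4 ''j'' 0 = d \<and> holds_P d m4 \<and> holds_Q d m4"
        show "triple W m4 (Seq Start Iterate)
          (4 * nz + 8 * d + 15 + k * (12 * d + 8 * nz + 4 * (d * d) + 26)) ?Q"
        proof (rule triple_Seq[OF triple_Start])
          fix m5 assume m5: "solving 0 m5"
          have "triple W m5 Iterate
            (k * Suc (12 * d + 8 * nz + 4 * (d * d) + 25) + 1) (solving k)"
          unfolding Iterate_def
          proof (rule triple_While)
            fix i m' assume "i < k" "solving i m'"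
            then show "bval (RLess (RRead ''eps'' (INum 0)) (RRead ''rho'' (INum 0))) m' \<and>
              triple W m' Improve (12 * d + 8 * nz + 4 * (d * d) + 25) (solving (Suc i))"
              using k(1) triple_Improve by (auto simp: solving_def ready_def params_def)
          next
            fix m' assume "solving k m'"
            then show "\<not> bval (RLess (RRead ''eps'' (INum 0)) (RRead ''rho'' (INum 0))) m'"
              using k(2) by (auto simp: solving_def ready_def params_def)
          qed (rule m5)
          then show "triple W m5 Iterate
            (k * (12 * d + 8 * nz + 4 * (d * d) + 26) + 1) ?Q"
            by (rule triple_weaken) (auto simp: solving_def)
        qed (use m0 m1 m2 m3 m4 in \<open>auto simp: only_def\<close>)
      qed (use m0 m1 m2 m3 in \<open>auto simp: only_def holds_G_def\<close>)
    qed (use m0 m1 m2 in \<open>auto simp: only_def\<close>)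
  qed (use m0 m1 in \<open>auto simp: only_def\<close>)
qed (use m0 in \<open>auto\<close>)

end

subsection \<open>Approximation guarantee\<close>

context lsq_run
begin

lemma bil_Gm: "bil D Gm x y = 2 / m * (\<Sum>q<m. vip D (sketch_rows K R aug f (s q)) x * vip D (sketch_rows K R aug f (s q)) y)"
proof -
  have "bil D Gm x y = 2 / m * bil D (gram {..<m} (\<lambda>q. sketch_rows K R aug f (s q))) x y"
    by (simp add: bil_def Gm_def gram_def sum_distrib_left mult_ac)
  then show ?thesis by (simp add: bil_gram)
qed

lemma psd_Gm: "psd_form D Gm"
proof
  show "Gm i j = Gm j i" for i j by (simp add: Gm_def mult.commute)
  show "0 \<le> bil D Gm x x" for x
    unfolding bil_Gm power2_eq_square[symmetric] by (intro mult_nonneg_nonneg sum_nonneg zero_le_power2) auto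
qed

lemma vip_aug: "vip D (aug r) (\<lambda>i. if i < d then - x i else 1) = res x r"
proof -
  have "{..<D} = insert d {..<d}" by (auto simp: less_D_iff)
  then have "vip D (aug r) (\<lambda>i. if i < d then - x i else 1) = b $ r + (\<Sum>i<d. - (A $$ (r, i) * x i))"
    unfolding vip_def by (simp add: aug_def)
  then show ?thesis by (simp add: res_def sum_negf)
qed

text \<open>On vectors \<open>(-x, 1)\<close> the Gram form of the augmented matrix is the squared
  residual over \<open>R\<close>, and \<open>xs\<close> is \<open>iterate\<close> in these terms; an
  arbitrary \<open>x\<close> is then compared through \<open>optimal_le\<close>.\<close>

lemma sketched_solution:
  assumes good: "good_sample D K m R aug f s"
  shows "(\<Sum>r\<in>R. (res (xs t) r)\<^sup>2) \<le> (1 + 2 * (2/3) ^ t) * (\<Sum>r\<in>R. (res x r)\<^sup>2)"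
proof -
  let ?M = "gram R aug"
  interpret preconditioned d ?M Gm
  proof (intro preconditioned.intro preconditioned_axioms.intro)
    show "psd_form (Suc d) ?M" "psd_form (Suc d) Gm" using psd_gram psd_Gm by simp_all
    fix y
    show "bil (Suc d) ?M y y \<le> bil (Suc d) Gm y y" "bil (Suc d) Gm y y \<le> 3 * bil (Suc d) ?M y y"
      using good unfolding good_sample_def by (simp_all add: bil_gram bil_Gm flip: power2_eq_square)
  qed
  have M_res: "bil D ?M u u = (\<Sum>r\<in>R. (res x r)\<^sup>2)" if u: "\<And>i. i < D \<Longrightarrow> u i = (if i < d then - x i else 1)" for u x
  proof -
    have "vip D (aug r) u = res x r" for r
      unfolding vip_aug[symmetric] vip_def by (intro sum.cong refl) (simp add: u)
    then show ?thesis by (simp add: bil_gram power2_eq_square)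
  qed
  have iter: "\<forall>i<D. iterate d ?M Gm t i = (if i < d then - xs t i else 1)" for t
  proof (induction t)
    case 0
    show ?case using G.gs_diag[of d] by (auto simp: less_D_iff)
  next
    case (Suc t)
    let ?u = "iterate d ?M Gm t"
    have "direction d ?M Gm ?u i = pgrad (xs t) i" for i
    proof -
      have "grad d ?M ?u c = (\<Sum>r\<in>R. A $$ (r, c) * res (xs t) r)" if c: "c < d" for c
      proof -
        have "grad d ?M ?u c = (\<Sum>j<D. \<Sum>r\<in>R. aug r c * (aug r j * ?u j))"
          by (simp add: grad_def gram_def sum_distrib_right mult.assoc)
        also have "\<dots> = (\<Sum>r\<in>R. aug r c * vip D (aug r) ?u)"
          by (subst sum.swap) (simp add: vip_def sum_distrib_left)
        also have "\<dots> = (\<Sum>r\<in>R. A $$ (r, c) * res (xs t) r)"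
        proof (intro sum.cong refl arg_cong2[where f = "(*)"])
          fix r
          show "aug r c = A $$ (r, c)" using c by (simp add: aug_def)
          show "vip D (aug r) ?u = res (xs t) r"
            unfolding vip_aug[symmetric] vip_def by (intro sum.cong refl) (use Suc in auto)
        qed
        finally show ?thesis .
      qed
      then show ?thesis by (simp add: direction_def pgrad_def)
    qed
    then show ?case using Suc iterate_last[of "Suc t"] by (auto simp: less_D_iff)
  qed
  let ?u = "\<lambda>i. if i < d then - x i else 1"
  have "(\<Sum>r\<in>R. (res (xs t) r)\<^sup>2) = bil D ?M (iterate d ?M Gm t) (iterate d ?M Gm t)"
    using iter by (intro M_res[symmetric]) auto
  also have "\<dots> \<le> (1 + 2 * (2/3) ^ t) * bil D ?M opt opt"
    using iterate_error[of t] by simp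
  also have "\<dots> \<le> (1 + 2 * (2/3) ^ t) * bil D ?M ?u ?u"
    using optimal_le[of ?u] by (intro mult_left_mono) (auto intro: add_nonneg_nonneg)
  also have "bil D ?M ?u ?u = (\<Sum>r\<in>R. (res x r)\<^sup>2)" by (rule M_res) simp
  finally show ?thesis .
qed

text \<open>A row without nonzeros contributes the square of its entry of \<open>b\<close> whatever
  \<open>x\<close> is. This is why the sketch and the iteration may ignore rows outside
  \<open>R\<close>.\<close>

lemma residual_norm:
  assumes x: "x \<in> carrier_vec d"
  shows "(norm2 (A *\<^sub>v x - b))\<^sup>2 = (\<Sum>r\<in>R. (res (($) x) r)\<^sup>2) + (\<Sum>r\<in>{..<n} - R. (b $ r)\<^sup>2)"
proof -
  have ent: "(A *\<^sub>v x - b) $ r = - res (($) x) r" if r: "r < n" for r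
    using r x A b by (simp add: res_def scalar_prod_def atLeast0LessThan row_def)
  have zero: "res (($) x) r = b $ r" if r: "r < n" "r \<notin> R" for r
  proof -
    have "A $$ (r, c) = 0" if "c < d" for c
    proof (rule ccontr)
      assume "A $$ (r, c) \<noteq> 0"
      then have "(r, c) \<in> set ps" using ps_set(2) r that by auto
      then show False using r(2) unfolding R_def by force
    qed
    then show ?thesis by (simp add: res_def)
  qed
  have "(norm2 (A *\<^sub>v x - b))\<^sup>2 = (\<Sum>r<n. ((A *\<^sub>v x - b) $ r)\<^sup>2)"
    using A b unfolding norm2_def L2_set_def by (simp add: sum_nonneg)
  also have "\<dots> = (\<Sum>r<n. (res (($) x) r)\<^sup>2)" by (intro sum.cong refl) (simp add: ent)
  also have "\<dots> = (\<Sum>r\<in>{..<n} - R. (res (($) x) r)\<^sup>2) + (\<Sum>r\<in>R. (res (($) x) r)\<^sup>2)"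
    using R_lt by (intro sum.subset_diff) auto
  also have "(\<Sum>r\<in>{..<n} - R. (res (($) x) r)\<^sup>2) = (\<Sum>r\<in>{..<n} - R. (b $ r)\<^sup>2)"
    using zero by (intro sum.cong refl) auto
  finally show ?thesis by simp
qed

text \<open>On squared residuals an excess factor of \<open>1 + 2 * \<epsilon>\<close> is allowed,
  as it is at most the square of \<open>1 + \<epsilon>\<close>; the constant part from the zero rows
  may be enlarged by it as well.\<close>

lemma approx_solution_xs:
  assumes good: "good_sample D K m R aug f s" and k: "(2/3) ^ k \<le> \<epsilon>"
    and out: "\<And>i. i < d \<Longrightarrow> reals m' ''x'' i = xs k i"
  shows "approx_solution A b \<epsilon> (output_vector d m')"
proof -
  let ?x = "output_vector d m'"
  have x: "?x \<in> carrier_vec d" by (simp add: output_vector_def)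
  have res_x: "res (($) ?x) r = res (xs k) r" for r
    unfolding res_def output_vector_def using out by (simp cong: sum.cong_simp)
  have le: "norm2 (A *\<^sub>v ?x - b) \<le> (1 + \<epsilon>) * norm2 (A *\<^sub>v y - b)" if y: "y \<in> carrier_vec d" for y
  proof -
    let ?o = "\<Sum>r\<in>{..<n} - R. (b $ r)\<^sup>2" and ?r = "\<Sum>r\<in>R. (res (($) y) r)\<^sup>2"
    have o: "0 \<le> ?o" "0 \<le> ?r" by (auto intro!: sum_nonneg)
    have "(norm2 (A *\<^sub>v ?x - b))\<^sup>2 \<le> (1 + 2 * (2/3) ^ k) * ?r + ?o"
      unfolding residual_norm[OF x] res_x by (intro add_right_mono sketched_solution[OF good])
    also have "\<dots> \<le> (1 + 2 * \<epsilon>) * ?r + (1 + 2 * \<epsilon>) * ?o"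
      using k o eps by (intro add_mono mult_right_mono) (auto simp: mult_le_cancel_right1)
    also have "\<dots> = (1 + 2 * \<epsilon>) * (norm2 (A *\<^sub>v y - b))\<^sup>2" unfolding residual_norm[OF y] by (simp add: distrib_left)
    also have "\<dots> \<le> (1 + \<epsilon>)\<^sup>2 * (norm2 (A *\<^sub>v y - b))\<^sup>2"
      by (intro mult_right_mono) (auto simp: power2_sum)
    finally have "(norm2 (A *\<^sub>v ?x - b))\<^sup>2 \<le> ((1 + \<epsilon>) * norm2 (A *\<^sub>v y - b))\<^sup>2" by (simp add: power_mult_distrib)
    then show ?thesis by (rule power2_le_imp_le) (use eps in \<open>simp add: norm2_def L2_set_nonneg\<close>)
  qed
  have "norm2 (A *\<^sub>v ?x - b) / (1 + \<epsilon>) \<le> least_residual A b"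
    unfolding least_residual_def
  proof (rule cINF_greatest)
    have "?x \<in> carrier_vec (dim_col A)" using A x by simp
    then show "(carrier_vec (dim_col A) :: real vec set) \<noteq> {}" by blast
    fix y :: "real vec" assume "y \<in> carrier_vec (dim_col A)"
    then show "norm2 (A *\<^sub>v ?x - b) / (1 + \<epsilon>) \<le> norm2 (A *\<^sub>v y - b)"
      using le[of y] A eps by (simp add: field_simps)
  qed
  then show ?thesis using x A eps unfolding approx_solution_def by (simp add: field_simps)
qed

end

section \<open>Choosing the sizes\<close>

context lsq
begin

definition sized :: "memory \<Rightarrow> memory \<Rightarrow> bool" where
  "sized m0 m' \<longleftrightarrow> reals m' = reals m0 \<and> (\<forall>x. x \<notin> {''p'', ''K'', ''N'', ''m''} \<longrightarrow> words m' x = words m0 x) \<and>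
     words m' ''K'' 0 = K \<and> words m' ''N'' 0 = N \<and> words m' ''m'' 0 = m \<and> (\<forall>i\<le>K. words m' ''p'' i = 2 ^ i)"

lemma triple_Sizes:
  assumes m0: "words m0 ''d'' 0 = d" "words m0 ''K'' 0 = 0"
    and K: "\<forall>k<K. 2 ^ k < 32768 * (D * D)" "32768 * (D * D) \<le> 2 ^ K"
    and W: "N \<le> W" "m \<le> W"
  shows "triple W m0 Sizes (4 * K + 7) (sized m0)"
  unfolding Sizes_def
proof (rule triple_Seq)
  let ?J = "\<lambda>i (m' :: memory). reals m' = reals m0 \<and> (\<forall>x. x \<notin> {''p'', ''K''} \<longrightarrow> words m' x = words m0 x) \<and>
     words m' ''K'' 0 = i \<and> (\<forall>j\<le>i. words m' ''p'' j = 2 ^ j)"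
  have N1: "1 \<le> N" by (simp add: N_def)
  show "triple W m0 (IWrite ''p'' (INum 0) (INum 1)) 1 (?J 0)"
    by (rule triple_IWrite) (use m0 W N1 in auto)
  fix m1 assume m1: "?J 0 m1"
  let ?fin = "Seq (IWrite ''N'' (INum 0) (IRead ''p'' (var ''K'')))
        (IWrite ''m'' (INum 0) (IMul (INum 2048) (IMul (IMul (var ''K'') (var ''K'')) DD)))"
  let ?body = "Seq (IWrite ''p'' (IAdd (var ''K'') (INum 1)) (IMul (INum 2) (IRead ''p'' (var ''K''))))
           (IWrite ''K'' (INum 0) (IAdd (var ''K'') (INum 1)))"
  let ?test = "ILess (IRead ''p'' (var ''K'')) (IMul (INum 32768) (IMul DD DD))"
  show "triple W m1 (Seq (While ?test ?body) ?fin) (4 * K + 5) (sized m0)"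
  proof (rule triple_Seq)
    show "triple W m1 (While ?test ?body) (K * Suc 3 + 1) (?J K)"
    proof (rule triple_While[where J = ?J])
      fix i m' assume i: "i < K" and J: "?J i m'"
      have "(2::nat) ^ Suc i \<le> N" unfolding N_def using i by (intro power_increasing) auto
      then have pw: "2 * 2 ^ i \<le> W" using W by simp
      have "Suc i < 2 ^ Suc i" by (rule less_exp)
      then have SK: "Suc i \<le> W" using pw by simp
      have "triple W m' ?body 3 (?J (Suc i))"
      proof (rule triple_Seq)
        let ?Q = "\<lambda>m' :: memory. reals m' = reals m0 \<and> (\<forall>x. x \<notin> {''p'', ''K''} \<longrightarrow> words m' x = words m0 x) \<and>
          words m' ''K'' 0 = i \<and> (\<forall>j\<le>Suc i. words m' ''p'' j = 2 ^ j)"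
        show "triple W m' (IWrite ''p'' (IAdd (var ''K'') (INum 1)) (IMul (INum 2) (IRead ''p'' (var ''K'')))) 1 ?Q"
          by (rule triple_IWrite) (use J pw in \<open>auto simp: le_Suc_eq\<close>)
        fix m'' assume "?Q m''"
        then show "triple W m'' (IWrite ''K'' (INum 0) (IAdd (var ''K'') (INum 1))) 1 (?J (Suc i))"
          by (intro triple_IWrite) (use SK in auto)
      qed simp
      then show "bval ?test m' \<and> triple W m' ?body 3 (?J (Suc i))"
        using J m0 K(1) i by simp
    next
      fix m' assume "?J K m'"
      then show "\<not> bval ?test m'" using m0 K(2) by simp
    qed (rule m1)
    fix m2 assume m2: "?J K m2"
    show "triple W m2 ?fin 3 (sized m0)"
    proof (rule triple_Seq)
      show "triple W m2 (IWrite ''N'' (INum 0) (IRead ''p'' (var ''K''))) 1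
        (\<lambda>m'. reals m' = reals m0 \<and> (\<forall>x. x \<notin> {''p'', ''K'', ''N''} \<longrightarrow> words m' x = words m0 x) \<and>
          words m' ''K'' 0 = K \<and> (\<forall>j\<le>K. words m' ''p'' j = 2 ^ j) \<and> words m' ''N'' 0 = N)"
        by (rule triple_IWrite) (use m2 W in \<open>auto simp: N_def\<close>)
      fix m3 :: memory assume m3: "reals m3 = reals m0 \<and> (\<forall>x. x \<notin> {''p'', ''K'', ''N''} \<longrightarrow> words m3 x = words m0 x) \<and>
          words m3 ''K'' 0 = K \<and> (\<forall>j\<le>K. words m3 ''p'' j = 2 ^ j) \<and> words m3 ''N'' 0 = N"
      have v: "ival (IMul (INum 2048) (IMul (IMul (var ''K'') (var ''K'')) DD)) m3 = m"
        using m3 m0 by (simp add: m_def power2_eq_square)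
      show "triple W m3 (IWrite ''m'' (INum 0) (IMul (INum 2048) (IMul (IMul (var ''K'') (var ''K'')) DD))) 1 (sized m0)"
        by (rule triple_IWrite; (unfold v)?) (use m3 W in \<open>auto simp: sized_def\<close>)
    qed simp
  qed simp
qed simp

end

section \<open>Random choices and running time\<close>

lemma prob_bind_ge:
  assumes "\<And>x. x \<in> set_pmf p \<Longrightarrow> x \<in> E \<Longrightarrow> set_pmf (g x) \<subseteq> X"
  shows "measure_pmf.prob p E \<le> measure_pmf.prob (bind_pmf p g) X"
proof -
  have "emeasure (measure_pmf p) E = (\<integral>\<^sup>+x. indicator E x \<partial>measure_pmf p)" by simp
  also have "\<dots> \<le> (\<integral>\<^sup>+x. emeasure (measure_pmf (g x)) X \<partial>measure_pmf p)"
  proof (rule nn_integral_mono_AE, simp add: AE_measure_pmf_iff, intro ballI)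
    fix x assume x: "x \<in> set_pmf p"
    show "indicator E x \<le> emeasure (measure_pmf (g x)) X"
    proof (cases "x \<in> E")
      case True
      then have "measure_pmf.prob (g x) X = 1"
        using assms[OF x] by (simp add: measure_pmf.prob_eq_1 AE_measure_pmf_iff subset_iff)
      then show ?thesis using True by (simp add: measure_pmf.emeasure_eq_measure)
    qed simp
  qed
  also have "\<dots> = emeasure (measure_pmf (bind_pmf p g)) X" by simp
  finally show ?thesis by (simp add: measure_pmf.emeasure_eq_measure)
qed

context lsq
begin

abbreviation "m_input \<equiv> input_memory ps A b \<epsilon>"

lemma run_Least_Squares:
  assumes K: "\<forall>k<K. 2 ^ k < 32768 * (D * D)" "32768 * (D * D) \<le> 2 ^ K"
    and W1: "K * (N * D) \<le> W" and W2: "m * (D * D) \<le> W" and W3: "nz \<le> W" and W4: "2 * N \<le> W"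
    and k: "\<forall>i<k. \<epsilon> < (2/3) ^ i" "(2/3) ^ k \<le> \<epsilon>"
  defines "Ts \<equiv> 16 * nz + 4 * (K * (N * D)) + 4 * (m * (D * D)) + 16 * (D * D * D) + 16 * D + 8 * d + 45 + k * (12 * d + 8 * nz + 4 * (d * d) + 26)"
  shows "\<exists>T \<le> 4 * K + 4 * nz + 4 * m + 16 + Ts. halts_within W T Least_Squares m_input \<and>
     measure_pmf.prob (outcome W T Least_Squares m_input) {Some ([], m') | m'. approx_solution A b \<epsilon> (output_vector d m')} \<ge> 99/100"
proof -
  have K0: "0 < K"
  proof (rule ccontr)
    assume "\<not> 0 < K"
    then have "32768 * (D * D) \<le> 1" using K(2) by simp
    moreover have "1 \<le> D * D" by (simp add: Suc_leI)
    ultimately show False by linarith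
  qed
  have mW: "m \<le> W"
  proof -
    have "m * 1 \<le> m * (D * D)" by (rule mult_le_mono2) (simp add: Suc_leI)
    then show ?thesis using W2 by linarith
  qed
  have N0: "0 < N" by (simp add: N_def)
  have m0: "words m_input ''d'' 0 = d" "words m_input ''K'' 0 = 0" "words m_input ''h'' = (\<lambda>_. 0)" "words m_input ''s'' = (\<lambda>_. 0)"
    "words m_input ''nnz'' 0 = nz" "\<And>t. t < nz \<Longrightarrow> words m_input ''row'' t = ro t" "\<And>t. t < nz \<Longrightarrow> words m_input ''col'' t = co t"
    "\<And>t. t < nz \<Longrightarrow> reals m_input ''val'' t = A $$ (ro t, co t)" "reals m_input ''eps'' 0 = \<epsilon>"
    "\<And>r. r < n \<Longrightarrow> reals m_input ''b'' r = b $ r" "\<And>y. y \<notin> {''val'', ''b'', ''eps''} \<Longrightarrow> reals m_input y = (\<lambda>_. 0)"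
    using A b by (auto simp: input_memory_def cells_def nz_def ro_def co_def list_of_vec_index)
  obtain t0 m1 where t0: "t0 \<le> 4 * K + 7" and r0: "reach W t0 Sizes m_input m1" and m1: "sized m_input m1"
    using triple_Sizes[OF m0(1,2) K] W4 mW by (auto simp: triple_def)
  let ?p = "Pi_pmf R 0 (\<lambda>_. pmf_of_set {..<2 * N})" and ?q = "Pi_pmf {..<m} 0 (\<lambda>_. pmf_of_set {..<N})"
  let ?m2 = "\<lambda>f. updw ''t'' ''h'' m1 nz f" and ?m3 = "\<lambda>f s. updw ''t'' ''s'' (updw ''t'' ''h'' m1 nz f) m s"
  have hash: "run W (4 * nz + 3) (Some (Draw_Hash # cs, m1)) = map_pmf (\<lambda>f. Some (cs, ?m2 f)) ?p" for cs
    unfolding Draw_Hash_def R_eq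
    by (rule run_draws) (use m1 m0 W3 W4 N0 in \<open>auto simp: sized_def\<close>)
  have samples: "run W (4 * m + 3) (Some (Draw_Samples # cs, ?m2 f)) = map_pmf (\<lambda>s. Some (cs, ?m3 f s)) ?q" for cs f
    using run_draws[of m W "''t''" "''s''" N "?m2 f" "var ''m''" tt id "var ''N''" cs] m1 m0 mW W4 N0
    by (simp add: Draw_Samples_def sized_def)
  \<comment> \<open>One number of steps has to serve all random choices: the drawing loops take
    exact times, and \<open>Solve\<close> is run for its bound \<open>Ts\<close>, since halted
    configurations do not change.\<close>
  let ?T = "Suc (t0 + Suc ((4 * nz + 3) + Suc ((4 * m + 3) + Ts)))"
  have run1: "run W (Suc t) (Some (Seq c c' # cs, m')) = run W t (Some (c # c' # cs, m'))" for t c c' cs m'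
    by (simp add: bind_return_pmf)
  let ?solve = "\<lambda>(f, s). run W Ts (Some ([Solve], ?m3 f s))"
  have outcome: "outcome W ?T Least_Squares m_input = bind_pmf (pair_pmf ?p ?q) ?solve"
    unfolding outcome_def Least_Squares_def run1 run_add[of W t0] r0[unfolded reach_def, rule_format]
    by (simp only: bind_return_pmf run1 run_add[of W "4 * nz + 3"] hash bind_map_pmf run_add[of W "4 * m + 3"] samples
        pair_pmf_def bind_assoc_pmf prod.case)
  have solve: "\<exists>m'. ?solve (f, s) = return_pmf (Some ([], m')) \<and> (good_sample D K m R aug f s \<longrightarrow> approx_solution A b \<epsilon> (output_vector d m'))"
    if fs: "(f, s) \<in> set_pmf (pair_pmf ?p ?q)" for f s
  proof -
    have f: "f r < 2 * N" if "r \<in> R" for r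
      using fs that N0 finite_R set_Pi_pmf[of R 0 "\<lambda>_. pmf_of_set {..<2 * N}"]
      by (auto simp: PiE_dflt_def lessThan_empty_iff)
    have s: "s q < N" if "q < m" for q
      using fs that N0 set_Pi_pmf[of "{..<m}" 0 "\<lambda>_. pmf_of_set {..<N}"]
      by (auto simp: PiE_dflt_def lessThan_empty_iff)
    interpret lsq_run n d A b \<epsilon> ps K W f s
    proof (intro lsq_run.intro lsq_run_axioms.intro)
      show "lsq n d A b \<epsilon> ps" by (rule lsq_axioms)
    qed (fact f s K0 W1 W2 W3)+
    have "ready (?m3 f s)" using m1 m0 by (auto simp: ready_def params_def sized_def)
    then have "triple W (?m3 f s) Solve Ts (\<lambda>m'. \<forall>i<d. reals m' ''x'' i = xs k i)"
      unfolding Ts_def by (rule triple_Solve) (use m1 m0 R_lt k in \<open>auto simp: sized_def\<close>)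
    from triple_run[OF this le_refl] obtain m' where
      "run W Ts (Some ([Solve], ?m3 f s)) = return_pmf (Some ([], m'))" "\<forall>i<d. reals m' ''x'' i = xs k i"
      by blast
    then show ?thesis using approx_solution_xs[OF _ k(2)] by auto
  qed
  have halts: "halts_within W ?T Least_Squares m_input"
    unfolding halts_within_def outcome
  proof
    fix c assume "c \<in> set_pmf (bind_pmf (pair_pmf ?p ?q) ?solve)"
    then obtain x where x: "x \<in> set_pmf (pair_pmf ?p ?q)" "c \<in> set_pmf (?solve x)" unfolding set_bind_pmf by blast
    obtain f s where fs: "x = (f, s)" by (cases x)
    show "\<exists>m'. c = Some ([], m')" using solve[of f s] x unfolding fs by auto
  qed
  have "99/100 \<le> measure_pmf.prob (pair_pmf ?p ?q) {(f, s). good_sample D K m R aug f s}"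
    using good_sample_probability[OF finite_R, of D K m aug] K(2)
    by (simp add: N_def m_def power2_eq_square Suc_leI)
  also have "\<dots> \<le> measure_pmf.prob (bind_pmf (pair_pmf ?p ?q) ?solve) {Some ([], m') | m'. approx_solution A b \<epsilon> (output_vector d m')}"
  proof (rule prob_bind_ge)
    fix x assume x: "x \<in> set_pmf (pair_pmf ?p ?q)" "x \<in> {(f, s). good_sample D K m R aug f s}"
    obtain f s where fs: "x = (f, s)" by (cases x)
    show "set_pmf (?solve x) \<subseteq> {Some ([], m') | m'. approx_solution A b \<epsilon> (output_vector d m')}"
      using solve[of f s] x unfolding fs by auto
  qed
  finally have prob: "99/100 \<le> measure_pmf.prob (outcome W ?T Least_Squares m_input) {Some ([], m') | m'. approx_solution A b \<epsilon> (output_vector d m')}"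
    unfolding outcome .
  have "?T \<le> 4 * K + 4 * nz + 4 * m + 16 + Ts" using t0 by simp
  with halts prob show ?thesis by blast
qed

end

section \<open>Number of rounds, word size and time budget\<close>

text \<open>For the least such \<open>k\<close>, if positive, \<open>\<epsilon>\<close> is below the
  power with exponent \<open>k - 1\<close>, and \<open>ln (2/3) \<le> -1/3\<close>.\<close>

lemma iterations_exist:
  fixes \<epsilon> :: real
  assumes "0 < \<epsilon>" "\<epsilon> < 1"
  obtains k :: nat where "\<forall>i<k. \<epsilon> < (2/3) ^ i" "(2/3) ^ k \<le> \<epsilon>" "real k \<le> 1 + 3 * ln (1 / \<epsilon>)"
proof -
  define k where "k = (LEAST k. (2/3) ^ k \<le> \<epsilon>)"
  have "\<exists>k. (2/3) ^ k < \<epsilon>" using assms by (intro real_arch_pow_inv) auto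
  then have "\<exists>k. (2/3) ^ k \<le> \<epsilon>" by (meson less_imp_le)
  then have k: "(2/3) ^ k \<le> \<epsilon>" unfolding k_def by (rule LeastI_ex)
  have less: "\<epsilon> < (2/3) ^ i" if "i < k" for i
    using not_less_Least[of i] that unfolding k_def by force
  have "real k \<le> 1 + 3 * ln (1 / \<epsilon>)"
  proof (cases k)
    case 0
    have "0 \<le> ln (1 / \<epsilon>)" using assms by (intro ln_ge_zero) auto
    then show ?thesis using 0 by simp
  next
    case (Suc j)
    have "\<epsilon> < (2/3) ^ j" using less[of j] Suc by simp
    then have "ln \<epsilon> < ln ((2/3) ^ j)" using assms by (subst ln_less_cancel_iff) auto
    also have "ln ((2/3 :: real) ^ j) = j * ln (2/3)" by (rule ln_realpow)
    also have "\<dots> \<le> j * (2/3 - 1)" by (intro mult_left_mono ln_le_minus_one) auto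
    finally show ?thesis using Suc assms by (simp add: ln_div)
  qed
  then show thesis using that less k by blast
qed

lemma (in lsq) nnz_eq: "nnz A = nz"
proof -
  have "nnz A = card (set ps)"
    using A unfolding nnz_def ps_set(2) by simp
  then show ?thesis using distinct_card[OF ps_set(1)] by (simp add: nz_def)
qed

lemma (in lsq) nz_le: "nz \<le> n * d"
proof -
  have "set ps \<subseteq> {..<n} \<times> {..<d}" using ps_set by auto
  then have "card (set ps) \<le> card ({..<n} \<times> {..<d})" by (intro card_mono) auto
  then show ?thesis using distinct_card[OF ps_set(1)] by (simp add: nz_def)
qed

context lsq
begin

lemma size_bounds:
  assumes K: "\<forall>k<K. 2 ^ k < 32768 * (D * D)" "32768 * (D * D) \<le> 2 ^ K"
  shows "1 \<le> K" "N \<le> 65536 * (D * D)" "K \<le> N"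
proof -
  have DD1: "1 \<le> D * D" by (simp add: Suc_leI)
  show K1: "1 \<le> K"
  proof (rule ccontr)
    assume "\<not> 1 \<le> K"
    then have "K = 0" by simp
    then have "32768 * (D * D) \<le> 1" using K(2) by simp
    then show False using DD1 by linarith
  qed
  have "2 ^ (K - 1) < 32768 * (D * D)" using K(1) K1 by simp
  moreover have "N = 2 * 2 ^ (K - 1)" using K1 by (simp add: N_def power_eq_if)
  ultimately show "N \<le> 65536 * (D * D)" by simp
  show "K \<le> N" unfolding N_def by (rule less_imp_le) (rule less_exp)
qed

text \<open>As \<open>2 \<le> n + d\<close>, constants are absorbed as powers of \<open>S\<close>.
  The exponent 50 is 43 + 7, from the bound \<open>2 ^ 43 * S ^ 7\<close> for the Gram loop.\<close>

lemma word_bounds: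
  assumes K: "\<forall>k<K. 2 ^ k < 32768 * (D * D)" "32768 * (D * D) \<le> 2 ^ K"
  defines "S \<equiv> n + d"
  shows "K * (N * D) \<le> S ^ 50" "m * (D * D) \<le> S ^ 50" "nz \<le> S ^ 50" "2 * N \<le> S ^ 50"
proof -
  note B = size_bounds[OF K]
  have S2: "2 \<le> S" and DS: "D \<le> S" and S0: "0 < S" using n d by (auto simp: S_def D_def simp del: Suc_d)
  have p2: "2 ^ i * S ^ j \<le> S ^ 50" if "i + j \<le> 50" for i j
  proof -
    have "2 ^ i * S ^ j \<le> S ^ i * S ^ j" using S2 by (intro mult_right_mono power_mono) auto
    also have "\<dots> \<le> S ^ 50" using S2 that by (simp flip: power_add add: power_increasing)
    finally show ?thesis .
  qed
  have DD: "D * D \<le> S ^ 2" using mult_le_mono[OF DS DS] by (simp add: power2_eq_square)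
  have NS: "N \<le> 2 ^ 16 * S ^ 2" by (rule order_trans[OF B(2)]) (use mult_le_mono2[OF DD, of 65536] in simp)
  have KS: "K \<le> 2 ^ 16 * S ^ 2" using B(3) NS by (rule order_trans)
  have "K * (N * D) \<le> (2 ^ 16 * S ^ 2) * ((2 ^ 16 * S ^ 2) * S)"
    by (intro mult_le_mono KS NS DS)
  also have "\<dots> = 2 ^ 32 * S ^ 5" by (simp add: power2_eq_square power_numeral_reduce)
  also have "\<dots> \<le> S ^ 50" by (rule p2) simp
  finally show "K * (N * D) \<le> S ^ 50" .
  have "m * (D * D) \<le> (2 ^ 11 * ((2 ^ 16 * S ^ 2) * (2 ^ 16 * S ^ 2)) * S) * S ^ 2"
    unfolding m_def power2_eq_square[of K] by (intro mult_le_mono KS DS DD) simp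
  also have "\<dots> = 2 ^ 43 * S ^ 7" by (simp add: power2_eq_square power_numeral_reduce)
  also have "\<dots> \<le> S ^ 50" by (rule p2) simp
  finally show "m * (D * D) \<le> S ^ 50" .
  have "nz \<le> S * S" by (rule order_trans[OF nz_le]) (simp add: S_def mult_le_mono)
  also have "\<dots> = 2 ^ 0 * S ^ 2" by (simp add: power2_eq_square)
  also have "\<dots> \<le> S ^ 50" by (rule p2) simp
  finally show "nz \<le> S ^ 50" .
  have "2 * N \<le> 2 * (2 ^ 16 * S ^ 2)" using NS by simp
  also have "\<dots> = 2 ^ 17 * S ^ 2" by simp
  also have "\<dots> \<le> S ^ 50" by (rule p2) simp
  finally show "2 * N \<le> S ^ 50" .
qed

text \<open>Minimality of \<open>K\<close> gives \<open>2 ^ K \<le> 2 ^ 18 * d^2\<close>; the 3 is 2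
  divided by the lower bound 2/3 for \<open>ln 2\<close>.\<close>

lemma K_le_log:
  assumes K: "\<forall>k<K. 2 ^ k < 32768 * (D * D)" "32768 * (D * D) \<le> 2 ^ K"
  shows "real K \<le> 18 + 3 * ln d"
proof -
  have d0: "0 < real d" and D2: "D \<le> 2 * d" using d by (auto simp: D_def simp del: Suc_d)
  have "D * D \<le> (2 * d) * (2 * d)" using D2 by (intro mult_le_mono)
  then have "N \<le> 65536 * ((2 * d) * (2 * d))" using size_bounds(2)[OF K] by linarith
  then have "real N \<le> 2 ^ 18 * (real d)\<^sup>2"
    by (simp add: power2_eq_square flip: of_nat_le_iff[where 'a = real])
  then have "ln (2 ^ K) \<le> ln (2 ^ 18 * (real d)\<^sup>2)"
    using d0 by (subst ln_le_cancel_iff) (auto simp: N_def)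
  also have "\<dots> = ln (2 ^ 18) + ln ((real d)\<^sup>2)" using d0 by (intro ln_mult_pos) auto
  also have "ln (2 ^ 18 :: real) = 18 * ln 2" by (simp only: ln_realpow of_nat_numeral)
  also have "ln ((real d)\<^sup>2) = 2 * ln d" by (simp only: ln_realpow of_nat_numeral)
  also have "ln (2 ^ K :: real) = K * ln 2" by (rule ln_realpow)
  finally have "K * ln 2 \<le> 18 * ln 2 + 2 * ln d" .
  then have 1: "(real K - 18) * ln 2 \<le> 2 * ln d" by (simp add: algebra_simps)
  have 2: "0 \<le> ln (real d)" using d by simp
  show ?thesis
  proof (cases "real K \<le> 18")
    case True then show ?thesis using 2 by simp
  next
    case False
    then have "(real K - 18) * (2/3) \<le> (real K - 18) * ln 2" using ln2_ge_two_thirds by (intro mult_left_mono) auto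
    then show ?thesis using 1 by simp
  qed
qed

definition "cube_term = real d ^ 3 * (ln (real d)) ^ 2"
definition "nnz_term = real nz * ln (real n / \<epsilon>)"
definition "square_term = real d ^ 2 * ln (1 / \<epsilon>)"

definition budget :: real where
  "budget = 1 + nnz_term + cube_term + square_term"

lemma logs: "0 < ln (1 / \<epsilon>)" "ln (1 / \<epsilon>) \<le> ln (real n / \<epsilon>)" "0 \<le> ln (real n / \<epsilon>)" "0 \<le> ln (real d)"
proof -
  show 1: "0 < ln (1 / \<epsilon>)" using eps by (intro ln_gt_zero) auto
  show 2: "ln (1 / \<epsilon>) \<le> ln (real n / \<epsilon>)"
    using eps n by (subst ln_le_cancel_iff) (auto simp: divide_right_mono)
  show "0 \<le> ln (real n / \<epsilon>)" using 1 2 by linarith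
  show "0 \<le> ln (real d)" using d by simp
qed

lemma budget_parts: "0 \<le> nnz_term" "0 \<le> cube_term" "0 \<le> square_term"
  using logs by (auto simp: nnz_term_def cube_term_def square_term_def)

text \<open>For \<open>d = 1\<close> the cubic term vanishes and the summand 1 covers the constant
  324. Otherwise \<open>18 \<le> 27 * ln d\<close>, so the base is at most \<open>30 * ln d\<close>,
  and 900 is the square of 30.\<close>

lemma log_cube_le: "(18 + 3 * ln (real d))\<^sup>2 * real d ^ 3 \<le> 900 * (1 + cube_term)"
proof (cases "d = 1")
  case True then show ?thesis using budget_parts(2) by simp
next
  case False
  then have d2: "2 \<le> real d" using d by simp
  have "ln 2 \<le> ln (real d)" using d2 by simp
  then have "18 + 3 * ln (real d) \<le> 30 * ln (real d)" using ln2_ge_two_thirds by simp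
  then have "(18 + 3 * ln (real d))\<^sup>2 \<le> (30 * ln (real d))\<^sup>2" using logs(4) by (intro power_mono) auto
  then have "(18 + 3 * ln (real d))\<^sup>2 * real d ^ 3 \<le> (30 * ln (real d))\<^sup>2 * real d ^ 3" by (intro mult_right_mono) auto
  then show ?thesis by (simp add: cube_term_def power_mult_distrib mult.commute)
qed

lemma cube_le: "real d ^ 3 \<le> 3 * (1 + cube_term)"
proof -
  have "18\<^sup>2 \<le> (18 + 3 * ln (real d))\<^sup>2" using logs(4) by (intro power_mono) auto
  then have "324 * real d ^ 3 \<le> (18 + 3 * ln (real d))\<^sup>2 * real d ^ 3" by (intro mult_right_mono) auto
  also note log_cube_le
  finally show ?thesis using budget_parts(2) by simp
qed

lemma square_le_cube: "real d ^ 2 \<le> real d ^ 3" "real d \<le> real d ^ 3" "1 \<le> real d ^ 3"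
  using d by (auto intro: power_increasing self_le_power one_le_power)

text \<open>\<open>ln (n / \<epsilon>)\<close> stays away from 0 only if \<open>n \<ge> 2\<close>.
  For \<open>n = 1\<close> there are at most \<open>d\<close> nonzeros, which the cubic term pays
  for.\<close>

lemma nz_le_budget: "real nz \<le> 3 * budget"
proof (cases "n = 1")
  case True
  then have "real nz \<le> real d" using nz_le by simp
  also note square_le_cube(2)
  also note cube_le
  finally show ?thesis using budget_parts unfolding budget_def by simp
next
  case False
  then have n2: "2 \<le> real n" using n by simp
  have "2 \<le> real n / \<epsilon>" using n2 eps by (simp add: le_divide_eq)
  then have "ln 2 \<le> ln (real n / \<epsilon>)" by (subst ln_le_cancel_iff) auto
  then have "real nz * (2/3) \<le> nnz_term" unfolding nnz_term_def using ln2_ge_two_thirds by (intro mult_left_mono) auto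
  then show ?thesis using budget_parts unfolding budget_def by simp
qed

text \<open>The transform and the Gram matrix dominate the constant: 4194304 * 900 is about 3.8 *
  10^9. The rounds are paid by \<open>ln (1 / \<epsilon>) \<le> ln (n / \<epsilon>)\<close> for the
  passes over the nonzeros, and by the quadratic and cubic terms for the products with
  \<open>P\<close>.\<close>

lemma time_bound:
  assumes K: "\<forall>k<K. 2 ^ k < 32768 * (D * D)" "32768 * (D * D) \<le> 2 ^ K"
    and k: "real k \<le> 1 + 3 * ln (1 / \<epsilon>)"
    and T: "T \<le> 4 * K + 4 * nz + 4 * m + 16 + (16 * nz + 4 * (K * (N * D)) + 4 * (m * (D * D)) + 16 * (D * D * D)
        + 16 * D + 8 * d + 45 + k * (12 * d + 8 * nz + 4 * (d * d) + 26))"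
  shows "real T \<le> 10000000000 * budget"
proof -
  define X where "X = K\<^sup>2 * d ^ 3"
  note B = size_bounds[OF K]
  have D2: "D \<le> 2 * d" using d by (auto simp: D_def simp del: Suc_d)
  have d3: "d \<le> d ^ 3" "1 \<le> d ^ 3" "d * d \<le> d ^ 3" using d by (auto simp: power3_eq_cube)
  have K2: "1 \<le> K\<^sup>2" "K \<le> K\<^sup>2" using B(1) by (auto simp: power2_eq_square)
  have D3: "D * D * D \<le> 8 * d ^ 3"
    using mult_le_mono[OF mult_le_mono[OF D2 D2] D2] by (simp add: power3_eq_cube mult_ac)
  have X1: "d ^ 3 \<le> X" "K\<^sup>2 \<le> X" using K2 d3 mult_le_mono[of 1 "K\<^sup>2" "d ^ 3" "d ^ 3"] mult_le_mono[of "K\<^sup>2" "K\<^sup>2" 1 "d ^ 3"]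
    by (simp_all add: X_def)
  have t1: "4 * (K * (N * D)) \<le> 2097152 * X"
  proof -
    have "K * (N * D) \<le> K\<^sup>2 * ((65536 * (D * D)) * D)" by (intro mult_le_mono K2 B(2) order_refl)
    also have "\<dots> = 65536 * (K\<^sup>2 * (D * D * D))" by simp
    also have "\<dots> \<le> 65536 * (K\<^sup>2 * (8 * d ^ 3))" by (intro mult_le_mono order_refl D3)
    finally have "K * (N * D) \<le> 524288 * X" by (simp add: X_def)
    then show ?thesis by linarith
  qed
  have t2: "4 * (m * (D * D)) \<le> 65536 * X"
  proof -
    have "m * (D * D) = 2048 * (K\<^sup>2 * (D * D * D))" by (simp add: m_def)
    also have "\<dots> \<le> 2048 * (K\<^sup>2 * (8 * d ^ 3))" by (intro mult_le_mono order_refl D3)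
    finally have "m * (D * D) \<le> 16384 * X" by (simp add: X_def)
    then show ?thesis by linarith
  qed
  have t3: "4 * m \<le> 16384 * X"
  proof -
    have "m \<le> 2048 * (K\<^sup>2 * (2 * d ^ 3))" unfolding m_def mult.assoc
      by (intro mult_le_mono order_refl order_trans[OF D2]) (use d3 in simp)
    then have "m \<le> 4096 * X" by (simp add: X_def)
    then show ?thesis by linarith
  qed
  have t4: "k * (12 * d + 8 * nz + 4 * (d * d) + 26) \<le> k * (8 * nz) + k * (42 * d ^ 2)"
  proof -
    have "d \<le> d * d" "1 \<le> d * d" using d by (auto simp: Suc_leI)
    then have "12 * d + 8 * nz + 4 * (d * d) + 26 \<le> 8 * nz + 42 * (d * d)" by linarith
    then show ?thesis by (simp add: power2_eq_square flip: distrib_left)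
  qed
  have "T \<le> 20 * nz + 4194304 * X + (k * (8 * nz) + k * (42 * d ^ 2))"
    using T t1 t2 t3 t4 D3 X1 K2(2) d3 D2 by linarith
  then have "real T \<le> real (20 * nz + 4194304 * X + (k * (8 * nz) + k * (42 * d ^ 2)))" by (rule of_nat_mono)
  then have T': "real T \<le> 20 * real nz + 4194304 * real X + (real k * (8 * real nz) + real k * (42 * real d ^ 2))" by simp
  have "real X \<le> 900 * (1 + cube_term)"
  proof -
    have "(real K)\<^sup>2 \<le> (18 + 3 * ln (real d))\<^sup>2" using K_le_log[OF K] by (intro power_mono) auto
    then have "real X \<le> (18 + 3 * ln (real d))\<^sup>2 * real d ^ 3" by (simp add: X_def mult_right_mono)
    also note log_cube_le
    finally show ?thesis .
  qed
  then have X: "real X \<le> 900 * budget" using budget_parts unfolding budget_def by simp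
  let ?L = "ln (1 / \<epsilon>)"
  have "real k * (8 * real nz) \<le> (1 + 3 * ?L) * (8 * real nz)" using k by (intro mult_right_mono) auto
  also have "\<dots> = 8 * real nz + 24 * (real nz * ?L)" by (simp add: algebra_simps)
  also have "\<dots> \<le> 8 * (3 * budget) + 24 * nnz_term"
    unfolding nnz_term_def using nz_le_budget logs by (intro add_mono mult_left_mono) auto
  also have "\<dots> \<le> 48 * budget" using budget_parts unfolding budget_def by simp
  finally have k1: "real k * (8 * real nz) \<le> 48 * budget" .
  have "real k * (42 * real d ^ 2) \<le> (1 + 3 * ?L) * (42 * real d ^ 2)" using k by (intro mult_right_mono) auto
  also have "\<dots> = 42 * real d ^ 2 + 126 * square_term" by (simp add: square_term_def algebra_simps)
  also have "\<dots> \<le> 126 * budget"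
    using order_trans[OF square_le_cube(1) cube_le] budget_parts unfolding budget_def by simp
  finally have k2: "real k * (42 * real d ^ 2) \<le> 126 * budget" .
  have "0 \<le> budget" using budget_parts unfolding budget_def by simp
  then show ?thesis using T' X k1 k2 nz_le_budget by simp
qed

end

theorem theorem2p17:
  shows "\<exists>(P :: com) (C :: real) (k :: nat). C > 0 \<and>
    (\<forall>(n :: nat) (d :: nat) (A :: real mat) (b :: real vec) (\<epsilon> :: real) (ps :: (nat \<times> nat) list).
       n \<ge> 1 \<longrightarrow> d \<ge> 1 \<longrightarrow> A \<in> carrier_mat n d \<longrightarrow> b \<in> carrier_vec n \<longrightarrow>
       0 < \<epsilon> \<longrightarrow> \<epsilon> < 1 \<longrightarrow> lists_nonzeros ps A \<longrightarrow>
       (\<exists>T :: nat.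
          real T \<le> C * (1 + real (nnz A) * ln (real n / \<epsilon>) + real d ^ 3 * (ln (real d)) ^ 2
                           + real d ^ 2 * ln (1 / \<epsilon>)) \<and>
          halts_within ((n + d) ^ k) T P (input_memory ps A b \<epsilon>) \<and>
          measure_pmf.prob (outcome ((n + d) ^ k) T P (input_memory ps A b \<epsilon>))
            {Some ([], m) | m. approx_solution A b \<epsilon> (output_vector d m)} \<ge> 99 / 100))"
proof (rule exI[of _ Least_Squares], rule exI[of _ "10000000000"], rule exI[of _ 50], intro conjI allI impI)
  fix n d :: nat and A :: "real mat" and b :: "real vec" and \<epsilon> :: real and ps :: "(nat \<times> nat) list"
  assume as: "n \<ge> 1" "d \<ge> 1" "A \<in> carrier_mat n d" "b \<in> carrier_vec n" "0 < \<epsilon>" "\<epsilon> < 1" "lists_nonzeros ps A"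
  define K where "K = (LEAST k. 32768 * (Suc d * Suc d) \<le> 2 ^ k)"
  interpret lsq n d A b \<epsilon> ps K "(n + d) ^ 50"
    by unfold_locales (fact as)+
  have "\<exists>k. 32768 * (D * D) \<le> 2 ^ k"
    by (rule exI[of _ "32768 * (D * D)"]) (rule less_imp_le, rule less_exp)
  then have K2: "32768 * (D * D) \<le> 2 ^ K" unfolding K_def Suc_d by (rule LeastI_ex)
  have K1: "\<forall>k<K. 2 ^ k < 32768 * (D * D)"
    using not_less_Least[of _ "\<lambda>k. 32768 * (D * D) \<le> 2 ^ k"] unfolding K_def Suc_d by (simp add: not_le)
  obtain k where k: "\<forall>i<k. \<epsilon> < (2/3) ^ i" "(2/3) ^ k \<le> \<epsilon>" "real k \<le> 1 + 3 * ln (1 / \<epsilon>)"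
    using iterations_exist[OF as(5,6)] by blast
  from run_Least_Squares[OF K1 K2 word_bounds[OF K1 K2] k(1,2)]
  obtain T where T: "T \<le> 4 * K + 4 * nz + 4 * m + 16 + (16 * nz + 4 * (K * (N * D)) + 4 * (m * (D * D)) + 16 * (D * D * D)
        + 16 * D + 8 * d + 45 + k * (12 * d + 8 * nz + 4 * (d * d) + 26))"
    and run: "halts_within ((n + d) ^ 50) T Least_Squares (input_memory ps A b \<epsilon>)"
    "measure_pmf.prob (outcome ((n + d) ^ 50) T Least_Squares (input_memory ps A b \<epsilon>))
      {Some ([], m) | m. approx_solution A b \<epsilon> (output_vector d m)} \<ge> 99 / 100"
    by blast
  have "real T \<le> 10000000000 * budget" by (rule time_bound[OF K1 K2 k(3) T])
  then show "\<exists>T :: nat. real T \<le> 10000000000 * (1 + real (nnz A) * ln (real n / \<epsilon>) + real d ^ 3 * (ln (real d)) ^ 2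
                           + real d ^ 2 * ln (1 / \<epsilon>)) \<and>
          halts_within ((n + d) ^ 50) T Least_Squares (input_memory ps A b \<epsilon>) \<and>
          measure_pmf.prob (outcome ((n + d) ^ 50) T Least_Squares (input_memory ps A b \<epsilon>))
            {Some ([], m) | m. approx_solution A b \<epsilon> (output_vector d m)} \<ge> 99 / 100"
    using run unfolding budget_def nnz_term_def cube_term_def square_term_def nnz_eq by blast
qed simp

end
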